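(* Assume the CFL condition $1-C_{\rm inv}^2\frac{(\Delta t)^2}{2h_{\mathscr T}^{2s}}\ge\theta>0$ with $\theta\in(0,1)$. The leapfrog fully discrete scheme is stable: its solution $V_{\Delta t}=\{V_k\}_{k=0}^K$ satisfies, for $\ell\in\{1,\dots,K\}$, $$\|\operatorname{tr}\mathfrak dV_\ell\|_{L^2(\Omega)}+\|V_\ell\|_{\mathcal C}\lesssim\|\operatorname{tr}\mathfrak dV_1\|_{L^2(\Omega)}+\|V_0\|_{\mathcal C}+\|V_1\|_{\mathcal C}+\sum_{k=1}^\ell\Delta t\,\|f_k\|_{L^2(\Omega)},$$ where the hidden constant is independent of $V_{\Delta t}$, $\Delta t$ and $h_{\mathscr T}$ but depends on $\theta$.
   Context: $\Omega\subset\mathbb R^n$ ($n\ge1$) is an open, bounded, convex polytope. $A\in C^{0,1}(\Omega,GL(n,\mathbb R))$ is symmetric and uniformly positive definite, $0\le c\in L^\infty(\Omega)$; $(\lambda_k,\varphi_k)_{k\ge1}$ are the Dirichlet eigenpairs of $\mathcal Lw=-\operatorname{div}(A\nabla w)+cw$ with $\{\varphi_k\}$ an orthonormal basis of $L^2(\Omega)$. $\mathbb H^r(\Omega)=\{w=\sum_k w_k\varphi_k:\|w\|^2_{\mathbb H^r(\Omega)}=\sum_k\lambda_k^r|w_k|^2<\infty\}$ for $r\ge0$. $s\in(0,1)$, $\alpha=1-2s$, $d_s=2^\alpha\Gamma(1-s)/\Gamma(s)$, $\mathbf A=\operatorname{diag}\{A,1\}$, $\mathcal Y>0$, $\mathcal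 C_{\mathcal Y}=\Omega\times(0,\mathcal Y)$; $\mathring H^1_L(y^\alpha,\mathcal C_{\mathcal Y})$ is the space of $w\in H^1(y^\alpha,\mathcal C_{\mathcal Y})$ vanishing on $\partial\Omega\times(0,\mathcal Y)$ and $\Omega\times\{\mathcal Y\}$; $a_{\mathcal Y}(w,\phi)=\frac1{d_s}\int_{\mathcal C_{\mathcal Y}}y^\alpha(\mathbf A\nabla w\cdot\nabla\phi+c\,w\phi)\,dx$; $\|w\|_{\mathcal C}^2=a_{\mathcal Y}(w,w)$; $\operatorname{tr}$ is the trace onto $\Omega\times\{0\}$; $\langle\cdot,\cdot\rangle$ is the $\mathbb H^{-s}$–$\mathbb H^s$ pairing ($L^2(\Omega)$ inner product on $L^2$ functions). $\mathcal H_\alpha w$, for $w\in\mathbb H^s(\Omega)$, is the function in $\mathring H^1_L(y^\alpha,\mathcal C_{\mathcal Y})$ with trace $w$ and $a_{\mathcal Y}(\mathcal H_\alpha w,\phi)=0$ for all $\phi$ in that space with $\operatorname{tr}\phi=0$. $\mathscr T$ is a conforming simplicial mesh of $\overline\Omega$ with maximal element diameter $h_{\mathscr T}$, $S^1_0(\Omega,\mathscr T)$ the continuous piecewise linear functions vanishing on $\partial\Omega$; for $\sigma\in(0,1)$, $M\in\mathbb N$, $[0,\mathcal Y]$ is split into $I_1=[0,\mathcal Y\sigma^{M-1}]$, $I_m=[\mathcal Y\sigma^{M-m+1},\mathcal Y\sigma^{M-m}]$, $2\le m\le M$; $S^{\boldsymbol r}_{\{\mathcal Y\}}$ is the space of $v\in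 C[0,\mathcal Y]$ with $v|_{I_m}\in\mathbb P_{r_m}$, $v(\mathcal Y)=0$, $r_m=\max\{1,\lceil\mathfrak sm\rceil\}$; $\mathbb V(\mathscr T_{\mathcal Y})=S^1_0(\Omega,\mathscr T)\otimes S^{\boldsymbol r}_{\{\mathcal Y\}}$. $G_{\mathscr T_{\mathcal Y}}w\in\mathbb V(\mathscr T_{\mathcal Y})$ is defined by $a_{\mathcal Y}(G_{\mathscr T_{\mathcal Y}}w,W)=a_{\mathcal Y}(w,W)$ for all $W\in\mathbb V(\mathscr T_{\mathcal Y})$. $C_{\rm inv}>0$ is a constant such that $\|X\|_{\mathcal C}\le C_{\rm inv}h_{\mathscr T}^{-s}\|\operatorname{tr}X\|_{L^2(\Omega)}$ for every $X\in\mathbb V(\mathscr T_{\mathcal Y})$ which, for some $\eta\in\mathbb H^{-s}(\Omega)$, satisfies $a_{\mathcal Y}(X,W)=\langle\eta,\operatorname{tr}W\rangle$ for all $W\in\mathbb V(\mathscr T_{\mathcal Y})$. Time grid: $K\in\mathbb N$, $\Delta t=T/K$, $t_k=k\Delta t$; $f_k=f(t_k)\in L^2(\Omega)$ for $f\in C([0,T];L^2(\Omega))$; $\mathfrak dw_{k+1}=(w_{k+1}-w_k)/\Delta t$. Leapfrog scheme: $V_0=G_{\mathscr T_{\mathcal Y}}\mathcal H_\alpha g$, $V_1=G_{\mathscr T_{\mathcal Y}}(\mathcal H_\alpha g+\Delta t\,\mathcal H_\alpha h+\frac12(\Delta t)^2\mathcal H_\alpha w)$, where $g,h\in\mathbb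 H^s(\Omega)$ and $w\in\mathbb H^s(\Omega)$ (assumed to exist) satisfies $\langle w,\operatorname{tr}\phi\rangle=-a_{\mathcal Y}(\mathcal H_\alpha g,\phi)+\langle f(0),\operatorname{tr}\phi\rangle$ for all $\phi\in\mathring H^1_L(y^\alpha,\mathcal C_{\mathcal Y})$; for $k=1,\dots,K-1$, $V_{k+1}\in\mathbb V(\mathscr T_{\mathcal Y})$ solves $$\tfrac1{\Delta t^2}\langle\operatorname{tr}(V_{k+1}-2V_k+V_{k-1}),\operatorname{tr}W\rangle+a_{\mathcal Y}(V_k,W)=\langle f_k,\operatorname{tr}W\rangle\quad\forall W\in\mathbb V(\mathscr T_{\mathcal Y}).$$ This determines $\operatorname{tr}V_{k+1}$, and $V_{k+1}$ is the discrete extension of its trace, i.e. $a_{\mathcal Y}(V_{k+1},W)=0$ for all $W\in\mathbb V(\mathscr T_{\mathcal Y})$ with $\operatorname{tr}W=0$ (as the next time step requires). $a\lesssim b$ means $a\le Cb$ with $C$ having the stated independence. *)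

theory Defs
  imports "HOL-Analysis.Analysis" "HOL-Computational_Algebra.Polynomial"
begin

text \<open>Functions are total; only their values on the domain in question matter, and elements of
  Lebesgue and Sobolev spaces are represented by functions that are determined almost everywhere.\<close>

subsection \<open>Weighted Lebesgue and Sobolev spaces\<close>

definition L2w :: "('a::euclidean_space \<Rightarrow> real) \<Rightarrow> 'a set \<Rightarrow> ('a \<Rightarrow> 'b::euclidean_space) set" where
  "L2w \<rho> U = {f. f \<in> borel_measurable (lebesgue_on U) \<and>
                 integrable (lebesgue_on U) (\<lambda>x. \<rho> x * (norm (f x))\<^sup>2)}"

definition L2 :: "'a::euclidean_space set \<Rightarrow> ('a \<Rightarrow> real) set" where
  "L2 U = L2w (\<lambda>_. 1) U"

definition L2_inner :: "'a::euclidean_space set \<Rightarrow> ('a \<Rightarrow> real) \<Rightarrow> ('a \<Rightarrow> real) \<Rightarrow> real" where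
  "L2_inner U f g = (LINT x|lebesgue_on U. f x * g x)"

definition L2_norm :: "'a::euclidean_space set \<Rightarrow> ('a \<Rightarrow> real) \<Rightarrow> real" where
  "L2_norm U f = sqrt (L2_inner U f f)"

text \<open>A test function is a compactly supported \<open>C\<^sup>1\<close> function; by mollification, testing with these
  or with smooth functions yields the same weak gradients and the same space \<open>H\<^sup>1\<^sub>0\<close>.\<close>

definition test_function :: "'a::euclidean_space set \<Rightarrow> ('a \<Rightarrow> real) \<Rightarrow> ('a \<Rightarrow> 'a) \<Rightarrow> bool" where
  "test_function U \<psi> \<psi>' \<longleftrightarrow>
     (\<forall>x. (\<psi> has_derivative (\<lambda>h. \<psi>' x \<bullet> h)) (at x)) \<and> continuous_on UNIV \<psi>' \<and>
     (\<exists>S. compact S \<and> S \<subseteq> U \<and> (\<forall>x. x \<notin> S \<longrightarrow> \<psi> x = 0))"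

definition locally_integrable :: "'a::euclidean_space set \<Rightarrow> ('a \<Rightarrow> 'b::euclidean_space) \<Rightarrow> bool" where
  "locally_integrable U f \<longleftrightarrow> (\<forall>S. compact S \<and> S \<subseteq> U \<longrightarrow> integrable (lebesgue_on S) f)"

definition has_weak_gradient ::
  "'a::euclidean_space set \<Rightarrow> ('a \<Rightarrow> real) \<Rightarrow> ('a \<Rightarrow> 'a) \<Rightarrow> bool" where
  "has_weak_gradient U w g \<longleftrightarrow> locally_integrable U w \<and> locally_integrable U g \<and>
     (\<forall>\<psi> \<psi>'. test_function U \<psi> \<psi>' \<longrightarrow>
        (LINT x|lebesgue_on U. w x *\<^sub>R \<psi>' x) = - (LINT x|lebesgue_on U. \<psi> x *\<^sub>R g x))"

definition weak_gradient :: "'a::euclidean_space set \<Rightarrow> ('a \<Rightarrow> real) \<Rightarrow> 'a \<Rightarrow> 'a" where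
  "weak_gradient U w = (SOME g. has_weak_gradient U w g)"

definition H1w :: "('a::euclidean_space \<Rightarrow> real) \<Rightarrow> 'a set \<Rightarrow> ('a \<Rightarrow> real) set" where
  "H1w \<rho> U = {w. w \<in> L2w \<rho> U \<and> (\<exists>g. has_weak_gradient U w g) \<and> weak_gradient U w \<in> L2w \<rho> U}"

definition H1w_norm :: "('a::euclidean_space \<Rightarrow> real) \<Rightarrow> 'a set \<Rightarrow> ('a \<Rightarrow> real) \<Rightarrow> real" where
  "H1w_norm \<rho> U w = sqrt ((LINT x|lebesgue_on U. \<rho> x * (w x)\<^sup>2) +
                          (LINT x|lebesgue_on U. \<rho> x * (norm (weak_gradient U w x))\<^sup>2))"

definition H1w_tendsto ::
  "('a::euclidean_space \<Rightarrow> real) \<Rightarrow> 'a set \<Rightarrow> (nat \<Rightarrow> 'a \<Rightarrow> real) \<Rightarrow> ('a \<Rightarrow> real) \<Rightarrow> bool" where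
  "H1w_tendsto \<rho> U v w \<longleftrightarrow> (\<lambda>j. H1w_norm \<rho> U (\<lambda>x. v j x - w x)) \<longlonglongrightarrow> 0"

definition H10 :: "'a::euclidean_space set \<Rightarrow> ('a \<Rightarrow> real) set" where
  "H10 U = {w \<in> H1w (\<lambda>_. 1) U.
     \<exists>v. (\<forall>j. \<exists>v'. test_function U (v j) v') \<and> H1w_tendsto (\<lambda>_. 1) U v w}"

text \<open>Functions vanishing on a part \<open>\<Gamma>\<close> of the boundary: the closure in the weighted \<open>H\<^sup>1\<close> norm of
  those members that are continuous up to the boundary and are zero at every point of \<open>\<Gamma>\<close>.\<close>

definition H1w_vanishing ::
  "('a::euclidean_space \<Rightarrow> real) \<Rightarrow> 'a set \<Rightarrow> 'a set \<Rightarrow> ('a \<Rightarrow> real) set" where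
  "H1w_vanishing \<rho> U \<Gamma> = {w \<in> H1w \<rho> U.
     \<exists>v. (\<forall>j. v j \<in> H1w \<rho> U \<and> continuous_on (closure U) (v j) \<and> (\<forall>x\<in>\<Gamma>. v j x = 0)) \<and>
         H1w_tendsto \<rho> U v w}"

subsection \<open>The elliptic operator and its spectral spaces\<close>

definition open_convex_polytope :: "(real^'n) set \<Rightarrow> bool" where
  "open_convex_polytope \<Omega> \<longleftrightarrow>
     open \<Omega> \<and> \<Omega> \<noteq> {} \<and> bounded \<Omega> \<and> convex \<Omega> \<and> polytope (closure \<Omega>)"

definition admissible_coefficients ::
  "(real^'n) set \<Rightarrow> (real^'n \<Rightarrow> real^'n^'n) \<Rightarrow> (real^'n \<Rightarrow> real) \<Rightarrow> bool" where
  "admissible_coefficients \<Omega> A c \<longleftrightarrow>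
     (\<exists>L. L-lipschitz_on \<Omega> A) \<and>
     (\<forall>x\<in>\<Omega>. invertible (A x) \<and> transpose (A x) = A x) \<and>
     (\<exists>a>0. \<forall>x\<in>\<Omega>. \<forall>\<xi>. (A x *v \<xi>) \<bullet> \<xi> \<ge> a * (norm \<xi>)\<^sup>2) \<and>
     c \<in> borel_measurable (lebesgue_on \<Omega>) \<and>
     (\<exists>b. AE x in lebesgue_on \<Omega>. 0 \<le> c x \<and> c x \<le> b)"

text \<open>The eigenpairs are indexed from 0; \<open>\<mu> k\<close> is the eigenvalue.\<close>

definition dirichlet_eigensystem ::
  "(real^'n) set \<Rightarrow> (real^'n \<Rightarrow> real^'n^'n) \<Rightarrow> (real^'n \<Rightarrow> real) \<Rightarrow>
   (nat \<Rightarrow> real) \<Rightarrow> (nat \<Rightarrow> real^'n \<Rightarrow> real) \<Rightarrow> bool" where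
  "dirichlet_eigensystem \<Omega> A c \<mu> \<phi> \<longleftrightarrow>
     (\<forall>k. \<phi> k \<in> H10 \<Omega> \<and>
        (\<forall>v\<in>H10 \<Omega>. (LINT x|lebesgue_on \<Omega>.
             (A x *v weak_gradient \<Omega> (\<phi> k) x) \<bullet> weak_gradient \<Omega> v x + c x * \<phi> k x * v x)
           = \<mu> k * L2_inner \<Omega> (\<phi> k) v)) \<and>
     (\<forall>j k. L2_inner \<Omega> (\<phi> j) (\<phi> k) = (if j = k then 1 else 0)) \<and>
     (\<forall>w\<in>L2 \<Omega>. (\<lambda>N. L2_norm \<Omega> (\<lambda>x. w x - (\<Sum>k<N. L2_inner \<Omega> w (\<phi> k) * \<phi> k x))) \<longlonglongrightarrow> 0)"

definition Hs ::
  "(real^'n) set \<Rightarrow> (nat \<Rightarrow> real) \<Rightarrow> (nat \<Rightarrow> real^'n \<Rightarrow> real) \<Rightarrow> real \<Rightarrow> (real^'n \<Rightarrow> real) set" where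
  "Hs \<Omega> \<mu> \<phi> r = {w \<in> L2 \<Omega>. summable (\<lambda>k. \<mu> k powr r * (L2_inner \<Omega> w (\<phi> k))\<^sup>2)}"

definition Hs_norm ::
  "(real^'n) set \<Rightarrow> (nat \<Rightarrow> real) \<Rightarrow> (nat \<Rightarrow> real^'n \<Rightarrow> real) \<Rightarrow> real \<Rightarrow> (real^'n \<Rightarrow> real) \<Rightarrow> real" where
  "Hs_norm \<Omega> \<mu> \<phi> r w = sqrt (\<Sum>k. \<mu> k powr r * (L2_inner \<Omega> w (\<phi> k))\<^sup>2)"

text \<open>The dual space of \<open>Hs\<close>; the duality pairing is application, and an \<open>L\<^sup>2\<close> function \<open>f\<close> is
  identified with the functional \<open>L2_inner \<Omega> f\<close>.\<close>

definition Hs_dual ::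
  "(real^'n) set \<Rightarrow> (nat \<Rightarrow> real) \<Rightarrow> (nat \<Rightarrow> real^'n \<Rightarrow> real) \<Rightarrow> real \<Rightarrow>
   ((real^'n \<Rightarrow> real) \<Rightarrow> real) set" where
  "Hs_dual \<Omega> \<mu> \<phi> r = {\<eta>.
     (\<forall>u\<in>Hs \<Omega> \<mu> \<phi> r. \<forall>v\<in>Hs \<Omega> \<mu> \<phi> r. \<eta> (\<lambda>x. u x + v x) = \<eta> u + \<eta> v) \<and>
     (\<forall>u\<in>Hs \<Omega> \<mu> \<phi> r. \<forall>a. \<eta> (\<lambda>x. a * u x) = a * \<eta> u) \<and>
     (\<exists>B. \<forall>u\<in>Hs \<Omega> \<mu> \<phi> r. \<bar>\<eta> u\<bar> \<le> B * Hs_norm \<Omega> \<mu> \<phi> r u)}"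

subsection \<open>The extension problem on the truncated cylinder\<close>

definition cyl :: "(real^'n) set \<Rightarrow> real \<Rightarrow> ((real^'n) \<times> real) set" where
  "cyl \<Omega> Y = \<Omega> \<times> {0<..<Y}"

definition y_weight :: "real \<Rightarrow> (real^'n) \<times> real \<Rightarrow> real" where
  "y_weight s z = snd z powr (1 - 2 * s)"

definition HL :: "(real^'n) set \<Rightarrow> real \<Rightarrow> real \<Rightarrow> ((real^'n) \<times> real \<Rightarrow> real) set" where
  "HL \<Omega> s Y = H1w_vanishing (y_weight s) (cyl \<Omega> Y) (frontier \<Omega> \<times> {0<..<Y} \<union> \<Omega> \<times> {Y})"

text \<open>The trace onto the bottom of the cylinder is the extension by continuity of the restriction
  map of functions continuous up to the boundary.\<close>

definition has_trace ::
  "(real^'n) set \<Rightarrow> real \<Rightarrow> real \<Rightarrow> ((real^'n) \<times> real \<Rightarrow> real) \<Rightarrow> (real^'n \<Rightarrow> real) \<Rightarrow> bool" where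
  "has_trace \<Omega> s Y w g \<longleftrightarrow> w \<in> H1w (y_weight s) (cyl \<Omega> Y) \<and> g \<in> L2 \<Omega> \<and>
     (\<exists>v. (\<forall>j. v j \<in> H1w (y_weight s) (cyl \<Omega> Y) \<and> continuous_on (closure (cyl \<Omega> Y)) (v j)) \<and>
          H1w_tendsto (y_weight s) (cyl \<Omega> Y) v w \<and>
          (\<lambda>j. L2_norm \<Omega> (\<lambda>x. v j (x, 0) - g x)) \<longlonglongrightarrow> 0)"

definition tr ::
  "(real^'n) set \<Rightarrow> real \<Rightarrow> real \<Rightarrow> ((real^'n) \<times> real \<Rightarrow> real) \<Rightarrow> real^'n \<Rightarrow> real" where
  "tr \<Omega> s Y w = (SOME g. has_trace \<Omega> s Y w g)"

definition d_s :: "real \<Rightarrow> real" where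
  "d_s s = 2 powr (1 - 2 * s) * Gamma (1 - s) / Gamma s"

definition a_form ::
  "(real^'n) set \<Rightarrow> (real^'n \<Rightarrow> real^'n^'n) \<Rightarrow> (real^'n \<Rightarrow> real) \<Rightarrow> real \<Rightarrow> real \<Rightarrow>
   ((real^'n) \<times> real \<Rightarrow> real) \<Rightarrow> ((real^'n) \<times> real \<Rightarrow> real) \<Rightarrow> real" where
  "a_form \<Omega> A c s Y w \<psi> = 1 / d_s s *
     (LINT z|lebesgue_on (cyl \<Omega> Y). y_weight s z *
        ((let g = weak_gradient (cyl \<Omega> Y) w z in (A (fst z) *v fst g, snd g))
            \<bullet> weak_gradient (cyl \<Omega> Y) \<psi> z
         + c (fst z) * w z * \<psi> z))"

definition C_norm ::
  "(real^'n) set \<Rightarrow> (real^'n \<Rightarrow> real^'n^'n) \<Rightarrow> (real^'n \<Rightarrow> real) \<Rightarrow> real \<Rightarrow> real \<Rightarrow>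
   ((real^'n) \<times> real \<Rightarrow> real) \<Rightarrow> real" where
  "C_norm \<Omega> A c s Y w = sqrt (a_form \<Omega> A c s Y w w)"

text \<open>\<open>u\<close> is (a representative of) the extension \<open>\<H>\<^sub>\<alpha> w\<close>.\<close>

definition is_harmonic_extension ::
  "(real^'n) set \<Rightarrow> (real^'n \<Rightarrow> real^'n^'n) \<Rightarrow> (real^'n \<Rightarrow> real) \<Rightarrow> real \<Rightarrow> real \<Rightarrow>
   (real^'n \<Rightarrow> real) \<Rightarrow> ((real^'n) \<times> real \<Rightarrow> real) \<Rightarrow> bool" where
  "is_harmonic_extension \<Omega> A c s Y w u \<longleftrightarrow>
     u \<in> HL \<Omega> s Y \<and> has_trace \<Omega> s Y u w \<and>
     (\<forall>\<psi>\<in>HL \<Omega> s Y. has_trace \<Omega> s Y \<psi> (\<lambda>_. 0) \<longrightarrow> a_form \<Omega> A c s Y u \<psi> = 0)"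

subsection \<open>The discrete spaces\<close>

definition simplicial_mesh :: "(real^'n) set \<Rightarrow> (real^'n) set set \<Rightarrow> bool" where
  "simplicial_mesh \<Omega> \<T> \<longleftrightarrow>
     triangulation \<T> \<and> (\<forall>T\<in>\<T>. int CARD('n) simplex T) \<and> \<Union>\<T> = closure \<Omega>"

definition mesh_size :: "(real^'n) set set \<Rightarrow> real" where
  "mesh_size \<T> = Max (diameter ` \<T>)"

definition S10 :: "(real^'n) set \<Rightarrow> (real^'n) set set \<Rightarrow> (real^'n \<Rightarrow> real) set" where
  "S10 \<Omega> \<T> = {v. continuous_on (closure \<Omega>) v \<and>
     (\<forall>T\<in>\<T>. \<exists>a b. \<forall>x\<in>T. v x = a \<bullet> x + b) \<and> (\<forall>x\<in>frontier \<Omega>. v x = 0)}"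

definition geo_interval :: "real \<Rightarrow> real \<Rightarrow> nat \<Rightarrow> nat \<Rightarrow> real set" where
  "geo_interval Y \<sigma> M m =
     (if m = 1 then {0..Y * \<sigma> ^ (M - 1)} else {Y * \<sigma> ^ (M - m + 1)..Y * \<sigma> ^ (M - m)})"

definition lin_degree :: "real \<Rightarrow> nat \<Rightarrow> nat" where
  "lin_degree \<ss> m = nat (max 1 \<lceil>\<ss> * real m\<rceil>)"

definition Sr :: "real \<Rightarrow> real \<Rightarrow> nat \<Rightarrow> real \<Rightarrow> (real \<Rightarrow> real) set" where
  "Sr Y \<sigma> M \<ss> = {p. continuous_on {0..Y} p \<and>
     (\<forall>m\<in>{1..M}. \<exists>q. degree q \<le> lin_degree \<ss> m \<and> (\<forall>y\<in>geo_interval Y \<sigma> M m. p y = poly q y)) \<and>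
     p Y = 0}"

text \<open>The algebraic tensor product, realised as finite sums of products on the closed cylinder.\<close>

definition V_space ::
  "(real^'n) set \<Rightarrow> (real^'n) set set \<Rightarrow> real \<Rightarrow> real \<Rightarrow> nat \<Rightarrow> real \<Rightarrow>
   ((real^'n) \<times> real \<Rightarrow> real) set" where
  "V_space \<Omega> \<T> Y \<sigma> M \<ss> = {W. \<exists>N v p.
     (\<forall>i<N::nat. v i \<in> S10 \<Omega> \<T> \<and> p i \<in> Sr Y \<sigma> M \<ss>) \<and>
     (\<forall>x\<in>closure \<Omega>. \<forall>y\<in>{0..Y}. W (x, y) = (\<Sum>i<N. v i x * p i y))}"

text \<open>\<open>X\<close> is the Galerkin projection \<open>G w\<close>.\<close>

definition is_galerkin_projection ::
  "(real^'n) set \<Rightarrow> (real^'n \<Rightarrow> real^'n^'n) \<Rightarrow> (real^'n \<Rightarrow> real) \<Rightarrow> real \<Rightarrow> real \<Rightarrow>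
   ((real^'n) \<times> real \<Rightarrow> real) set \<Rightarrow>
   ((real^'n) \<times> real \<Rightarrow> real) \<Rightarrow> ((real^'n) \<times> real \<Rightarrow> real) \<Rightarrow> bool" where
  "is_galerkin_projection \<Omega> A c s Y \<V> w X \<longleftrightarrow>
     X \<in> \<V> \<and> (\<forall>W\<in>\<V>. a_form \<Omega> A c s Y X W = a_form \<Omega> A c s Y w W)"

definition inverse_inequality ::
  "(real^'n) set \<Rightarrow> (real^'n \<Rightarrow> real^'n^'n) \<Rightarrow> (real^'n \<Rightarrow> real) \<Rightarrow>
   (nat \<Rightarrow> real) \<Rightarrow> (nat \<Rightarrow> real^'n \<Rightarrow> real) \<Rightarrow> real \<Rightarrow> real \<Rightarrow>
   ((real^'n) \<times> real \<Rightarrow> real) set \<Rightarrow> real \<Rightarrow> real \<Rightarrow> bool" where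
  "inverse_inequality \<Omega> A c \<mu> \<phi> s Y \<V> h Cinv \<longleftrightarrow>
     (\<forall>X\<in>\<V>. (\<exists>\<eta>\<in>Hs_dual \<Omega> \<mu> \<phi> s. \<forall>W\<in>\<V>. a_form \<Omega> A c s Y X W = \<eta> (tr \<Omega> s Y W)) \<longrightarrow>
        C_norm \<Omega> A c s Y X \<le> Cinv * h powr (- s) * L2_norm \<Omega> (tr \<Omega> s Y X))"

subsection \<open>The leapfrog scheme\<close>

definition continuous_L2_valued ::
  "real \<Rightarrow> (real^'n) set \<Rightarrow> (real \<Rightarrow> real^'n \<Rightarrow> real) \<Rightarrow> bool" where
  "continuous_L2_valued T \<Omega> f \<longleftrightarrow> (\<forall>t\<in>{0..T}. f t \<in> L2 \<Omega> \<and>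
     ((\<lambda>\<tau>. L2_norm \<Omega> (\<lambda>x. f \<tau> x - f t x)) \<longlongrightarrow> 0) (at t within {0..T}))"

text \<open>For \<open>k \<ge> 1\<close>, the backward difference quotient of \<open>V\<close> at \<open>k\<close>.\<close>

definition dq :: "real \<Rightarrow> (nat \<Rightarrow> 'a \<Rightarrow> real) \<Rightarrow> nat \<Rightarrow> 'a \<Rightarrow> real" where
  "dq \<Delta>t V k = (\<lambda>z. (V k z - V (k - 1) z) / \<Delta>t)"

definition leapfrog_initial ::
  "(real^'n) set \<Rightarrow> (real^'n \<Rightarrow> real^'n^'n) \<Rightarrow> (real^'n \<Rightarrow> real) \<Rightarrow>
   (nat \<Rightarrow> real) \<Rightarrow> (nat \<Rightarrow> real^'n \<Rightarrow> real) \<Rightarrow> real \<Rightarrow> real \<Rightarrow>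
   ((real^'n) \<times> real \<Rightarrow> real) set \<Rightarrow> real \<Rightarrow> (real \<Rightarrow> real^'n \<Rightarrow> real) \<Rightarrow>
   (real^'n \<Rightarrow> real) \<Rightarrow> (real^'n \<Rightarrow> real) \<Rightarrow> (nat \<Rightarrow> (real^'n) \<times> real \<Rightarrow> real) \<Rightarrow> bool" where
  "leapfrog_initial \<Omega> A c \<mu> \<phi> s Y \<V> \<Delta>t f g h V \<longleftrightarrow>
     g \<in> Hs \<Omega> \<mu> \<phi> s \<and> h \<in> Hs \<Omega> \<mu> \<phi> s \<and>
     (\<exists>w\<in>Hs \<Omega> \<mu> \<phi> s. \<exists>Hg Hh Hw.
        is_harmonic_extension \<Omega> A c s Y g Hg \<and>
        is_harmonic_extension \<Omega> A c s Y h Hh \<and>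
        is_harmonic_extension \<Omega> A c s Y w Hw \<and>
        (\<forall>\<psi>\<in>HL \<Omega> s Y. L2_inner \<Omega> w (tr \<Omega> s Y \<psi>) =
            - a_form \<Omega> A c s Y Hg \<psi> + L2_inner \<Omega> (f 0) (tr \<Omega> s Y \<psi>)) \<and>
        is_galerkin_projection \<Omega> A c s Y \<V> Hg (V 0) \<and>
        is_galerkin_projection \<Omega> A c s Y \<V> (\<lambda>z. Hg z + \<Delta>t * Hh z + \<Delta>t\<^sup>2 / 2 * Hw z) (V 1))"

definition leapfrog_steps ::
  "(real^'n) set \<Rightarrow> (real^'n \<Rightarrow> real^'n^'n) \<Rightarrow> (real^'n \<Rightarrow> real) \<Rightarrow> real \<Rightarrow> real \<Rightarrow>
   ((real^'n) \<times> real \<Rightarrow> real) set \<Rightarrow> nat \<Rightarrow> real \<Rightarrow> (real \<Rightarrow> real^'n \<Rightarrow> real) \<Rightarrow>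
   (nat \<Rightarrow> (real^'n) \<times> real \<Rightarrow> real) \<Rightarrow> bool" where
  "leapfrog_steps \<Omega> A c s Y \<V> K \<Delta>t f V \<longleftrightarrow>
     (\<forall>k. 1 \<le> k \<and> k < K \<longrightarrow>
        V (k + 1) \<in> \<V> \<and>
        (\<forall>W\<in>\<V>.
           1 / \<Delta>t\<^sup>2 * L2_inner \<Omega> (tr \<Omega> s Y (\<lambda>z. V (k + 1) z - 2 * V k z + V (k - 1) z)) (tr \<Omega> s Y W)
           + a_form \<Omega> A c s Y (V k) W = L2_inner \<Omega> (f (real k * \<Delta>t)) (tr \<Omega> s Y W)) \<and>
        (\<forall>W\<in>\<V>. has_trace \<Omega> s Y W (\<lambda>_. 0) \<longrightarrow> a_form \<Omega> A c s Y (V (k + 1)) W = 0))"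

end

theory Submission
  imports Defs
begin

text \<open>The discrete energy \<open>(\<parallel>tr D\<^sub>k\<parallel>\<^sup>2 + a(V\<^sub>k\<^sub>+\<^sub>1, V\<^sub>k)) / 2\<close>, with \<open>D\<^sub>k\<close> the difference quotient of the scheme, is
  coercive: \<open>4 a(V\<^sub>k\<^sub>+\<^sub>1, V\<^sub>k)\<close> is the difference of the squared energy norms of \<open>V\<^sub>k\<^sub>+\<^sub>1 + V\<^sub>k\<close> and
  \<open>V\<^sub>k\<^sub>+\<^sub>1 - V\<^sub>k\<close>, and the latter is absorbed by the inverse inequality and the CFL condition. Testing the
  scheme with the sum of two consecutive difference quotients shows that the square root of the energy grows by at most
  \<open>\<Delta>t \<parallel>f\<^sub>k\<parallel>\<close> per step. The inverse inequality applies to \<open>V\<^sub>k\<^sub>+\<^sub>1 - V\<^sub>k\<close> because every iterate is discretely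
  harmonic, so that its energy functional factors through the finite-dimensional space of traces and is represented
  there by an \<open>L\<^sup>2\<close> function; this function defines an element of the dual space because the Poincare inequality
  bounds the eigenvalues from below. For all this the energy form and the trace must be well defined and linear on the
  discrete space, which rests on the existence of weak gradients of Lipschitz functions that are differentiable almost
  everywhere, the almost everywhere uniqueness of weak gradients, and the uniqueness of the trace.\<close>

section \<open>Test functions\<close>

text \<open>\<open>weak_gradient\<close> and \<open>tr\<close> are Hilbert choices, so not even
  additivity of the trace is available before the chosen objects are known to be unique almost
  everywhere. For the trace this is a closability statement: if continuous functions tend to 0 in
  the weighted norm and their bottom values converge in L2, the limit is 0. It holds for every s in
  (0,1) because the weight y^(1-2s) and its reciprocal are both integrable near y = 0. The L2
  product of the traces is degenerate on the discrete space, since a nonzero discrete function may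
  vanish at the bottom. Hence the algebra is carried out for semi-inner products on spaces of
  functions, without quotients. The mixed product of two consecutive iterates in the energy is
  dictated by the explicit scheme: it evaluates the energy form at the middle iterate, and the
  tested increment joins the two outer ones, so that mixed products telescope. The price is that the
  energy is not visibly nonnegative, and the time step restriction has to repair this.\<close>

definition C1_gradient :: "('a::euclidean_space \<Rightarrow> real) \<Rightarrow> ('a \<Rightarrow> 'a) \<Rightarrow> bool" where
  "C1_gradient \<psi> \<psi>' \<longleftrightarrow>
     (\<forall>x. (\<psi> has_derivative (\<lambda>h. \<psi>' x \<bullet> h)) (at x)) \<and> continuous_on UNIV \<psi>'"

text \<open>Test functions are assembled from factors that are not compactly supported themselves,
  such as affine functions and one-dimensional cutoffs. The product and chain rules are therefore
  stated for the differentiability part alone, and the support is checked at the end.\<close>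

lemma test_function_iff:
  "test_function U \<psi> \<psi>' \<longleftrightarrow>
     C1_gradient \<psi> \<psi>' \<and> (\<exists>S. compact S \<and> S \<subseteq> U \<and> (\<forall>x. x \<notin> S \<longrightarrow> \<psi> x = 0))"
  by (simp add: test_function_def C1_gradient_def)

lemma C1_gradient_continuous: "C1_gradient \<psi> \<psi>' \<Longrightarrow> continuous_on UNIV \<psi>"
  unfolding C1_gradient_def by (meson continuous_at_imp_continuous_on has_derivative_continuous)

lemma C1_gradient_const: "C1_gradient (\<lambda>_. a) (\<lambda>_. 0)"
  by (auto simp: C1_gradient_def)

lemma C1_gradient_mult:
  assumes "C1_gradient u u'" "C1_gradient v v'"
  shows "C1_gradient (\<lambda>x. u x * v x) (\<lambda>x. u x *\<^sub>R v' x + v x *\<^sub>R u' x)"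
  unfolding C1_gradient_def
proof (intro conjI allI)
  fix x
  show "((\<lambda>x. u x * v x) has_derivative (\<lambda>h. (u x *\<^sub>R v' x + v x *\<^sub>R u' x) \<bullet> h)) (at x)"
    using assms unfolding C1_gradient_def
    by (auto intro!: derivative_eq_intros simp: inner_add_left algebra_simps)
  show "continuous_on UNIV (\<lambda>x. u x *\<^sub>R v' x + v x *\<^sub>R u' x)"
    using assms C1_gradient_continuous[OF assms(1)] C1_gradient_continuous[OF assms(2)]
    unfolding C1_gradient_def by (auto intro!: continuous_intros)
qed

lemma C1_gradient_prod:
  assumes "finite I" "\<And>i. i \<in> I \<Longrightarrow> \<exists>u'. C1_gradient (u i) u'"
  shows "\<exists>u'. C1_gradient (\<lambda>x. \<Prod>i\<in>I. u i x) u'"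
  using assms
proof (induction I rule: finite_induct)
  case empty
  then show ?case using C1_gradient_const[of 1] by auto
next
  case (insert i I)
  then obtain u' v' where "C1_gradient (u i) u'" "C1_gradient (\<lambda>x. \<Prod>i\<in>I. u i x) v'"
    by blast
  from C1_gradient_mult[OF this] insert show ?case by auto
qed

lemma C1_gradient_compose:
  fixes f :: "real \<Rightarrow> real"
  assumes "C1_gradient u u'" and f: "\<And>t. (f has_real_derivative f' t) (at t)"
    and "continuous_on UNIV f'"
  shows "C1_gradient (\<lambda>x. f (u x)) (\<lambda>x. f' (u x) *\<^sub>R u' x)"
  unfolding C1_gradient_def
proof (intro conjI allI)
  fix x
  have "(u has_derivative (\<lambda>h. u' x \<bullet> h)) (at x)"
    using assms(1) by (auto simp: C1_gradient_def)
  moreover have "(f has_derivative (\<lambda>h. h * f' (u x))) (at (u x))"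
    using f[of "u x"] by (simp add: has_field_derivative_def mult_commute_abs)
  ultimately show "((\<lambda>x. f (u x)) has_derivative (\<lambda>h. (f' (u x) *\<^sub>R u' x) \<bullet> h)) (at x)"
    using has_derivative_compose[of u "\<lambda>h. u' x \<bullet> h" x UNIV f "\<lambda>h. h * f' (u x)"]
    by (simp add: mult.commute)
  show "continuous_on UNIV (\<lambda>x. f' (u x) *\<^sub>R u' x)"
    using assms(1) continuous_on_compose2[OF assms(3) C1_gradient_continuous[OF assms(1)]]
    unfolding C1_gradient_def by (auto intro!: continuous_intros)
qed

lemma C1_gradient_affine: "C1_gradient (\<lambda>x. b \<bullet> x + a) (\<lambda>_. b)"
  unfolding C1_gradient_def by (auto intro!: derivative_eq_intros)

lemma C1_gradient_fst:
  assumes "C1_gradient u u'"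
  shows "C1_gradient (\<lambda>z::'a::euclidean_space \<times> 'b::euclidean_space. u (fst z)) (\<lambda>z. (u' (fst z), 0))"
  unfolding C1_gradient_def
proof (intro conjI allI)
  fix z :: "'a \<times> 'b"
  have "(u has_derivative (\<lambda>h. u' (fst z) \<bullet> h)) (at (fst z))"
    using assms by (auto simp: C1_gradient_def)
  then have "((\<lambda>z. u (fst z)) has_derivative (\<lambda>h. u' (fst z) \<bullet> fst h)) (at z)"
    using has_derivative_compose[OF has_derivative_fst[OF has_derivative_ident], of u _ z UNIV] by simp
  then show "((\<lambda>z. u (fst z)) has_derivative (\<lambda>h. (u' (fst z), 0) \<bullet> h)) (at z)"
    by (simp add: inner_prod_def)
  show "continuous_on UNIV (\<lambda>z::'a \<times> 'b. (u' (fst z), 0::'b))"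
    using assms continuous_on_compose2[of UNIV u' UNIV "fst :: 'a \<times> 'b \<Rightarrow> 'a"] continuous_on_fst[OF continuous_on_id]
    by (auto simp: C1_gradient_def intro!: continuous_on_Pair continuous_on_fst continuous_on_id)
qed

lemma C1_gradient_snd:
  assumes "\<And>t. (f has_real_derivative f' t) (at t)" "continuous_on UNIV f'"
  shows "C1_gradient (\<lambda>z::'a::euclidean_space \<times> real. f (snd z)) (\<lambda>z. (0, f' (snd z)))"
proof -
  have "C1_gradient (\<lambda>z::'a \<times> real. snd z) (\<lambda>_. (0, 1))"
    using C1_gradient_affine[of "(0::'a, 1::real)" 0] by (simp add: inner_prod_def)
  from C1_gradient_compose[OF this assms] show ?thesis by simp
qed

text \<open>\<open>test_function\<close> restricts only the support of \<psi>. Off the closed set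
  \<psi> is zero on an open neighbourhood, so the gradient has the same support; integrals against
  \<psi>' need this.\<close>

lemma C1_gradient_vanishes:
  assumes "C1_gradient \<psi> \<psi>'" "closed S" "\<And>x. x \<notin> S \<Longrightarrow> \<psi> x = 0" "x \<notin> S"
  shows "\<psi>' x = 0"
proof -
  have "((\<lambda>_. 0) has_derivative (\<lambda>h. \<psi>' x \<bullet> h)) (at x)"
  proof (rule has_derivative_transform_within_open[where s="- S"])
    show "(\<psi> has_derivative (\<lambda>h. \<psi>' x \<bullet> h)) (at x)"
      using assms(1) by (auto simp: C1_gradient_def)
  qed (use assms in \<open>auto simp: open_Compl\<close>)
  then have "(\<lambda>h. \<psi>' x \<bullet> h) = (\<lambda>h. 0)"
    using has_derivative_unique has_derivative_const by blast
  then have "\<psi>' x \<bullet> \<psi>' x = 0" by metis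
  then show ?thesis by simp
qed

section \<open>A C1 step and its tent-shaped derivative\<close>

definition sqpos :: "real \<Rightarrow> real" where "sqpos t = (max 0 t)\<^sup>2"

lemma DERIV_sqpos: "(sqpos has_real_derivative 2 * max 0 t) (at t)"
proof -
  consider "t < 0" | "t = 0" | "t > 0" by linarith
  then show ?thesis
  proof cases
    case 1
    have "((\<lambda>_. 0) has_real_derivative 0) (at t)" by simp
    then have "(sqpos has_real_derivative 0) (at t)"
      by (rule has_field_derivative_transform_within_open[where S="{..<0}"])
         (use 1 in \<open>auto simp: sqpos_def\<close>)
    then show ?thesis using 1 by simp
  next
    case 2
    have "((\<lambda>h. sqpos h / h) \<longlongrightarrow> 0) (at 0)"
    proof (rule Lim_null_comparison)
      show "\<forall>\<^sub>F h in at 0. norm (sqpos h / h) \<le> \<bar>h\<bar>"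
        by (auto simp: sqpos_def max_def power2_eq_square eventually_at intro!: exI[of _ 1])
      show "((\<lambda>h::real. \<bar>h\<bar>) \<longlongrightarrow> 0) (at 0)"
        by (auto intro!: tendsto_eq_intros)
    qed
    then show ?thesis using 2 by (simp add: DERIV_def sqpos_def)
  next
    case 3
    have "((\<lambda>t. t\<^sup>2) has_real_derivative 2 * t) (at t)" 
      by (auto intro!: derivative_eq_intros)
    then have "(sqpos has_real_derivative 2 * t) (at t)"
      by (rule has_field_derivative_transform_within_open[where S="{0<..}"])
         (use 3 in \<open>auto simp: sqpos_def\<close>)
    then show ?thesis using 3 by simp
  qed
qed

text \<open>The second difference of the squared positive part is a \<open>C\<^sup>1\<close> step from 0 to 1 on the unit interval.\<close>

definition smoothstep :: "real \<Rightarrow> real" where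
  "smoothstep t = 2 * (sqpos t - 2 * sqpos (t - 1/2) + sqpos (t - 1))"

text \<open>The derivative of \<open>smoothstep\<close>: the tent on [0,1] with peak 2 at 1/2, hence
  of integral 1. Rescaled, it later serves as an approximate identity at the bottom of the
  cylinder.\<close>

definition hat :: "real \<Rightarrow> real" where
  "hat t = 4 * (max 0 t - 2 * max 0 (t - 1/2) + max 0 (t - 1))"

lemma DERIV_smoothstep: "(smoothstep has_real_derivative hat t) (at t)"
proof -
  have "((\<lambda>t. sqpos (t - a)) has_real_derivative 2 * max 0 (t - a)) (at t)" for a
    using DERIV_shift[of sqpos "2 * max 0 (t - a)" t "- a"] DERIV_sqpos[of "t - a"] by simp
  from this[of 0] this[of "1/2"] this[of 1] show ?thesis
    unfolding smoothstep_def[abs_def] hat_def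
    by (auto intro!: derivative_eq_intros)
qed

lemma continuous_on_hat: "continuous_on S hat"
  unfolding hat_def by (intro continuous_intros)

lemma continuous_on_smoothstep: "continuous_on S smoothstep"
  by (meson DERIV_isCont DERIV_smoothstep continuous_at_imp_continuous_on)

lemma hat_nonneg: "0 \<le> hat t"
  by (auto simp: hat_def max_def)

lemma hat_eq_0: "t \<le> 0 \<or> 1 \<le> t \<Longrightarrow> hat t = 0"
  by (auto simp: hat_def max_def)

lemma smoothstep_le_0: "t \<le> 0 \<Longrightarrow> smoothstep t = 0"
  by (auto simp: smoothstep_def sqpos_def)

lemma smoothstep_ge_1: "1 \<le> t \<Longrightarrow> smoothstep t = 1"
  by (auto simp: smoothstep_def sqpos_def max_def) (simp add: power2_eq_square algebra_simps)

lemma smoothstep_mono: "t \<le> u \<Longrightarrow> smoothstep t \<le> smoothstep u"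
  using DERIV_smoothstep hat_nonneg by (intro DERIV_nonneg_imp_nondecreasing[of t u smoothstep]) auto

lemma smoothstep_nonneg: "0 \<le> smoothstep t"
  using smoothstep_mono[of 0 t] smoothstep_le_0[of t] smoothstep_le_0[of 0] by linarith

lemma smoothstep_le_1: "smoothstep t \<le> 1"
  using smoothstep_mono[of t 1] smoothstep_ge_1[of t] smoothstep_ge_1[of 1] by linarith

lemma C1_gradient_smoothstep_affine: "\<exists>u'. C1_gradient (\<lambda>x. smoothstep (b \<bullet> x + a)) u'"
proof
  show "C1_gradient (\<lambda>x. smoothstep (b \<bullet> x + a)) (\<lambda>x. hat (b \<bullet> x + a) *\<^sub>R b)"
    by (rule C1_gradient_compose[where f=smoothstep and f'=hat])
       (simp_all add: C1_gradient_affine DERIV_smoothstep continuous_on_hat)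
qed

text \<open>A larger n steepens the flanks. The bumps stay between 0 and 1, vanish off the closed
  box and are eventually equal to 1 at each point of the open box, so they can replace the indicator
  of a box in dominated convergence.\<close>

definition box_bump :: "'a::euclidean_space \<Rightarrow> 'a \<Rightarrow> nat \<Rightarrow> 'a \<Rightarrow> real" where
  "box_bump p q n x =
     (\<Prod>b\<in>Basis. smoothstep (real n * (x \<bullet> b - p \<bullet> b)) * smoothstep (real n * (q \<bullet> b - x \<bullet> b)))"

lemma box_bump_eq_0:
  assumes "x \<notin> cbox p q"
  shows "box_bump p q n x = 0"
proof -
  from assms obtain b where "b \<in> Basis" "x \<bullet> b < p \<bullet> b \<or> q \<bullet> b < x \<bullet> b"
    by (auto simp: mem_box not_le)
  then show ?thesis unfolding box_bump_def
    by (intro prod_zero) (auto intro!: bexI[of _ b] smoothstep_le_0 mult_nonneg_nonpos)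
qed

lemma test_function_box_bump:
  assumes "cbox p q \<subseteq> U"
  obtains \<psi>' where "test_function U (box_bump p q n) \<psi>'"
proof -
  have "\<exists>u'. C1_gradient (\<lambda>x. smoothstep (real n * (x \<bullet> b - p \<bullet> b)) * smoothstep (real n * (q \<bullet> b - x \<bullet> b))) u'"
    for b :: 'a
  proof -
    obtain u' where u': "C1_gradient (\<lambda>x. smoothstep ((real n *\<^sub>R b) \<bullet> x + (- real n * (p \<bullet> b)))) u'"
      using C1_gradient_smoothstep_affine by blast
    obtain v' where v': "C1_gradient (\<lambda>x. smoothstep ((- real n *\<^sub>R b) \<bullet> x + (real n * (q \<bullet> b)))) v'"
      using C1_gradient_smoothstep_affine by blast
    from C1_gradient_mult[OF u' v'] show ?thesis
      by (intro exI) (simp add: algebra_simps inner_commute)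
  qed
  from C1_gradient_prod[OF finite_Basis this, of "\<lambda>b. b"] obtain \<psi>' where "C1_gradient (box_bump p q n) \<psi>'"
    by (auto simp: box_bump_def[abs_def])
  then have "test_function U (box_bump p q n) \<psi>'"
    using assms compact_cbox[of p q] box_bump_eq_0[of _ p q n] unfolding test_function_iff by blast
  then show ?thesis by (rule that)
qed

lemma box_bump_bounds: "0 \<le> box_bump p q n x" "box_bump p q n x \<le> 1"
  unfolding box_bump_def
  using smoothstep_nonneg smoothstep_le_1
  by (simp_all add: prod_nonneg prod_le_1 mult_le_one)

lemma box_bump_eventually_eq_1:
  assumes "x \<in> box p q"
  shows "\<forall>\<^sub>F n in sequentially. box_bump p q n x = 1"
proof -
  have *: "\<forall>\<^sub>F n in sequentially. smoothstep (real n * d) = 1" if "d > 0" for d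
  proof -
    obtain N :: nat where "1 / d \<le> real N" using real_arch_simple by blast
    then have "1 \<le> real n * d" if "n \<ge> N" for n
    proof -
      have "1 \<le> real N * d" using \<open>d > 0\<close> \<open>1 / d \<le> real N\<close> by (simp add: field_simps)
      also have "\<dots> \<le> real n * d" using \<open>d > 0\<close> that by (intro mult_right_mono) auto
      finally show ?thesis .
    qed
    then show ?thesis
      by (auto simp: eventually_sequentially intro!: exI[of _ N] smoothstep_ge_1)
  qed
  have "\<forall>\<^sub>F n in sequentially. \<forall>b\<in>Basis. smoothstep (real n * (x \<bullet> b - p \<bullet> b)) = 1 \<and>
      smoothstep (real n * (q \<bullet> b - x \<bullet> b)) = 1"
    using assms by (intro eventually_ball_finite ballI eventually_conj *) (auto simp: mem_box)
  then show ?thesis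
    by eventually_elim (auto simp: box_bump_def)
qed

section \<open>Weak gradients\<close>

lemma lebesgue_on_support:
  fixes f :: "'a::euclidean_space \<Rightarrow> 'b::{banach, second_countable_topology}"
  assumes "S \<in> sets lebesgue" "U \<in> sets lebesgue" "S \<subseteq> U" "\<And>x. x \<in> U \<Longrightarrow> x \<notin> S \<Longrightarrow> f x = 0"
  shows "integrable (lebesgue_on U) f \<longleftrightarrow> integrable (lebesgue_on S) f"
    and "(LINT x|lebesgue_on U. f x) = (LINT x|lebesgue_on S. f x)"
proof -
  have "indicator U x *\<^sub>R f x = indicator S x *\<^sub>R f x" for x
    using assms(3,4) by (auto simp: indicator_def)
  then have *: "(\<lambda>x. indicator U x *\<^sub>R f x) = (\<lambda>x. indicator S x *\<^sub>R f x)" by blast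
  show "integrable (lebesgue_on U) f \<longleftrightarrow> integrable (lebesgue_on S) f"
    using assms by (simp add: integrable_restrict_space *)
  show "(LINT x|lebesgue_on U. f x) = (LINT x|lebesgue_on S. f x)"
    using assms by (simp add: integral_restrict_space *)
qed

lemma integrable_lebesgue_on_subset:
  fixes f :: "'a::euclidean_space \<Rightarrow> 'b::euclidean_space"
  assumes "integrable (lebesgue_on U) f" "S \<in> sets lebesgue" "U \<in> sets lebesgue" "S \<subseteq> U"
  shows "integrable (lebesgue_on S) f"
proof -
  have "integrable lebesgue (\<lambda>x. indicator S x *\<^sub>R (indicator U x *\<^sub>R f x))"
    using assms by (intro integrable_mult_indicator[where A=S]) (auto simp: integrable_restrict_space)
  moreover have "(\<lambda>x. indicator S x *\<^sub>R (indicator U x *\<^sub>R f x)) = (\<lambda>x. indicator S x *\<^sub>R f x)"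
    using assms(4) by (auto simp: indicator_def fun_eq_iff)
  ultimately show ?thesis
    using assms by (simp add: integrable_restrict_space)
qed

text \<open>The bumps converge to 1 on the open box, the boundary of the box is a null set, and the
  norm of g dominates. The vanishing integrals against the bumps thus pass to the integral over the
  box itself.\<close>

lemma integral_cbox_eq_0_if_test_functions:
  fixes g :: "'a::euclidean_space \<Rightarrow> 'b::euclidean_space"
  assumes "open U" "locally_integrable U g" "cbox p q \<subseteq> U"
    and zero: "\<And>\<psi> \<psi>'. test_function U \<psi> \<psi>' \<Longrightarrow> (LINT x|lebesgue_on U. \<psi> x *\<^sub>R g x) = 0"
  shows "g integrable_on cbox p q" "integral (cbox p q) g = 0"
proof -
  have g: "integrable (lebesgue_on (cbox p q)) g"
    using assms by (auto simp: locally_integrable_def)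
  then show "g integrable_on cbox p q"
    by (rule integrable_on_lebesgue_on) simp
  have eq0: "(LINT x|lebesgue_on (cbox p q). box_bump p q n x *\<^sub>R g x) = 0" for n
  proof -
    obtain \<psi>' where tf: "test_function U (box_bump p q n) \<psi>'"
      using test_function_box_bump[OF assms(3)] by blast
    have "(LINT x|lebesgue_on U. box_bump p q n x *\<^sub>R g x)
        = (LINT x|lebesgue_on (cbox p q). box_bump p q n x *\<^sub>R g x)"
      using assms(1,3) by (intro lebesgue_on_support) (auto simp: box_bump_eq_0)
    then show ?thesis using zero[OF tf] by simp
  qed
  have "(\<lambda>n. LINT x|lebesgue_on (cbox p q). box_bump p q n x *\<^sub>R g x)
      \<longlonglongrightarrow> (LINT x|lebesgue_on (cbox p q). g x)"
  proof (rule integral_dominated_convergence[where w="\<lambda>x. norm (g x)"])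
    show "g \<in> borel_measurable (lebesgue_on (cbox p q))" using g by auto
    show "(\<lambda>x. box_bump p q n x *\<^sub>R g x) \<in> borel_measurable (lebesgue_on (cbox p q))" for n
    proof -
      obtain \<psi>' where tf: "test_function U (box_bump p q n) \<psi>'"
        using test_function_box_bump[OF assms(3)] by blast
      then have "continuous_on UNIV (box_bump p q n)"
        using C1_gradient_continuous test_function_iff by blast
      then have "box_bump p q n \<in> borel_measurable (lebesgue_on (cbox p q))"
        by (meson continuous_imp_measurable_on_sets_lebesgue continuous_on_subset lmeasurable_cbox
            fmeasurableD subset_UNIV)
      then show ?thesis using g by auto
    qed
    show "integrable (lebesgue_on (cbox p q)) (\<lambda>x. norm (g x))" using g by auto
    show "AE x in lebesgue_on (cbox p q). norm (box_bump p q n x *\<^sub>R g x) \<le> norm (g x)" for n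
      using box_bump_bounds[of p q n] by (auto intro!: AE_I2 mult_left_le_one_le)
    have "frontier (cbox p q) \<in> null_sets lebesgue"
      using negligible_convex_frontier[of "cbox p q"] by (simp add: negligible_iff_null_sets)
    then have "AE x in lebesgue. x \<notin> frontier (cbox p q)"
      by (rule AE_not_in)
    then have "AE x in lebesgue_on (cbox p q). x \<in> box p q"
      by (subst AE_restrict_space_iff) (auto simp: frontier_cbox elim!: eventually_mono)
    then show "AE x in lebesgue_on (cbox p q). (\<lambda>n. box_bump p q n x *\<^sub>R g x) \<longlonglongrightarrow> g x"
    proof eventually_elim
      case (elim x)
      show ?case
        by (rule tendsto_eventually)
          (use box_bump_eventually_eq_1[OF elim] in \<open>auto elim!: eventually_mono\<close>)
    qed
  qed
  then have "(LINT x|lebesgue_on (cbox p q). g x) = 0"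
    using eq0 LIMSEQ_unique by (simp add: LIMSEQ_const_iff)
  then show "integral (cbox p q) g = 0"
    using lebesgue_integral_eq_integral[OF g] by simp
qed

text \<open>All integrals over small cubes vanish, and by Lebesgue differentiation the averages over
  shrinking cubes recover g almost everywhere. The argument runs inside one box at a time; countably
  many boxes exhaust the open set.\<close>

proposition locally_integrable_eq_0_AE:
  fixes g :: "'a::euclidean_space \<Rightarrow> 'b::euclidean_space"
  assumes "open U" "locally_integrable U g"
    and zero: "\<And>\<psi> \<psi>'. test_function U \<psi> \<psi>' \<Longrightarrow> (LINT x|lebesgue_on U. \<psi> x *\<^sub>R g x) = 0"
  shows "AE x in lebesgue_on U. g x = 0"
proof -
  note I0 = integral_cbox_eq_0_if_test_functions[OF assms(1,2) _ assms(3)]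
  have cb: "negligible {x \<in> cbox p q. g x \<noteq> 0}" if "cbox p q \<subseteq> U" for p q
  proof -
    \<comment> \<open>The differentiation theorem wants a function integrable on every box, whereas
      g is controlled only inside U; hence the extension by zero.\<close>
    define f where "f x = (if x \<in> cbox p q then g x else 0)" for x
    have "f integrable_on cbox a b" for a b
    proof -
      have "g integrable_on cbox p q \<inter> cbox a b"
        unfolding Int_interval
        by (rule I0(1)) (use that Int_interval[of p q a b] in blast)
      then show ?thesis
        unfolding f_def[abs_def] integrable_restrict_Int[of "cbox p q" g] by simp
    qed
    then obtain N where N: "negligible N" and lim: "\<And>x e. \<lbrakk>x \<notin> N; 0 < e\<rbrakk> \<Longrightarrow>
         \<exists>d>0. \<forall>h. 0 < h \<and> h < d \<longrightarrow>
            norm(integral (cbox x (x + h *\<^sub>R One)) f /\<^sub>R h ^ DIM('a) - f x) < e"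
      using integrable_ccontinuous_explicit by blast
    have "g x = 0" if x: "x \<in> box p q" "x \<notin> N" for x
    proof (rule ccontr)
      assume "g x \<noteq> 0"
      then obtain d where "d > 0" and d: "\<And>h. 0 < h \<Longrightarrow> h < d \<Longrightarrow>
          norm(integral (cbox x (x + h *\<^sub>R One)) f /\<^sub>R h ^ DIM('a) - f x) < norm (g x)"
        using lim[OF x(2), of "norm (g x)"] by auto
      obtain e where "e > 0" and e: "ball x e \<subseteq> box p q"
        using x(1) open_box open_contains_ball by blast
      \<comment> \<open>The norm is bounded by the sum of the coordinates, so a cube of side h lies
        in the ball of radius e once h times the dimension is below e.\<close>
      define h where "h = min (d / 2) (e / (2 * real DIM('a)))"
      have h: "0 < h" "h < d" "h * real DIM('a) < e"
        using \<open>d > 0\<close> \<open>e > 0\<close> by (auto simp: h_def min_def field_simps)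
      have "cbox x (x + h *\<^sub>R One) \<subseteq> ball x e"
      proof
        fix y assume y: "y \<in> cbox x (x + h *\<^sub>R One)"
        have "norm (y - x) \<le> (\<Sum>b\<in>Basis. \<bar>(y - x) \<bullet> b\<bar>)" by (rule norm_le_l1)
        also have "\<dots> \<le> (\<Sum>b\<in>(Basis::'a set). h)"
          using y by (intro sum_mono) (auto simp: mem_box inner_diff_left inner_add_left abs_le_iff)
        also have "\<dots> < e" using h(3) by (simp add: mult.commute)
        finally show "y \<in> ball x e" by (simp add: dist_norm norm_minus_commute)
      qed
      then have sub: "cbox x (x + h *\<^sub>R One) \<subseteq> cbox p q"
        using e box_subset_cbox by blast
      have "integral (cbox x (x + h *\<^sub>R One)) f = integral (cbox x (x + h *\<^sub>R One)) g"
        using sub by (intro integral_cong) (auto simp: f_def)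
      also have "\<dots> = 0" using sub \<open>cbox p q \<subseteq> U\<close> by (intro I0(2)) auto
      finally show False using d[OF h(1,2)] x(1) box_subset_cbox[of p q] by (auto simp: f_def)
    qed
    then have "{x \<in> cbox p q. g x \<noteq> 0} \<subseteq> N \<union> frontier (cbox p q)"
      by (auto simp: frontier_cbox)
    then show ?thesis
      using N negligible_convex_frontier[of "cbox p q"]
      by (auto intro: negligible_subset[where S="N \<union> frontier (cbox p q)"])
  qed
  obtain D where D: "countable D" "D \<subseteq> Pow U" "\<And>X. X \<in> D \<Longrightarrow> \<exists>a b. X = cbox a b" "\<Union>D = U"
    using open_countable_Union_open_cbox[OF assms(1)] by metis
  have "negligible (\<Union>X\<in>D. {x \<in> X. g x \<noteq> 0})"
  proof (rule negligible_countable_Union)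
    show "countable ((\<lambda>X. {x \<in> X. g x \<noteq> 0}) ` D)" using D(1) by simp
    fix Z assume "Z \<in> (\<lambda>X. {x \<in> X. g x \<noteq> 0}) ` D"
    then obtain X where "X \<in> D" and Z: "Z = {x \<in> X. g x \<noteq> 0}" by auto
    with D(3) obtain a b where "X = cbox a b" by blast
    with cb[of a b] D(2) \<open>X \<in> D\<close> Z show "negligible Z" by blast
  qed
  moreover have "{x \<in> U. g x \<noteq> 0} = (\<Union>X\<in>D. {x \<in> X. g x \<noteq> 0})" using D(4) by auto
  ultimately have "{x \<in> U. g x \<noteq> 0} \<in> null_sets lebesgue"
    by (simp add: negligible_iff_null_sets)
  then have "AE x in lebesgue. x \<notin> {x \<in> U. g x \<noteq> 0}" by (rule AE_not_in)
  then show ?thesis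
    using assms(1) by (subst AE_restrict_space_iff) (auto elim!: eventually_mono)
qed

section \<open>Linearity and uniqueness of weak gradients\<close>

lemma integrable_const_lebesgue_on:
  fixes a :: "'b::euclidean_space"
  assumes "S \<in> lmeasurable"
  shows "integrable (lebesgue_on S) (\<lambda>_. a)"
proof -
  have "integrable lebesgue (\<lambda>x. indicator S x *\<^sub>R a)"
    using assms by (intro integrable_scaleR_left integrable_real_indicator) (auto simp: fmeasurable_def)
  then show ?thesis using assms by (simp add: integrable_restrict_space fmeasurableD)
qed

lemma test_function_support:
  assumes "test_function U \<psi> \<psi>'"
  obtains S where "compact S" "S \<subseteq> U" "\<And>x. x \<notin> S \<Longrightarrow> \<psi> x = 0" "\<And>x. x \<notin> S \<Longrightarrow> \<psi>' x = 0"
    "continuous_on UNIV \<psi>" "continuous_on UNIV \<psi>'"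
    "\<And>x. (\<psi> has_derivative (\<lambda>h. \<psi>' x \<bullet> h)) (at x)"
proof -
  have C1: "C1_gradient \<psi> \<psi>'" using assms by (simp add: test_function_iff)
  obtain S where S: "compact S" "S \<subseteq> U" "\<And>x. x \<notin> S \<Longrightarrow> \<psi> x = 0"
    using assms by (auto simp: test_function_def)
  show ?thesis
  proof (rule that[OF S])
    show "\<psi>' x = 0" if "x \<notin> S" for x
      using C1_gradient_vanishes[OF C1 compact_imp_closed[OF S(1)] S(3) that] .
  qed (use C1 C1_gradient_continuous[OF C1] in \<open>auto simp: C1_gradient_def\<close>)
qed

lemma locally_integrableD:
  "locally_integrable U f \<Longrightarrow> compact S \<Longrightarrow> S \<subseteq> U \<Longrightarrow> integrable (lebesgue_on S) f"
  by (simp add: locally_integrable_def)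

lemma integrable_compact_support:
  fixes f :: "'a::euclidean_space \<Rightarrow> real" and \<eta> :: "'a \<Rightarrow> 'b::euclidean_space"
  assumes "open U" "locally_integrable U f" "continuous_on UNIV \<eta>" "compact S" "S \<subseteq> U"
    "\<And>x. x \<notin> S \<Longrightarrow> \<eta> x = 0"
  shows "integrable (lebesgue_on U) (\<lambda>x. f x *\<^sub>R \<eta> x)"
proof -
  have S: "S \<in> sets lebesgue" using assms(4) by (simp add: lmeasurable_compact fmeasurableD)
  have f: "integrable (lebesgue_on S) f" using assms locally_integrableD by metis
  have \<eta>: "\<eta> \<in> borel_measurable (lebesgue_on S)"
    using continuous_imp_measurable_on_sets_lebesgue[OF continuous_on_subset[OF assms(3)] S] by simp
  have "bounded (\<eta> ` S)"
    using assms(3,4) by (intro compact_imp_bounded compact_continuous_image)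
      (auto intro: continuous_on_subset)
  then obtain B where "\<forall>y\<in>\<eta> ` S. norm y \<le> B" unfolding bounded_iff by blast
  then have B: "\<And>x. x \<in> S \<Longrightarrow> norm (\<eta> x) \<le> B" by simp
  have "integrable (lebesgue_on S) (\<lambda>x. f x *\<^sub>R \<eta> x)"
  proof (rule Bochner_Integration.integrable_bound)
    show "integrable (lebesgue_on S) (\<lambda>x. B * f x)" using f by simp
    show "(\<lambda>x. f x *\<^sub>R \<eta> x) \<in> borel_measurable (lebesgue_on S)" using f \<eta> by auto
    show "AE x in lebesgue_on S. norm (f x *\<^sub>R \<eta> x) \<le> norm (B * f x)"
    proof (rule AE_I2)
      fix x assume "x \<in> space (lebesgue_on S)"
      then have "norm (\<eta> x) \<le> \<bar>B\<bar>" using B[of x] by simp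
      then show "norm (f x *\<^sub>R \<eta> x) \<le> norm (B * f x)"
        by (simp add: abs_mult mult.commute[of "\<bar>B\<bar>"] mult_left_mono)
    qed
  qed
  then show ?thesis
    using assms S by (subst lebesgue_on_support(1)[of S U]) auto
qed

lemma integrable_compact_support':
  fixes g :: "'a::euclidean_space \<Rightarrow> 'b::euclidean_space" and \<eta> :: "'a \<Rightarrow> real"
  assumes "open U" "locally_integrable U g" "continuous_on UNIV \<eta>" "compact S" "S \<subseteq> U"
    "\<And>x. x \<notin> S \<Longrightarrow> \<eta> x = 0"
  shows "integrable (lebesgue_on U) (\<lambda>x. \<eta> x *\<^sub>R g x)"
proof -
  have "integrable (lebesgue_on U) (\<lambda>x. (\<eta> x *\<^sub>R g x) \<bullet> b)" for b
  proof -
    have "locally_integrable U (\<lambda>x. g x \<bullet> b)"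
      using assms(2) by (auto simp: locally_integrable_def)
    from integrable_compact_support[OF assms(1) this assms(3-6)] show ?thesis
      by (simp add: mult.commute)
  qed
  then have "integrable (lebesgue_on U) (\<lambda>x. \<Sum>b\<in>Basis. ((\<eta> x *\<^sub>R g x) \<bullet> b) *\<^sub>R b)"
    by (intro Bochner_Integration.integrable_sum integrable_scaleR_left) auto
  then show ?thesis by (simp only: euclidean_representation)
qed

lemma has_weak_gradient_integrable:
  assumes "open U" "has_weak_gradient U w g" "test_function U \<psi> \<psi>'"
  shows "integrable (lebesgue_on U) (\<lambda>x. w x *\<^sub>R \<psi>' x)"
    and "integrable (lebesgue_on U) (\<lambda>x. \<psi> x *\<^sub>R g x)"
proof -
  obtain S where S: "compact S" "S \<subseteq> U" "\<And>x. x \<notin> S \<Longrightarrow> \<psi> x = 0" "\<And>x. x \<notin> S \<Longrightarrow> \<psi>' x = 0"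
    "continuous_on UNIV \<psi>" "continuous_on UNIV \<psi>'"
    using test_function_support[OF assms(3)] by metis
  show "integrable (lebesgue_on U) (\<lambda>x. w x *\<^sub>R \<psi>' x)"
    using assms S by (intro integrable_compact_support) (auto simp: has_weak_gradient_def)
  show "integrable (lebesgue_on U) (\<lambda>x. \<psi> x *\<^sub>R g x)"
    using assms S by (intro integrable_compact_support') (auto simp: has_weak_gradient_def)
qed

lemma locally_integrable_lincomb:
  assumes "locally_integrable U f" "locally_integrable U g"
  shows "locally_integrable U (\<lambda>x. a *\<^sub>R f x + b *\<^sub>R g x)"
  using assms unfolding locally_integrable_def
  by (intro allI impI Bochner_Integration.integrable_add integrable_scaleR_right) auto

lemma LINT_lincomb:
  fixes f g :: "_ \<Rightarrow> 'b::euclidean_space"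
  assumes "integrable M f" "integrable M g"
  shows "(LINT x|M. a *\<^sub>R f x + b *\<^sub>R g x) = a *\<^sub>R (LINT x|M. f x) + b *\<^sub>R (LINT x|M. g x)"
  using assms by (simp add: Bochner_Integration.integral_add)

lemma has_weak_gradient_lincomb:
  assumes "open U" "has_weak_gradient U u g" "has_weak_gradient U v k"
  shows "has_weak_gradient U (\<lambda>x. a * u x + b * v x) (\<lambda>x. a *\<^sub>R g x + b *\<^sub>R k x)"
  unfolding has_weak_gradient_def
proof (intro conjI allI impI)
  show "locally_integrable U (\<lambda>x. a * u x + b * v x)"
    using locally_integrable_lincomb[of U u v a b] assms by (simp add: has_weak_gradient_def)
  show "locally_integrable U (\<lambda>x. a *\<^sub>R g x + b *\<^sub>R k x)"
    using assms by (intro locally_integrable_lincomb) (auto simp: has_weak_gradient_def)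
  fix \<psi> \<psi>' assume tf: "test_function U \<psi> \<psi>'"
  note I = has_weak_gradient_integrable[OF assms(1,2) tf] has_weak_gradient_integrable[OF assms(1,3) tf]
  have "(LINT x|lebesgue_on U. (a * u x + b * v x) *\<^sub>R \<psi>' x)
      = (LINT x|lebesgue_on U. a *\<^sub>R (u x *\<^sub>R \<psi>' x) + b *\<^sub>R (v x *\<^sub>R \<psi>' x))"
    by (simp add: scaleR_add_left)
  also have "\<dots> = a *\<^sub>R (LINT x|lebesgue_on U. u x *\<^sub>R \<psi>' x) + b *\<^sub>R (LINT x|lebesgue_on U. v x *\<^sub>R \<psi>' x)"
    using I by (simp only: LINT_lincomb)
  also have "\<dots> = - (a *\<^sub>R (LINT x|lebesgue_on U. \<psi> x *\<^sub>R g x) + b *\<^sub>R (LINT x|lebesgue_on U. \<psi> x *\<^sub>R k x))"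
    using assms(2,3) tf by (simp add: has_weak_gradient_def)
  also have "\<dots> = - (LINT x|lebesgue_on U. a *\<^sub>R (\<psi> x *\<^sub>R g x) + b *\<^sub>R (\<psi> x *\<^sub>R k x))"
    using I by (simp only: LINT_lincomb)
  also have "\<dots> = - (LINT x|lebesgue_on U. \<psi> x *\<^sub>R (a *\<^sub>R g x + b *\<^sub>R k x))"
    by (simp add: scaleR_add_right mult.commute)
  finally show "(LINT x|lebesgue_on U. (a * u x + b * v x) *\<^sub>R \<psi>' x)
      = - (LINT x|lebesgue_on U. \<psi> x *\<^sub>R (a *\<^sub>R g x + b *\<^sub>R k x))" .
qed

text \<open>The difference of two weak gradients of w is a weak gradient of the zero function, so
  its integral against every test function vanishes.\<close>

lemma has_weak_gradient_unique:
  assumes "open U" "has_weak_gradient U w g" "has_weak_gradient U w k"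
  shows "AE x in lebesgue_on U. g x = k x"
proof -
  have 1: "has_weak_gradient U (\<lambda>x. 1 * w x + (- 1) * w x) (\<lambda>x. 1 *\<^sub>R g x + (- 1) *\<^sub>R k x)"
    by (rule has_weak_gradient_lincomb[OF assms])
  have "AE x in lebesgue_on U. 1 *\<^sub>R g x + (- 1) *\<^sub>R k x = 0"
  proof (rule locally_integrable_eq_0_AE[OF assms(1)])
    show "locally_integrable U (\<lambda>x. 1 *\<^sub>R g x + (- 1) *\<^sub>R k x)"
      using 1 by (simp add: has_weak_gradient_def)
    show "(LINT x|lebesgue_on U. \<psi> x *\<^sub>R (1 *\<^sub>R g x + - 1 *\<^sub>R k x)) = 0"
      if "test_function U \<psi> \<psi>'" for \<psi> \<psi>'
      using 1 that unfolding has_weak_gradient_def by fastforce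
  qed
  then show ?thesis by eventually_elim simp
qed

lemma has_weak_gradient_weak_gradient:
  "has_weak_gradient U w g \<Longrightarrow> has_weak_gradient U w (weak_gradient U w)"
  unfolding weak_gradient_def by (rule someI[where P="has_weak_gradient U w"])

text \<open>\<open>weak_gradient\<close> is an arbitrary choice among the weak gradients, so
  identities for it, linearity included, can hold only up to a null set.\<close>

lemma weak_gradient_AE:
  assumes "open U" "has_weak_gradient U w g"
  shows "AE x in lebesgue_on U. weak_gradient U w x = g x"
  using has_weak_gradient_unique[OF assms(1) has_weak_gradient_weak_gradient[OF assms(2)] assms(2)] .

lemma weak_gradient_lincomb_AE:
  assumes "open U" "has_weak_gradient U u g" "has_weak_gradient U v k"
  shows "AE x in lebesgue_on U. weak_gradient U (\<lambda>x. a * u x + b * v x) x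
      = a *\<^sub>R weak_gradient U u x + b *\<^sub>R weak_gradient U v x"
  by (rule weak_gradient_AE[OF assms(1)], rule has_weak_gradient_lincomb[OF assms(1)])
    (rule has_weak_gradient_weak_gradient, rule assms)+

section \<open>Weak gradients of Lipschitz functions\<close>

lemma LINT_lebesgue_on_eq_lborel:
  fixes f :: "'a::euclidean_space \<Rightarrow> 'b::{banach, second_countable_topology}"
  assumes "U \<in> sets lebesgue" "f \<in> borel_measurable borel" "\<And>x. x \<notin> U \<Longrightarrow> f x = 0"
  shows "(LINT x|lebesgue_on U. f x) = (LINT x|lborel. f x)"
proof -
  have "(\<lambda>x. indicator U x *\<^sub>R f x) = f"
    using assms(3) by (auto simp: indicator_def)
  then show ?thesis
    using assms by (simp add: integral_restrict_space integral_completion)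
qed

lemma integrable_lborel_compact_support:
  fixes f :: "'a::euclidean_space \<Rightarrow> 'b::euclidean_space"
  assumes "continuous_on UNIV f" "compact S" "\<And>x. x \<notin> S \<Longrightarrow> f x = 0"
  shows "integrable lborel f"
proof -
  have "integrable lborel (\<lambda>x. indicator S x *\<^sub>R f x)"
    using assms by (intro borel_integrable_compact) (auto intro: continuous_on_subset)
  moreover have "(\<lambda>x. indicator S x *\<^sub>R f x) = f"
    using assms(3) by (auto simp: indicator_def)
  ultimately show ?thesis by simp
qed

lemma LINT_lborel_translate:
  fixes f :: "'a::euclidean_space \<Rightarrow> 'b::{banach, second_countable_topology}"
  assumes "f \<in> borel_measurable borel"
  shows "(LINT x|lborel. f (c + x)) = (LINT x|lborel. f x)"
proof -
  have "(LINT x|lborel. f x) = (LINT x|distr lborel borel ((+) c). f x)"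
    by (simp add: lborel_distr_plus)
  also have "\<dots> = (LINT x|lborel. f (c + x))"
    using assms by (subst integral_distr) auto
  finally show ?thesis ..
qed

lemma test_function_lipschitz:
  assumes "test_function U \<psi> \<psi>'"
  obtains B where "B \<ge> 0" "B-lipschitz_on UNIV \<psi>"
proof -
  obtain S where S: "compact S" "S \<subseteq> U" "\<And>x. x \<notin> S \<Longrightarrow> \<psi> x = 0" "\<And>x. x \<notin> S \<Longrightarrow> \<psi>' x = 0"
    "continuous_on UNIV \<psi>" "continuous_on UNIV \<psi>'"
    and der: "\<And>x. (\<psi> has_derivative (\<lambda>h. \<psi>' x \<bullet> h)) (at x)"
    using test_function_support[OF assms] by metis
  have "bounded (\<psi>' ` S)"
    using S by (intro compact_imp_bounded compact_continuous_image) (auto intro: continuous_on_subset)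
  then obtain B where "\<forall>y\<in>\<psi>' ` S. norm y \<le> B" unfolding bounded_iff by blast
  then have B: "norm (\<psi>' x) \<le> max B 0" for x
    using S(4)[of x] by (cases "x \<in> S") auto
  have "norm (\<psi> x - \<psi> y) \<le> max B 0 * norm (x - y)" for x y
  proof (rule differentiable_bound[of UNIV])
    show "onorm (\<lambda>h. \<psi>' x \<bullet> h) \<le> max B 0" for x
    proof (rule onorm_le)
      fix h
      have "norm (\<psi>' x \<bullet> h) \<le> norm (\<psi>' x) * norm h" by (simp add: Cauchy_Schwarz_ineq2)
      also have "\<dots> \<le> max B 0 * norm h" using B by (intro mult_right_mono) auto
      finally show "norm (\<psi>' x \<bullet> h) \<le> max B 0 * norm h" .
    qed
  qed (use der in auto)
  then have "(max B 0)-lipschitz_on UNIV \<psi>"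
    by (intro lipschitz_onI) (auto simp: dist_norm)
  then show ?thesis by (rule that[rotated]) simp
qed

text \<open>Difference quotients along the steps 1/(n+1) form a sequence, as dominated convergence
  requires; moreover the limit of a sequence of measurable functions is measurable, which later
  yields measurable gradients.\<close>

lemma has_derivative_sequential:
  fixes w :: "'a::euclidean_space \<Rightarrow> real"
  assumes "(w has_derivative D) (at x)"
  shows "(\<lambda>n. real (Suc n) * (w (x + (1 / real (Suc n)) *\<^sub>R b) - w x)) \<longlonglongrightarrow> D b"
proof -
  have lin: "linear D" using assms has_derivative_linear by blast
  have "((\<lambda>t. w (x + t *\<^sub>R b)) has_derivative (\<lambda>t. D (t *\<^sub>R b))) (at 0)"
    by (rule has_derivative_compose[of "\<lambda>t. x + t *\<^sub>R b" "\<lambda>t. t *\<^sub>R b" 0 UNIV w D])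
      (use assms in \<open>auto intro!: derivative_eq_intros\<close>)
  then have "((\<lambda>t. w (x + t *\<^sub>R b)) has_real_derivative D b) (at 0)"
    using lin by (simp add: has_field_derivative_def linear_cmul mult_commute_abs)
  then have "((\<lambda>h. (w (x + h *\<^sub>R b) - w x) / h) \<longlongrightarrow> D b) (at 0)"
    by (simp add: DERIV_def)
  moreover have "filterlim (\<lambda>n. 1 / real (Suc n)) (at 0) sequentially"
    unfolding filterlim_at using LIMSEQ_inverse_real_of_nat by (simp add: inverse_eq_divide)
  ultimately have "(\<lambda>n. (w (x + (1 / real (Suc n)) *\<^sub>R b) - w x) / (1 / real (Suc n))) \<longlonglongrightarrow> D b"
    by (rule filterlim_compose)
  then show ?thesis by (simp add: mult.commute)
qed

lemma LINT_eq_by_components: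
  fixes f g :: "'a \<Rightarrow> 'b::euclidean_space"
  assumes "integrable M f" "integrable M g"
    and "\<And>b. b \<in> Basis \<Longrightarrow> (LINT x|M. f x \<bullet> b) = - (LINT x|M. g x \<bullet> b)"
  shows "(LINT x|M. f x) = - (LINT x|M. g x)"
proof (rule euclidean_eqI)
  fix b :: 'b assume "b \<in> Basis"
  then show "(LINT x|M. f x) \<bullet> b = (- (LINT x|M. g x)) \<bullet> b"
    using assms(1,2) assms(3)[of b] by simp
qed

text \<open>The difference quotients are moved from \<open>w\<close> to the test function by translation invariance of
  the Lebesgue measure; both sides then converge by dominated convergence.\<close>

proposition has_weak_gradient_lipschitz:
  fixes w :: "'a::euclidean_space \<Rightarrow> real"
  assumes U: "open U" and lip: "L-lipschitz_on UNIV w"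
    and g: "g \<in> borel_measurable (lebesgue_on U)"
    and lim: "\<And>b. b \<in> Basis \<Longrightarrow> AE x in lebesgue_on U.
      (\<lambda>n. real (Suc n) * (w (x + (1 / real (Suc n)) *\<^sub>R b) - w x)) \<longlonglongrightarrow> g x \<bullet> b"
  shows "has_weak_gradient U w g" "AE x in lebesgue_on U. norm (g x) \<le> L * DIM('a)"
proof -
  have L: "L \<ge> 0" using lip lipschitz_on_nonneg by blast
  have US: "U \<in> sets lebesgue" using U by auto
  have wc: "continuous_on UNIV w" using lip lipschitz_on_continuous_on by blast
  have dql: "\<bar>real (Suc n) * (w (x + (1 / real (Suc n)) *\<^sub>R b) - w x)\<bar> \<le> L" if "b \<in> Basis" for n x b
  proof -
    have "\<bar>w (x + (1 / real (Suc n)) *\<^sub>R b) - w x\<bar> \<le> L * (1 / real (Suc n))"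
      using lipschitz_onD[OF lip, of "x + (1 / real (Suc n)) *\<^sub>R b" x] that
      by (simp add: dist_norm)
    then have "real (Suc n) * \<bar>w (x + (1 / real (Suc n)) *\<^sub>R b) - w x\<bar> \<le> real (Suc n) * (L * (1 / real (Suc n)))"
      by (intro mult_left_mono) auto
    then show ?thesis by (simp add: abs_mult)
  qed
  have gb: "AE x in lebesgue_on U. \<bar>g x \<bullet> b\<bar> \<le> L" if "b \<in> Basis" for b
    using lim[OF that]
  proof eventually_elim
    case (elim x)
    from tendsto_rabs[OF elim] show ?case
      by (rule LIMSEQ_le_const2) (use dql[OF that] in auto)
  qed
  then have "AE x in lebesgue_on U. \<forall>b\<in>Basis. \<bar>g x \<bullet> b\<bar> \<le> L"
    by (intro AE_finite_allI) auto
  then show bound: "AE x in lebesgue_on U. norm (g x) \<le> L * DIM('a)"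
  proof eventually_elim
    case (elim x)
    have "norm (g x) \<le> (\<Sum>b\<in>Basis. \<bar>g x \<bullet> b\<bar>)" by (rule norm_le_l1)
    also have "\<dots> \<le> (\<Sum>b\<in>(Basis::'a set). L)" using elim by (intro sum_mono) auto
    finally show ?case by (simp add: mult.commute)
  qed
  have lw: "locally_integrable U w"
    unfolding locally_integrable_def
  proof (intro allI impI)
    fix S assume S: "compact S \<and> S \<subseteq> U"
    then have "integrable lborel (\<lambda>x. indicator S x *\<^sub>R w x)"
      using wc by (intro borel_integrable_compact) (auto intro: continuous_on_subset)
    then have "integrable lebesgue (\<lambda>x. indicator S x *\<^sub>R w x)"
      using integrable_completion borel_measurable_integrable by blast
    then show "integrable (lebesgue_on S) w"
      using S by (simp add: integrable_restrict_space lmeasurable_compact fmeasurableD)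
  qed
  have lg: "locally_integrable U g"
    unfolding locally_integrable_def
  proof (intro allI impI)
    fix S assume S: "compact S \<and> S \<subseteq> U"
    have SL: "S \<in> lmeasurable" using S lmeasurable_compact by blast
    show "integrable (lebesgue_on S) g"
    proof (rule Bochner_Integration.integrable_bound)
      show "integrable (lebesgue_on S) (\<lambda>x. L * DIM('a))"
        using SL by (rule integrable_const_lebesgue_on)
      show "g \<in> borel_measurable (lebesgue_on S)"
        using g S by (metis measurable_restrict_mono)
      have "AE x in lebesgue. x \<in> U \<longrightarrow> norm (g x) \<le> L * DIM('a)"
        using bound US by (simp add: AE_restrict_space_iff)
      then show "AE x in lebesgue_on S. norm (g x) \<le> norm (L * DIM('a))"
        using SL S L by (subst AE_restrict_space_iff) (auto simp: fmeasurableD elim!: eventually_mono)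
    qed
  qed
  show "has_weak_gradient U w g"
    unfolding has_weak_gradient_def
  proof (intro conjI allI impI lw lg)
    fix \<psi> \<psi>' assume tf: "test_function U \<psi> \<psi>'"
    obtain S where S: "compact S" "S \<subseteq> U" "\<And>x. x \<notin> S \<Longrightarrow> \<psi> x = 0" "\<And>x. x \<notin> S \<Longrightarrow> \<psi>' x = 0"
      and c: "continuous_on UNIV \<psi>" "continuous_on UNIV \<psi>'"
      and der: "\<And>x. (\<psi> has_derivative (\<lambda>h. \<psi>' x \<bullet> h)) (at x)"
      using test_function_support[OF tf] by metis
    obtain B where B: "B \<ge> 0" "B-lipschitz_on UNIV \<psi>"
      using test_function_lipschitz[OF tf] by blast
    show "(LINT x|lebesgue_on U. w x *\<^sub>R \<psi>' x) = - (LINT x|lebesgue_on U. \<psi> x *\<^sub>R g x)"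
    proof (rule LINT_eq_by_components)
      show "integrable (lebesgue_on U) (\<lambda>x. w x *\<^sub>R \<psi>' x)"
        using U lw c S by (intro integrable_compact_support)
      show "integrable (lebesgue_on U) (\<lambda>x. \<psi> x *\<^sub>R g x)"
        using U lg c S by (intro integrable_compact_support')
      fix b :: 'a assume b: "b \<in> Basis"
      define r where "r n = 1 / real (Suc n)" for n
      have rpos: "r n > 0" "r n \<le> 1" for n by (auto simp: r_def)
      have r1: "real (Suc n) * r n = 1" for n by (simp add: r_def)
      have shift: "continuous_on UNIV (\<lambda>x. f (x + v))" "continuous_on UNIV (\<lambda>x. f (v + x))"
        if "continuous_on UNIV f" for f :: "'a \<Rightarrow> real" and v
        by (rule continuous_on_compose2[OF that]; (intro continuous_intros)?; simp)+
      have lhs: "(\<lambda>n. LINT x|lebesgue_on U. \<psi> x * (real (Suc n) * (w (x + r n *\<^sub>R b) - w x)))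
          \<longlonglongrightarrow> (LINT x|lebesgue_on U. \<psi> x * (g x \<bullet> b))"
      proof (rule integral_dominated_convergence[where w="\<lambda>x. L * \<bar>\<psi> x\<bar>"])
        have m\<psi>: "\<psi> \<in> borel_measurable (lebesgue_on U)"
          using continuous_imp_measurable_on_sets_lebesgue[OF continuous_on_subset[OF c(1)] US] by simp
        then show "(\<lambda>x. \<psi> x * (g x \<bullet> b)) \<in> borel_measurable (lebesgue_on U)" using g by auto
        have "continuous_on UNIV (\<lambda>x. w (x + r n *\<^sub>R b) - w x)" for n
          using shift[OF wc] wc by (intro continuous_intros)
        then have "(\<lambda>x. w (x + r n *\<^sub>R b) - w x) \<in> borel_measurable (lebesgue_on U)" for n
          by (intro continuous_imp_measurable_on_sets_lebesgue US) (auto intro: continuous_on_subset)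
        then show "(\<lambda>x. \<psi> x * (real (Suc n) * (w (x + r n *\<^sub>R b) - w x))) \<in> borel_measurable (lebesgue_on U)" for n
          using m\<psi> by auto
        have "integrable lborel \<psi>" using c(1) S by (intro integrable_lborel_compact_support)
        then have "integrable lebesgue \<psi>"
          using integrable_completion borel_measurable_integrable by blast
        then have "integrable (lebesgue_on U) \<psi>"
          using integrable_mult_indicator[OF US, of \<psi>] US by (simp add: integrable_restrict_space)
        then show "integrable (lebesgue_on U) (\<lambda>x. L * \<bar>\<psi> x\<bar>)" by auto
        show "AE x in lebesgue_on U. (\<lambda>n. \<psi> x * (real (Suc n) * (w (x + r n *\<^sub>R b) - w x))) \<longlonglongrightarrow> \<psi> x * (g x \<bullet> b)"
          using lim[OF b] by eventually_elim (unfold r_def, rule tendsto_mult_left)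
        show "AE x in lebesgue_on U. norm (\<psi> x * (real (Suc n) * (w (x + r n *\<^sub>R b) - w x))) \<le> L * \<bar>\<psi> x\<bar>" for n
        proof (rule AE_I2)
          fix x
          show "norm (\<psi> x * (real (Suc n) * (w (x + r n *\<^sub>R b) - w x))) \<le> L * \<bar>\<psi> x\<bar>"
            using mult_left_mono[OF dql[OF b, of n x] abs_ge_zero[of "\<psi> x"]]
            by (simp add: abs_mult r_def mult.commute)
        qed
      qed
      \<comment> \<open>The steps \<open>r n\<close> are at most 1, so the supports of all
        translated test functions lie in the unit neighbourhood of S; it carries the common
        dominating function.\<close>
      define K where "K = {x + y |x y. x \<in> S \<and> y \<in> cball 0 1}"
      have K: "compact K" unfolding K_def by (rule compact_sums) (use S in auto)
      have SK: "S \<subseteq> K" unfolding K_def by force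
      have tK: "\<psi> (- (r n *\<^sub>R b) + x) = 0" if "x \<notin> K" for x n
      proof (rule ccontr)
        assume "\<psi> (- (r n *\<^sub>R b) + x) \<noteq> 0"
        then have "- (r n *\<^sub>R b) + x \<in> S" using S(3) by blast
        moreover have "r n *\<^sub>R b \<in> cball 0 1" using rpos[of n] b by simp
        ultimately have "(- (r n *\<^sub>R b) + x) + r n *\<^sub>R b \<in> K" unfolding K_def by blast
        with that show False by simp
      qed
      \<comment> \<open>U is not translation invariant. The integral is first extended to the whole
        space, which is possible because \<psi> vanishes off S, and only then translated.\<close>
      have eq: "(LINT x|lebesgue_on U. \<psi> x * (real (Suc n) * (w (x + r n *\<^sub>R b) - w x)))
          = (LINT x|lborel. w x * (real (Suc n) * (\<psi> (- (r n *\<^sub>R b) + x) - \<psi> x)))" for n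
      proof -
        define v where "v = r n *\<^sub>R b"
        have c1: "continuous_on UNIV (\<lambda>x. \<psi> x * w (x + v))" "continuous_on UNIV (\<lambda>x. \<psi> x * w x)"
          "continuous_on UNIV (\<lambda>x. \<psi> (- v + x) * w x)"
          by (intro continuous_on_mult shift[OF wc] shift[OF c(1)] wc c(1))+
        have i1: "integrable lborel (\<lambda>x. \<psi> x * w (x + v))" "integrable lborel (\<lambda>x. \<psi> x * w x)"
          using S by (auto intro!: integrable_lborel_compact_support[OF _ S(1)] c1)
        have i2: "integrable lborel (\<lambda>x. \<psi> (- v + x) * w x)"
          by (rule integrable_lborel_compact_support[OF c1(3) K]) (simp only: v_def tK mult_zero_left not_False_eq_True)
        have "(LINT x|lebesgue_on U. \<psi> x * (real (Suc n) * (w (x + v) - w x)))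
           = (LINT x|lborel. \<psi> x * (real (Suc n) * (w (x + v) - w x)))"
          using S c(1) wc shift by (intro LINT_lebesgue_on_eq_lborel US borel_measurable_continuous_onI)
             (auto intro!: continuous_intros)
        also have "\<dots> = (LINT x|lborel. real (Suc n) * (\<psi> x * w (x + v)) - real (Suc n) * (\<psi> x * w x))"
          by (simp add: algebra_simps)
        also have "\<dots> = real (Suc n) * (LINT x|lborel. \<psi> x * w (x + v)) - real (Suc n) * (LINT x|lborel. \<psi> x * w x)"
          using i1 by (subst Bochner_Integration.integral_diff) auto
        also have "(LINT x|lborel. \<psi> x * w (x + v)) = (LINT x|lborel. \<psi> (- v + x) * w x)"
          using LINT_lborel_translate[OF borel_measurable_continuous_onI[OF c1(3)], of v]
          by (simp add: add.commute)
        also have "real (Suc n) * (LINT x|lborel. \<psi> (- v + x) * w x) - real (Suc n) * (LINT x|lborel. \<psi> x * w x)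
          = (LINT x|lborel. real (Suc n) * (\<psi> (- v + x) * w x) - real (Suc n) * (\<psi> x * w x))"
          using i1 i2 by (subst Bochner_Integration.integral_diff) auto
        also have "\<dots> = (LINT x|lborel. w x * (real (Suc n) * (\<psi> (- v + x) - \<psi> x)))"
          by (simp add: algebra_simps)
        finally show ?thesis by (simp add: v_def)
      qed
      have mc: "f \<in> borel_measurable lborel" if "continuous_on UNIV f" for f :: "'a \<Rightarrow> real"
        using borel_measurable_continuous_onI[OF that] by simp
      have rhs: "(\<lambda>n. LINT x|lborel. w x * (real (Suc n) * (\<psi> (- (r n *\<^sub>R b) + x) - \<psi> x)))
          \<longlonglongrightarrow> (LINT x|lborel. w x * (- (\<psi>' x \<bullet> b)))"
      proof (rule integral_dominated_convergence[where w="\<lambda>x. indicator K x *\<^sub>R (B * \<bar>w x\<bar>)"])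
        show "(\<lambda>x. w x * (- (\<psi>' x \<bullet> b))) \<in> borel_measurable lborel"
          by (intro mc continuous_intros wc c)
        show "(\<lambda>x. w x * (real (Suc n) * (\<psi> (- (r n *\<^sub>R b) + x) - \<psi> x))) \<in> borel_measurable lborel" for n
          by (intro mc continuous_on_mult continuous_on_diff
              continuous_on_const shift[OF c(1)] wc c(1))
        show "integrable lborel (\<lambda>x. indicator K x *\<^sub>R (B * \<bar>w x\<bar>))"
          using K wc by (intro borel_integrable_compact) (auto intro!: continuous_intros intro: continuous_on_subset)
        show "AE x in lborel. (\<lambda>n. w x * (real (Suc n) * (\<psi> (- (r n *\<^sub>R b) + x) - \<psi> x))) \<longlonglongrightarrow> w x * (- (\<psi>' x \<bullet> b))"
        proof (rule AE_I2, rule tendsto_mult_left)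
          fix x
          \<comment> \<open>Moving the shift from w to \<psi> reverses its direction; the derivative
            along -b is the minus sign of integration by parts.\<close>
          from has_derivative_sequential[OF der[of x], of "- b"]
          show "(\<lambda>n. real (Suc n) * (\<psi> (- (r n *\<^sub>R b) + x) - \<psi> x)) \<longlonglongrightarrow> - (\<psi>' x \<bullet> b)"
            by (simp add: r_def)
        qed
        show "AE x in lborel. norm (w x * (real (Suc n) * (\<psi> (- (r n *\<^sub>R b) + x) - \<psi> x)))
            \<le> indicator K x *\<^sub>R (B * \<bar>w x\<bar>)" for n
        proof (rule AE_I2)
          fix x
          show "norm (w x * (real (Suc n) * (\<psi> (- (r n *\<^sub>R b) + x) - \<psi> x))) \<le> indicator K x *\<^sub>R (B * \<bar>w x\<bar>)"
          proof (cases "x \<in> K")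
            case True
            have "\<bar>\<psi> (- (r n *\<^sub>R b) + x) - \<psi> x\<bar> \<le> B * r n"
              using lipschitz_onD[OF B(2), of "- (r n *\<^sub>R b) + x" x] b rpos[of n] by (simp add: dist_norm)
            then have "real (Suc n) * \<bar>\<psi> (- (r n *\<^sub>R b) + x) - \<psi> x\<bar> \<le> real (Suc n) * (B * r n)"
              by (intro mult_left_mono) auto
            also have "\<dots> = B" using r1[of n] by (metis mult.left_commute mult.right_neutral)
            finally have "\<bar>w x\<bar> * (real (Suc n) * \<bar>\<psi> (- (r n *\<^sub>R b) + x) - \<psi> x\<bar>) \<le> \<bar>w x\<bar> * B"
              by (intro mult_left_mono) auto
            then show ?thesis using True by (simp add: abs_mult mult.commute)
          next
            case False
            then show ?thesis using tK[of x n] S(3)[of x] SK by auto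
          qed
        qed
      qed
      have "(LINT x|lborel. w x * (- (\<psi>' x \<bullet> b))) = (LINT x|lebesgue_on U. \<psi> x * (g x \<bullet> b))"
        using LIMSEQ_unique[OF rhs] lhs unfolding eq by blast
      moreover have "(LINT x|lebesgue_on U. w x * (\<psi>' x \<bullet> b)) = (LINT x|lborel. w x * (\<psi>' x \<bullet> b))"
      proof (intro LINT_lebesgue_on_eq_lborel US borel_measurable_continuous_onI)
        show "continuous_on UNIV (\<lambda>x. w x * (\<psi>' x \<bullet> b))" by (intro continuous_intros wc c)
        show "w x * (\<psi>' x \<bullet> b) = 0" if "x \<notin> U" for x
        proof -
          have "x \<notin> S" using S(2) that by blast
          then show ?thesis by (simp add: S(4))
        qed
      qed
      ultimately show "(LINT x|lebesgue_on U. (w x *\<^sub>R \<psi>' x) \<bullet> b) = - (LINT x|lebesgue_on U. (\<psi> x *\<^sub>R g x) \<bullet> b)"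
        by simp
    qed
  qed
qed

text \<open>A test function is Lipschitz and differentiable everywhere, so its difference quotients
  converge at every point to the components of the classical gradient and the Lipschitz criterion
  applies.\<close>

lemma has_weak_gradient_test_function:
  assumes "open U" "test_function V \<psi> \<psi>'"
  shows "has_weak_gradient U \<psi> \<psi>'"
proof -
  obtain B where B: "B-lipschitz_on UNIV \<psi>"
    using test_function_lipschitz[OF assms(2)] by blast
  show ?thesis
  proof (rule has_weak_gradient_lipschitz(1)[OF assms(1) B])
    show "\<psi>' \<in> borel_measurable (lebesgue_on U)"
      using assms by (intro continuous_imp_measurable_on_sets_lebesgue)
        (auto simp: test_function_def intro: continuous_on_subset)
    show "AE x in lebesgue_on U. (\<lambda>n. real (Suc n) * (\<psi> (x + (1 / real (Suc n)) *\<^sub>R b) - \<psi> x)) \<longlonglongrightarrow> \<psi>' x \<bullet> b" for b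
      using assms(2) by (intro AE_I2 has_derivative_sequential) (auto simp: test_function_def)
  qed
qed

section \<open>Semi-inner products on function spaces\<close>

text \<open>Elements are functions, not classes modulo null functions, so definiteness cannot be
  demanded: L2 products ignore null sets, and the product of bottom values ignores everything above
  the bottom.\<close>

locale semi_inner =
  fixes S :: "('a \<Rightarrow> real) set" and B :: "('a \<Rightarrow> real) \<Rightarrow> ('a \<Rightarrow> real) \<Rightarrow> real"
  assumes zero_mem: "(\<lambda>_. 0) \<in> S"
    and lincomb_mem: "u \<in> S \<Longrightarrow> v \<in> S \<Longrightarrow> (\<lambda>x. a * u x + b * v x) \<in> S"
    and lincomb_left: "u \<in> S \<Longrightarrow> v \<in> S \<Longrightarrow> w \<in> S \<Longrightarrow>
      B (\<lambda>x. a * u x + b * v x) w = a * B u w + b * B v w"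
    and sym: "u \<in> S \<Longrightarrow> v \<in> S \<Longrightarrow> B u v = B v u"
    and nonneg: "u \<in> S \<Longrightarrow> 0 \<le> B u u"
begin

definition N :: "('a \<Rightarrow> real) \<Rightarrow> real" where "N u = sqrt (B u u)"

lemma N_nonneg: "u \<in> S \<Longrightarrow> 0 \<le> N u"
  by (simp add: N_def nonneg)

lemma N_power2: "u \<in> S \<Longrightarrow> (N u)\<^sup>2 = B u u"
  by (simp add: N_def nonneg)

lemma lincomb_right:
  "u \<in> S \<Longrightarrow> v \<in> S \<Longrightarrow> w \<in> S \<Longrightarrow> B w (\<lambda>x. a * u x + b * v x) = a * B w u + b * B w v"
  by (simp add: sym[of w] lincomb_mem lincomb_left)

lemma diff_mem: "u \<in> S \<Longrightarrow> v \<in> S \<Longrightarrow> (\<lambda>x. u x - v x) \<in> S"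
  using lincomb_mem[of u v 1 "-1"] by simp

lemma add_mem: "u \<in> S \<Longrightarrow> v \<in> S \<Longrightarrow> (\<lambda>x. u x + v x) \<in> S"
  using lincomb_mem[of u v 1 1] by simp

lemma scale_mem: "u \<in> S \<Longrightarrow> (\<lambda>x. a * u x) \<in> S"
  using lincomb_mem[of u u a 0] by simp

lemma diff_left: "u \<in> S \<Longrightarrow> v \<in> S \<Longrightarrow> w \<in> S \<Longrightarrow> B (\<lambda>x. u x - v x) w = B u w - B v w"
  using lincomb_left[of u v w 1 "-1"] by simp

lemma scale_left: "u \<in> S \<Longrightarrow> w \<in> S \<Longrightarrow> B (\<lambda>x. a * u x) w = a * B u w"
  using lincomb_left[of u u w a 0] by simp

lemma add_right: "u \<in> S \<Longrightarrow> v \<in> S \<Longrightarrow> w \<in> S \<Longrightarrow> B w (\<lambda>x. u x + v x) = B w u + B w v"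
  using lincomb_right[of u v w 1 1] by simp

lemma scale_right: "u \<in> S \<Longrightarrow> w \<in> S \<Longrightarrow> B w (\<lambda>x. a * u x) = a * B w u"
  using lincomb_right[of u u w a 0] by simp

lemma square_lincomb:
  assumes "u \<in> S" "v \<in> S"
  shows "B (\<lambda>x. a * u x + b * v x) (\<lambda>x. a * u x + b * v x)
    = a\<^sup>2 * B u u + 2 * a * b * B u v + b\<^sup>2 * B v v"
  using assms sym[of v u]
  by (simp add: lincomb_left lincomb_right lincomb_mem algebra_simps power2_eq_square)

lemma cauchy_schwarz:
  assumes "u \<in> S" "v \<in> S"
  shows "\<bar>B u v\<bar> \<le> N u * N v"
proof -
  have *: "0 \<le> a\<^sup>2 * B u u + 2 * a * b * B u v + b\<^sup>2 * B v v" for a b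
    using nonneg[OF lincomb_mem[OF assms, of a b]] square_lincomb[OF assms, of a b] by simp
  have "(B u v)\<^sup>2 \<le> B u u * B v v"
  proof (cases "B v v = 0")
    case True
    have "B u v = 0"
    proof (rule ccontr)
      assume ne: "B u v \<noteq> 0"
      \<comment> \<open>With B v v = 0 the quadratic form is affine in b; this b makes its value
        -1.\<close>
      have "0 \<le> B u u - (B u u + 1)"
        using *[of 1 "- (B u u + 1) / (2 * B u v)"] True ne by (simp add: field_simps)
      then show False by simp
    qed
    then show ?thesis using True by simp
  next
    case False
    then have pos: "B v v > 0" using nonneg[OF assms(2)] by simp
    \<comment> \<open>The minimizing ratio of the coefficients, multiplied by B v v so that no
      division occurs.\<close>
    have "0 \<le> B v v * (B u u * B v v - (B u v)\<^sup>2)"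
      using *[of "B v v" "- B u v"] by (simp add: algebra_simps power2_eq_square)
    then show ?thesis using pos by (simp add: zero_le_mult_iff)
  qed
  then have "sqrt ((B u v)\<^sup>2) \<le> sqrt (B u u * B v v)" by (rule real_sqrt_le_mono)
  then show ?thesis by (simp add: N_def real_sqrt_mult)
qed

lemma N_triangle:
  assumes "u \<in> S" "v \<in> S"
  shows "N (\<lambda>x. a * u x + b * v x) \<le> \<bar>a\<bar> * N u + \<bar>b\<bar> * N v"
proof (rule power2_le_imp_le)
  have "a * b * B u v \<le> \<bar>a\<bar> * \<bar>b\<bar> * (N u * N v)"
    using mult_left_mono[OF cauchy_schwarz[OF assms], of "\<bar>a\<bar> * \<bar>b\<bar>"] abs_ge_self[of "a * b * B u v"]
    by (simp add: abs_mult)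
  then show "(N (\<lambda>x. a * u x + b * v x))\<^sup>2 \<le> (\<bar>a\<bar> * N u + \<bar>b\<bar> * N v)\<^sup>2"
    using assms by (simp add: N_power2 lincomb_mem square_lincomb power2_sum power_mult_distrib
        algebra_simps)
  show "0 \<le> \<bar>a\<bar> * N u + \<bar>b\<bar> * N v" using assms by (simp add: N_nonneg)
qed

lemma N_scale:
  assumes "u \<in> S"
  shows "N (\<lambda>x. a * u x) = \<bar>a\<bar> * N u"
proof -
  have "B (\<lambda>x. a * u x) (\<lambda>x. a * u x) = a\<^sup>2 * B u u"
    using assms by (simp add: scale_left scale_right scale_mem power2_eq_square)
  then show ?thesis by (simp add: N_def real_sqrt_mult)
qed

lemma semi_inner_subset:
  assumes "S' \<subseteq> S" "(\<lambda>_. 0) \<in> S'"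
    "\<And>u v a b. u \<in> S' \<Longrightarrow> v \<in> S' \<Longrightarrow> (\<lambda>x. a * u x + b * v x) \<in> S'"
  shows "semi_inner S' B"
  using assms by unfold_locales (auto intro: lincomb_left sym nonneg)

text \<open>Induction on the number of points that determine an element up to null vectors: the functions
  of the space that vanish at one of the points have codimension at most one.\<close>

lemma riesz_representation:
  assumes "finite P" "S' \<subseteq> S" "(\<lambda>_. 0) \<in> S'"
    "\<And>u v a b. u \<in> S' \<Longrightarrow> v \<in> S' \<Longrightarrow> (\<lambda>x. a * u x + b * v x) \<in> S'"
    and null: "\<And>u. u \<in> S' \<Longrightarrow> (\<forall>p\<in>P. u p = 0) \<Longrightarrow> B u u = 0"
    and L: "\<And>u v a b. u \<in> S' \<Longrightarrow> v \<in> S' \<Longrightarrow> L (\<lambda>x. a * u x + b * v x) = a * L u + b * L v"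
    and Lnull: "\<And>u. u \<in> S' \<Longrightarrow> B u u = 0 \<Longrightarrow> L u = 0"
  shows "\<exists>z\<in>S'. \<forall>u\<in>S'. L u = B z u"
  using assms
proof (induction P arbitrary: S' L rule: finite_induct)
  case empty
  have "B (\<lambda>_. 0) u = 0" if "u \<in> S'" for u
    using scale_left[of u u 0] that empty.prems(1) by auto
  then show ?case using empty by (intro bexI[of _ "\<lambda>_. 0"]) auto
next
  case (insert p P)
  interpret S': semi_inner S' B
    using insert.prems by (intro semi_inner_subset)
  define S0 where "S0 = {u \<in> S'. u p = 0}"
  have S0S': "S0 \<subseteq> S'" by (auto simp: S0_def)
  have IH: "\<exists>z\<in>S0. \<forall>u\<in>S0. L u = B z u"
    if "\<And>u v a b. u \<in> S0 \<Longrightarrow> v \<in> S0 \<Longrightarrow> L (\<lambda>x. a * u x + b * v x) = a * L u + b * L v"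
      "\<And>u. u \<in> S0 \<Longrightarrow> B u u = 0 \<Longrightarrow> L u = 0" for L
    by (rule insert.IH) (use that insert.prems(1,2,4) S'.lincomb_mem in \<open>auto simp: S0_def\<close>)
  obtain z where z: "z \<in> S0" "\<forall>u\<in>S0. L u = B z u"
    using IH[of L] insert.prems(5,6) S0S' by blast
  show ?case
  proof (cases "S0 = S'")
    case True
    then show ?thesis using z by blast
  next
    case False
    then obtain w where w: "w \<in> S'" "w p \<noteq> 0" by (auto simp: S0_def)
    \<comment> \<open>The induction hypothesis, applied to B w instead of L, supplies an orthogonal
      projection y of w to S0. It is applicable because B w annihilates null vectors by
      Cauchy-Schwarz. The remainder w - y is orthogonal to S0 and still nonzero at p.\<close>
    have "\<exists>y\<in>S0. \<forall>u\<in>S0. B w u = B y u"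
    proof (rule IH)
      show "B w (\<lambda>x. a * u x + b * v x) = a * B w u + b * B w v" if "u \<in> S0" "v \<in> S0" for u v a b
        using that S0S' w by (intro S'.lincomb_right) auto
      show "B w u = 0" if "u \<in> S0" "B u u = 0" for u
        using S'.cauchy_schwarz[of w u] that w S0S' by (auto simp: S'.N_def)
    qed
    then obtain y where y: "y \<in> S0" "\<And>u. u \<in> S0 \<Longrightarrow> B w u = B y u" by blast
    define e where "e = (\<lambda>x. w x - y x)"
    have eS: "e \<in> S'" unfolding e_def using w y S0S' by (intro S'.diff_mem) auto
    have ep: "e p \<noteq> 0" using w(2) y(1) by (simp add: e_def S0_def)
    have orth: "B e u = 0" if "u \<in> S0" for u
      using y that w S0S' unfolding e_def by (subst S'.diff_left) auto
    have zS: "z \<in> S'" using z S0S' by auto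
    \<comment> \<open>The multiple of e that makes z' represent L on e. If e is a null vector then L
      e = 0 by assumption, and the value 0 is correct.\<close>
    define t where "t = (if B e e = 0 then 0 else L e / B e e)"
    define z' where "z' = (\<lambda>x. 1 * z x + t * e x)"
    have z'S: "z' \<in> S'" unfolding z'_def using zS eS by (rule S'.lincomb_mem)
    have "L u = B z' u" if u: "u \<in> S'" for u
    proof -
      \<comment> \<open>With this r the function u - r e vanishes at p, so it lies in S0.\<close>
      define r where "r = u p / e p"
      define u0 where "u0 = (\<lambda>x. 1 * u x + (- r) * e x)"
      have u0: "u0 \<in> S0" "u0 \<in> S'"
        using S'.lincomb_mem[OF u eS, of 1 "- r"] ep by (auto simp: u0_def S0_def r_def)
      have "u = (\<lambda>x. 1 * u0 x + r * e x)" by (auto simp: u0_def)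
      then have Lu: "L u = L u0 + r * L e" and Bu: "B z' u = B z' u0 + r * B z' e"
        using insert.prems(5)[OF u0(2) eS, of 1 r] S'.lincomb_right[OF u0(2) eS z'S, of 1 r] by auto
      have "B z' u0 = B z u0"
        unfolding z'_def using zS eS u0 orth by (subst S'.lincomb_left) auto
      moreover have "B z' e = L e"
      proof -
        have "B z e = 0" using orth[OF z(1)] S'.sym[OF zS eS] by simp
        then have "B z' e = t * B e e"
          unfolding z'_def using zS eS by (subst S'.lincomb_left) auto
        then show ?thesis using insert.prems(6)[OF eS] by (auto simp: t_def)
      qed
      ultimately show ?thesis using Lu Bu z(2) u0(1) by simp
    qed
    then show ?thesis using z'S by blast
  qed
qed

end

lemma semi_inner_scale:
  assumes "semi_inner S B" "r \<ge> 0"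
  shows "semi_inner S (\<lambda>u v. r * B u v)"
proof -
  interpret semi_inner S B by fact
  show ?thesis
  proof
    fix u v w :: "'a \<Rightarrow> real" and a b :: real
    show "r * B (\<lambda>x. a * u x + b * v x) w = a * (r * B u w) + b * (r * B v w)"
      if "u \<in> S" "v \<in> S" "w \<in> S"
      using lincomb_left[OF that, of a b] by (simp add: algebra_simps)
    show "r * B u v = r * B v u" if "u \<in> S" "v \<in> S"
      using sym[OF that] by simp
    show "0 \<le> r * B u u" if "u \<in> S"
      using nonneg[OF that] assms(2) by simp
  qed (auto intro: zero_mem lincomb_mem)
qed

section \<open>Weighted spaces\<close>

text \<open>Completeness of Lebesgue measure: the two functions differ on a null set, all of whose
  subsets are measurable. It transfers measurability to chosen gradients and traces, which are known
  only almost everywhere.\<close>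

lemma borel_measurable_lebesgue_on_AE:
  fixes f g :: "'a::euclidean_space \<Rightarrow> 'b::euclidean_space"
  assumes "U \<in> sets lebesgue" "g \<in> borel_measurable (lebesgue_on U)" "AE x in lebesgue_on U. f x = g x"
  shows "f \<in> borel_measurable (lebesgue_on U)"
proof (rule borel_measurableI)
  fix Q :: "'b set" assume "open Q"
  define Z where "Z = {x \<in> U. f x \<noteq> g x}"
  have "AE x in lebesgue. x \<notin> Z"
    using assms(1,3) by (simp add: AE_restrict_space_iff Z_def)
  then have "Z \<in> null_sets lebesgue"
    by (simp add: completion.null_sets_iff_AE)
  then have Z: "negligible Z" by (simp add: negligible_iff_null_sets)
  have "f -` Q \<inter> U = (g -` Q \<inter> U - Z) \<union> (f -` Q \<inter> Z)" by (auto simp: Z_def)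
  moreover have "g -` Q \<inter> U \<in> sets lebesgue"
    using measurable_sets[OF assms(2), of Q] \<open>open Q\<close> assms(1)
    by (auto simp: sets_restrict_space_iff)
  moreover have "Z \<in> sets lebesgue" "f -` Q \<inter> Z \<in> sets lebesgue"
    using Z negligible_imp_sets negligible_subset[OF Z, of "f -` Q \<inter> Z"] by auto
  ultimately show "f -` Q \<inter> space (lebesgue_on U) \<in> sets (lebesgue_on U)"
    using assms(1) by (auto simp: sets_restrict_space_iff)
qed

locale weighted_domain =
  fixes \<rho> :: "'a::euclidean_space \<Rightarrow> real" and U :: "'a set"
  assumes open_U: "open U"
    and weight_measurable: "\<rho> \<in> borel_measurable (lebesgue_on U)"
    and weight_nonneg: "\<And>x. 0 \<le> \<rho> x"
begin

lemma U_sets: "U \<in> sets lebesgue" using open_U by auto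

lemma L2w_bound:
  fixes f :: "'a \<Rightarrow> 'b::euclidean_space" and g :: "'a \<Rightarrow> 'c::euclidean_space"
  assumes "f \<in> L2w \<rho> U" "g \<in> borel_measurable (lebesgue_on U)"
    "AE x in lebesgue_on U. norm (g x) \<le> K * norm (f x)"
  shows "g \<in> L2w \<rho> U"
  unfolding L2w_def
proof (intro CollectI conjI assms(2))
  show "integrable (lebesgue_on U) (\<lambda>x. \<rho> x * (norm (g x))\<^sup>2)"
  proof (rule Bochner_Integration.integrable_bound)
    show "integrable (lebesgue_on U) (\<lambda>x. K\<^sup>2 * (\<rho> x * (norm (f x))\<^sup>2))"
      using assms(1) by (auto simp: L2w_def)
    show "(\<lambda>x. \<rho> x * (norm (g x))\<^sup>2) \<in> borel_measurable (lebesgue_on U)"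
      using weight_measurable assms(2) by measurable
    show "AE x in lebesgue_on U. norm (\<rho> x * (norm (g x))\<^sup>2) \<le> norm (K\<^sup>2 * (\<rho> x * (norm (f x))\<^sup>2))"
      using assms(3)
    proof eventually_elim
      case (elim x)
      have "(norm (g x))\<^sup>2 \<le> (K * norm (f x))\<^sup>2" using elim by (intro power_mono) auto
      then have "\<rho> x * (norm (g x))\<^sup>2 \<le> \<rho> x * (K * norm (f x))\<^sup>2"
        using weight_nonneg by (rule mult_left_mono)
      then show ?case using weight_nonneg[of x] by (simp add: power_mult_distrib algebra_simps)
    qed
  qed
qed

lemma L2w_inner_integrable:
  fixes f g :: "'a \<Rightarrow> 'b::euclidean_space"
  assumes "f \<in> L2w \<rho> U" "g \<in> L2w \<rho> U"
  shows "integrable (lebesgue_on U) (\<lambda>x. \<rho> x * (f x \<bullet> g x))"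
proof (rule Bochner_Integration.integrable_bound)
  show "integrable (lebesgue_on U) (\<lambda>x. \<rho> x * (norm (f x))\<^sup>2 + \<rho> x * (norm (g x))\<^sup>2)"
    using assms by (auto simp: L2w_def)
  have "f \<in> borel_measurable (lebesgue_on U)" "g \<in> borel_measurable (lebesgue_on U)"
    using assms by (auto simp: L2w_def)
  then show "(\<lambda>x. \<rho> x * (f x \<bullet> g x)) \<in> borel_measurable (lebesgue_on U)"
    using weight_measurable by measurable
  show "AE x in lebesgue_on U. norm (\<rho> x * (f x \<bullet> g x))
      \<le> norm (\<rho> x * (norm (f x))\<^sup>2 + \<rho> x * (norm (g x))\<^sup>2)"
  proof (rule AE_I2)
    fix x
    have "\<bar>f x \<bullet> g x\<bar> \<le> norm (f x) * norm (g x)" by (rule Cauchy_Schwarz_ineq2)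
    also have "\<dots> \<le> (norm (f x))\<^sup>2 + (norm (g x))\<^sup>2"
      using sum_squares_bound[of "norm (f x)" "norm (g x)"]
        mult_nonneg_nonneg[OF norm_ge_zero[of "f x"] norm_ge_zero[of "g x"]] by linarith
    finally have "\<rho> x * \<bar>f x \<bullet> g x\<bar> \<le> \<rho> x * ((norm (f x))\<^sup>2 + (norm (g x))\<^sup>2)"
      using weight_nonneg by (rule mult_left_mono)
    then show "norm (\<rho> x * (f x \<bullet> g x)) \<le> norm (\<rho> x * (norm (f x))\<^sup>2 + \<rho> x * (norm (g x))\<^sup>2)"
      using weight_nonneg[of x] by (simp add: abs_mult algebra_simps)
  qed
qed

lemma L2w_lincomb:
  fixes f g :: "'a \<Rightarrow> 'b::euclidean_space"
  assumes "f \<in> L2w \<rho> U" "g \<in> L2w \<rho> U"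
  shows "(\<lambda>x. a *\<^sub>R f x + b *\<^sub>R g x) \<in> L2w \<rho> U"
proof -
  have m: "f \<in> borel_measurable (lebesgue_on U)" "g \<in> borel_measurable (lebesgue_on U)"
    using assms by (auto simp: L2w_def)
  have eq: "\<rho> x * (norm (a *\<^sub>R f x + b *\<^sub>R g x))\<^sup>2
      = a\<^sup>2 * (\<rho> x * (f x \<bullet> f x)) + 2 * a * b * (\<rho> x * (f x \<bullet> g x)) + b\<^sup>2 * (\<rho> x * (g x \<bullet> g x))" for x
    unfolding power2_norm_eq_inner
    by (simp add: inner_add_left inner_add_right inner_commute[of "g x" "f x"] power2_eq_square ring_distribs)
  have "integrable (lebesgue_on U) (\<lambda>x. \<rho> x * (norm (a *\<^sub>R f x + b *\<^sub>R g x))\<^sup>2)"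
    unfolding eq using L2w_inner_integrable[OF assms(1,1)] L2w_inner_integrable[OF assms]
      L2w_inner_integrable[OF assms(2,2)] by auto
  then show ?thesis using m by (auto simp: L2w_def)
qed

lemma H1w_has_weak_gradient:
  "w \<in> H1w \<rho> U \<Longrightarrow> has_weak_gradient U w (weak_gradient U w)"
  unfolding H1w_def using has_weak_gradient_weak_gradient by auto

text \<open>\<open>H1w\<close> asks for square integrability of the chosen weak gradient; by almost
  everywhere uniqueness it is enough to exhibit any square integrable one.\<close>

lemma H1wI:
  assumes "w \<in> L2w \<rho> U" "has_weak_gradient U w g" "g \<in> L2w \<rho> U"
  shows "w \<in> H1w \<rho> U"
proof -
  have ae: "AE x in lebesgue_on U. weak_gradient U w x = g x"
    by (rule weak_gradient_AE[OF open_U assms(2)])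
  have "weak_gradient U w \<in> L2w \<rho> U"
  proof (rule L2w_bound[OF assms(3), where K=1])
    show "weak_gradient U w \<in> borel_measurable (lebesgue_on U)"
      using assms(3) by (intro borel_measurable_lebesgue_on_AE[OF U_sets _ ae]) (auto simp: L2w_def)
    show "AE x in lebesgue_on U. norm (weak_gradient U w x) \<le> 1 * norm (g x)"
      using ae by eventually_elim simp
  qed
  then show ?thesis using assms by (auto simp: H1w_def)
qed

lemma H1w_lincomb:
  assumes "u \<in> H1w \<rho> U" "v \<in> H1w \<rho> U"
  shows "(\<lambda>x. a * u x + b * v x) \<in> H1w \<rho> U"
proof (rule H1wI)
  show "(\<lambda>x. a * u x + b * v x) \<in> L2w \<rho> U"
    using L2w_lincomb[of u v a b] assms by (auto simp: H1w_def)
  show "has_weak_gradient U (\<lambda>x. a * u x + b * v x) (\<lambda>x. a *\<^sub>R weak_gradient U u x + b *\<^sub>R weak_gradient U v x)"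
    using assms by (intro has_weak_gradient_lincomb open_U H1w_has_weak_gradient)
  show "(\<lambda>x. a *\<^sub>R weak_gradient U u x + b *\<^sub>R weak_gradient U v x) \<in> L2w \<rho> U"
    using assms by (intro L2w_lincomb) (auto simp: H1w_def)
qed

lemma H1w_zero: "(\<lambda>_. 0) \<in> H1w \<rho> U"
  by (rule H1wI[where g="\<lambda>_. 0"]) (auto simp: L2w_def has_weak_gradient_def locally_integrable_def)

end

text \<open>One form covers the energy of the extension problem up to the factor 1/d_s, the squared
  H1 norm (identity and k = 1), the Dirichlet integral (identity and k = 0), and the form of the
  eigenvalue problem on \<Omega>.\<close>

definition grad_form where
  "grad_form \<rho> U M k u v = (LINT z|lebesgue_on U. \<rho> z *
     (M z (weak_gradient U u z) \<bullet> weak_gradient U v z + k z * u z * v z))"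

locale elliptic_form = weighted_domain \<rho> U for \<rho> :: "'a::euclidean_space \<Rightarrow> real" and U +
  fixes M :: "'a \<Rightarrow> 'a \<Rightarrow> 'a" and k :: "'a \<Rightarrow> real" and K b :: real
  assumes M_linear: "z \<in> U \<Longrightarrow> linear (M z)"
    and M_sym: "z \<in> U \<Longrightarrow> M z p \<bullet> q = M z q \<bullet> p"
    and M_nonneg: "z \<in> U \<Longrightarrow> 0 \<le> M z p \<bullet> p"
    and M_bounded: "z \<in> U \<Longrightarrow> norm (M z p) \<le> K * norm p"
    and M_measurable: "g \<in> borel_measurable (lebesgue_on U) \<Longrightarrow>
      (\<lambda>z. M z (g z)) \<in> borel_measurable (lebesgue_on U)"
    and k_measurable: "k \<in> borel_measurable (lebesgue_on U)"
    and k_bounds: "AE z in lebesgue_on U. 0 \<le> k z \<and> k z \<le> b"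
begin

lemma integrand_integrable:
  assumes "u \<in> H1w \<rho> U" "v \<in> H1w \<rho> U"
  shows "integrable (lebesgue_on U) (\<lambda>z. \<rho> z *
     (M z (weak_gradient U u z) \<bullet> weak_gradient U v z + k z * u z * v z))"
proof -
  have L: "u \<in> L2w \<rho> U" "v \<in> L2w \<rho> U" "weak_gradient U u \<in> L2w \<rho> U" "weak_gradient U v \<in> L2w \<rho> U"
    using assms by (auto simp: H1w_def)
  then have m: "u \<in> borel_measurable (lebesgue_on U)"
      "weak_gradient U u \<in> borel_measurable (lebesgue_on U)"
    by (auto simp: L2w_def)
  have "(\<lambda>z. M z (weak_gradient U u z)) \<in> L2w \<rho> U"
    by (rule L2w_bound[OF L(3) M_measurable[OF m(2)], where K=K]) (auto intro!: AE_I2 M_bounded)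
  moreover have "(\<lambda>z. k z * u z) \<in> L2w \<rho> U"
  proof (rule L2w_bound[OF L(1), where K=b])
    show "(\<lambda>z. k z * u z) \<in> borel_measurable (lebesgue_on U)"
      using k_measurable m(1) by measurable
    show "AE z in lebesgue_on U. norm (k z * u z) \<le> b * norm (u z)"
      using k_bounds by eventually_elim (auto simp: abs_mult intro: mult_right_mono)
  qed
  ultimately have "integrable (lebesgue_on U) (\<lambda>z. \<rho> z * (M z (weak_gradient U u z) \<bullet> weak_gradient U v z)
      + \<rho> z * ((k z * u z) \<bullet> v z))"
    using L by (intro Bochner_Integration.integrable_add L2w_inner_integrable)
  then show ?thesis by (simp add: algebra_simps)
qed

sublocale semi_inner "H1w \<rho> U" "grad_form \<rho> U M k"
proof
  show "(\<lambda>_. 0) \<in> H1w \<rho> U" by (rule H1w_zero)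
  show "(\<lambda>x. a * u x + b * v x) \<in> H1w \<rho> U" if "u \<in> H1w \<rho> U" "v \<in> H1w \<rho> U" for u v a b
    using that by (rule H1w_lincomb)
  show "grad_form \<rho> U M k (\<lambda>x. a * u x + b * v x) w = a * grad_form \<rho> U M k u w + b * grad_form \<rho> U M k v w"
    if uvw: "u \<in> H1w \<rho> U" "v \<in> H1w \<rho> U" "w \<in> H1w \<rho> U" for u v w a b
  proof -
    let ?i = "\<lambda>u z. \<rho> z * (M z (weak_gradient U u z) \<bullet> weak_gradient U w z + k z * u z * w z)"
    have "AE z in lebesgue_on U. weak_gradient U (\<lambda>x. a * u x + b * v x) z
        = a *\<^sub>R weak_gradient U u z + b *\<^sub>R weak_gradient U v z"
      by (rule weak_gradient_lincomb_AE[OF open_U H1w_has_weak_gradient[OF uvw(1)] H1w_has_weak_gradient[OF uvw(2)]])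
    moreover have "AE z in lebesgue_on U. z \<in> U" by (rule AE_I2) simp
    ultimately have "AE z in lebesgue_on U. ?i (\<lambda>x. a * u x + b * v x) z = a *\<^sub>R ?i u z + b *\<^sub>R ?i v z"
    proof eventually_elim
      case (elim z)
      then show ?case
        by (simp add: linear_add[OF M_linear] linear_cmul[OF M_linear] inner_add_left algebra_simps)
    qed
    then have "(LINT z|lebesgue_on U. ?i (\<lambda>x. a * u x + b * v x) z)
        = (LINT z|lebesgue_on U. a *\<^sub>R ?i u z + b *\<^sub>R ?i v z)"
      using uvw integrand_integrable[OF H1w_lincomb[OF uvw(1,2)] uvw(3)] 
        integrand_integrable[OF uvw(1,3)] integrand_integrable[OF uvw(2,3)]
      by (intro integral_cong_AE borel_measurable_integrable Bochner_Integration.integrable_add integrable_scaleR_right)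
    also have "\<dots> = a *\<^sub>R (LINT z|lebesgue_on U. ?i u z) + b *\<^sub>R (LINT z|lebesgue_on U. ?i v z)"
      by (rule LINT_lincomb) (rule integrand_integrable uvw)+
    finally show ?thesis by (simp add: grad_form_def)
  qed
  show "grad_form \<rho> U M k u v = grad_form \<rho> U M k v u" for u v
    unfolding grad_form_def
    by (intro Bochner_Integration.integral_cong refl) (auto simp: M_sym mult_ac)
  show "0 \<le> grad_form \<rho> U M k u u" for u
    unfolding grad_form_def
  proof (rule integral_nonneg_AE)
    have "AE z in lebesgue_on U. z \<in> U" by (rule AE_I2) simp
    with k_bounds show "AE z in lebesgue_on U.
        0 \<le> \<rho> z * (M z (weak_gradient U u z) \<bullet> weak_gradient U u z + k z * u z * u z)"
    proof eventually_elim
      case (elim z)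
      then have "0 \<le> k z * (u z * u z)" by simp
      with elim show ?case using weight_nonneg[of z] M_nonneg[of z "weak_gradient U u z"]
        by (simp add: mult.assoc)
    qed
  qed
qed

end

section \<open>Product measures\<close>

lemma lborel_tensor_product:
  fixes f :: "'a::euclidean_space \<Rightarrow> real" and g :: "'b::euclidean_space \<Rightarrow> real"
  assumes "integrable lborel f" "integrable lborel g"
  shows "integrable lborel (\<lambda>z. f (fst z) * g (snd z))"
    and "(LINT z|lborel. f (fst z) * g (snd z)) = (LINT x|lborel. f x) * (LINT y|lborel. g y)"
proof -
  have f: "f \<in> borel_measurable lborel" and g: "g \<in> borel_measurable lborel" using assms by auto
  have "integrable (lborel \<Otimes>\<^sub>M lborel) (\<lambda>z. f (fst z) * g (snd z))"
  proof (rule lborel_pair.Fubini_integrable)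
    show "(\<lambda>z. f (fst z) * g (snd z)) \<in> borel_measurable (lborel \<Otimes>\<^sub>M lborel)"
      using f g by (intro borel_measurable_times measurable_compose[OF measurable_fst f] measurable_compose[OF measurable_snd g])
    show "integrable lborel (\<lambda>x. LINT y|lborel. norm (f (fst (x, y)) * g (snd (x, y))))"
      using assms by (simp add: abs_mult)
    show "AE x in lborel. integrable lborel (\<lambda>y. f (fst (x, y)) * g (snd (x, y)))"
      using assms by simp
  qed
  note int = this
  then show "integrable lborel (\<lambda>z. f (fst z) * g (snd z))" by (simp add: lborel_prod)
  show "(LINT z|lborel. f (fst z) * g (snd z)) = (LINT x|lborel. f x) * (LINT y|lborel. g y)"
    using lborel_pair.integral_fst'[OF int] assms by (simp add: lborel_prod)
qed

text \<open>A cylinder over a null set is null. The detour through a Borel null cover is due to the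
  fact that Lebesgue measure on the product is the completion of the Borel product measure.\<close>

lemma AE_lebesgue_fst:
  assumes "AE x in (lebesgue :: 'a::euclidean_space measure). P x"
  shows "AE z in (lebesgue :: ('a \<times> 'b::euclidean_space) measure). P (fst z)"
proof -
  have "AE x in lborel. P x" using assms by (simp add: AE_completion_iff)
  then obtain N where N: "N \<in> null_sets lborel" "{x. \<not> P x} \<subseteq> N"
    by (auto simp: eventually_ae_filter)
  have "N \<times> (UNIV :: 'b set) \<in> null_sets (lborel \<Otimes>\<^sub>M lborel)"
  proof (rule null_setsI)
    have "emeasure (lborel \<Otimes>\<^sub>M lborel) (N \<times> (UNIV :: 'b set)) = emeasure lborel N * emeasure lborel (UNIV :: 'b set)"
      using N(1) by (intro lborel.emeasure_pair_measure_Times) auto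
    then show "emeasure (lborel \<Otimes>\<^sub>M lborel) (N \<times> (UNIV :: 'b set)) = 0" using null_setsD1[OF N(1)] by simp
    show "N \<times> (UNIV :: 'b set) \<in> sets (lborel \<Otimes>\<^sub>M lborel)"
      using N(1) by (intro pair_measureI) auto
  qed
  then have "AE z in (lborel :: ('a \<times> 'b) measure). z \<notin> N \<times> UNIV"
    by (simp add: lborel_prod AE_not_in)
  then have "AE z in (lborel :: ('a \<times> 'b) measure). P (fst z)"
    by eventually_elim (use N(2) in \<open>auto simp: mem_Times_iff\<close>)
  then show ?thesis by (rule AE_completion)
qed

lemma AE_lebesgue_snd:
  assumes "AE x in (lebesgue :: 'b::euclidean_space measure). P x"
  shows "AE z in (lebesgue :: ('a::euclidean_space \<times> 'b) measure). P (snd z)"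
proof -
  have "AE x in lborel. P x" using assms by (simp add: AE_completion_iff)
  then obtain N where N: "N \<in> null_sets lborel" "{x. \<not> P x} \<subseteq> N"
    by (auto simp: eventually_ae_filter)
  have "(UNIV :: 'a set) \<times> N \<in> null_sets (lborel \<Otimes>\<^sub>M lborel)"
  proof (rule null_setsI)
    have "emeasure (lborel \<Otimes>\<^sub>M lborel) ((UNIV :: 'a set) \<times> N) = emeasure lborel (UNIV :: 'a set) * emeasure lborel N"
      using N(1) by (intro lborel.emeasure_pair_measure_Times) auto
    then show "emeasure (lborel \<Otimes>\<^sub>M lborel) ((UNIV :: 'a set) \<times> N) = 0" using null_setsD1[OF N(1)] by simp
    show "(UNIV :: 'a set) \<times> N \<in> sets (lborel \<Otimes>\<^sub>M lborel)"
      using N(1) by (intro pair_measureI) auto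
  qed
  then have "AE z in (lborel :: ('a \<times> 'b) measure). z \<notin> UNIV \<times> N"
    by (simp add: lborel_prod AE_not_in)
  then have "AE z in (lborel :: ('a \<times> 'b) measure). P (snd z)"
    by eventually_elim (use N(2) in \<open>auto simp: mem_Times_iff\<close>)
  then show ?thesis by (rule AE_completion)
qed

lemma borel_measurable_lebesgue_on_borel:
  "f \<in> borel_measurable borel \<Longrightarrow> f \<in> borel_measurable (lebesgue_on U)"
  by (intro measurable_restrict_space1 measurable_completion) simp

text \<open>Composing with the projection is immediate for Borel functions. A Lebesgue measurable f
  is replaced by a Borel version, and the error is confined to a cylinder over a null set. This
  serves the merely measurable coefficient c.\<close>

lemma borel_measurable_lebesgue_on_fst:
  fixes f :: "'a::euclidean_space \<Rightarrow> real" and I :: "'b::euclidean_space set"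
  assumes "open U" "open I" "f \<in> borel_measurable (lebesgue_on U)"
  shows "(\<lambda>z. f (fst z)) \<in> borel_measurable (lebesgue_on (U \<times> I))"
proof -
  have "(\<lambda>x. indicator U x * f x) \<in> borel_measurable lebesgue"
    using assms(1,3) borel_measurable_restrict_space_iff[of U lebesgue f] by simp
  from completion_ex_borel_measurable_real[OF this] obtain f' where f': "f' \<in> borel_measurable lborel"
    and "AE x in lborel. indicator U x * f x = f' x" by blast
  then have "AE x in lebesgue. indicator U x * f x = f' x" by (simp add: AE_completion)
  then have "AE z in (lebesgue :: ('a \<times> 'b) measure). indicator U (fst z) * f (fst z) = f' (fst z)"
    by (rule AE_lebesgue_fst)
  then have ae: "AE z in lebesgue_on (U \<times> I). f (fst z) = f' (fst z)"
    using assms(1,2) by (subst AE_restrict_space_iff) (auto simp: open_Times elim!: eventually_mono)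
  have "(\<lambda>z::'a \<times> 'b. f' (fst z)) \<in> borel_measurable borel"
    using f' by (intro measurable_compose[OF borel_measurable_continuous_onI[of fst]]) (auto intro: continuous_on_fst continuous_on_id)
  then have "(\<lambda>z. f' (fst z)) \<in> borel_measurable (lebesgue_on (U \<times> I))"
    by (rule borel_measurable_lebesgue_on_borel)
  then show ?thesis
    using ae assms(1,2) by (intro borel_measurable_lebesgue_on_AE[OF _ _ ae]) (auto simp: open_Times)
qed

lemma integrable_lebesgue_on_of_lborel:
  fixes f :: "'a::euclidean_space \<Rightarrow> 'b::euclidean_space"
  assumes "U \<in> sets lebesgue" "integrable lborel f"
  shows "integrable (lebesgue_on U) f"
proof -
  have "integrable lebesgue f"
    using assms(2) by (subst integrable_completion) auto
  then show ?thesis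
    using integrable_mult_indicator[OF assms(1), of f] assms(1) by (simp add: integrable_restrict_space)
qed

text \<open>Applied with exponent 1-2s for the weight and 2s-1 for its reciprocal; both exceed -1
  exactly because 0 < s < 1.\<close>

lemma integrable_snd_powr:
  fixes \<Omega> :: "'a::euclidean_space set" and r Y :: real
  assumes "open \<Omega>" "bounded \<Omega>" "- 1 < r" "0 < Y"
  shows "integrable (lebesgue_on (\<Omega> \<times> {0<..<Y})) (\<lambda>z. snd z powr r)"
proof -
  have "(\<lambda>y. y powr r) integrable_on {0..Y}"
    using assms by (intro integrable_on_powr_from_0) auto
  then have "(\<lambda>y. y powr r) absolutely_integrable_on {0..Y}"
    by (intro nonnegative_absolutely_integrable_1) auto
  then have "integrable lebesgue (\<lambda>y. indicator {0..Y} y * y powr r)"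
    by (simp add: set_integrable_def)
  then have 1: "integrable lborel (\<lambda>y. indicator {0..Y} y * y powr r)"
    by (subst (asm) integrable_completion) auto
  have "emeasure lborel \<Omega> < \<infinity>"
    using assms(2) by (rule emeasure_bounded_finite)
  then have 2: "integrable lborel (indicator \<Omega> :: 'a \<Rightarrow> real)"
    using assms(1) by (intro integrable_real_indicator) auto
  have "integrable lborel (\<lambda>z::'a \<times> real. indicator \<Omega> (fst z) * (indicator {0..Y} (snd z) * snd z powr r))"
    by (rule lborel_tensor_product(1)[OF 2 1])
  then have "integrable (lebesgue_on (\<Omega> \<times> {0<..<Y})) (\<lambda>z::'a \<times> real. indicator \<Omega> (fst z) * (indicator {0..Y} (snd z) * snd z powr r))"
    using assms(1) by (intro integrable_lebesgue_on_of_lborel) (auto simp: open_Times)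
  then show ?thesis
    by (rule Bochner_Integration.integrable_cong[THEN iffD1, rotated 2]) (auto simp: indicator_def)
qed

section \<open>The energy form of the extension problem\<close>

lemma norm_matrix_vector_le:
  fixes A :: "real^'n^'n"
  shows "norm (A *v x) \<le> (real CARD('n) * norm A) * norm x"
proof -
  have "norm (A *v x) \<le> (\<Sum>i\<in>UNIV. \<bar>(A *v x) $ i\<bar>)" by (rule norm_le_l1_cart)
  also have "\<dots> \<le> (\<Sum>i\<in>(UNIV::'n set). norm A * norm x)"
  proof (rule sum_mono)
    fix i :: 'n
    have "\<bar>(A *v x) $ i\<bar> \<le> norm (A $ i) * norm x"
      by (simp add: matrix_vector_mul_component Cauchy_Schwarz_ineq2)
    also have "\<dots> \<le> norm A * norm x" by (intro mult_right_mono Finite_Cartesian_Product.norm_nth_le) auto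
    finally show "\<bar>(A *v x) $ i\<bar> \<le> norm A * norm x" .
  qed
  finally show ?thesis by simp
qed

lemma continuous_on_matrix_vector:
  "continuous_on UNIV (\<lambda>p. (fst p :: real^'n^'n) *v (snd p))"
  unfolding matrix_vector_mult_def
  by (intro continuous_on_vec_lambda continuous_intros continuous_on_component)

text \<open>The action of the block matrix diag(A, 1), constant in the extended variable.\<close>

definition A_ext :: "(real^'n \<Rightarrow> real^'n^'n) \<Rightarrow> (real^'n) \<times> real \<Rightarrow> (real^'n) \<times> real \<Rightarrow> (real^'n) \<times> real" where
  "A_ext A z p = (A (fst z) *v fst p, snd p)"

lemma weighted_domain_one: "open U \<Longrightarrow> weighted_domain (\<lambda>_. 1) U"
  by unfold_locales auto

lemma elliptic_form_id:
  assumes "weighted_domain \<rho> U"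
  shows "elliptic_form \<rho> U (\<lambda>_ p. p) (\<lambda>_. 1) 1 1"
proof -
  interpret weighted_domain \<rho> U by fact
  show ?thesis by unfold_locales (auto simp: inner_commute linear_id[unfolded id_def])
qed

lemma H1w_norm_grad_form:
  assumes "weighted_domain \<rho> U" "w \<in> H1w \<rho> U"
  shows "H1w_norm \<rho> U w = sqrt (grad_form \<rho> U (\<lambda>_ p. p) (\<lambda>_. 1) w w)"
proof -
  interpret weighted_domain \<rho> U by fact
  have "w \<in> L2w \<rho> U" "weak_gradient U w \<in> L2w \<rho> U" using assms by (auto simp: H1w_def)
  then have i: "integrable (lebesgue_on U) (\<lambda>x. \<rho> x * (w x)\<^sup>2)"
     "integrable (lebesgue_on U) (\<lambda>x. \<rho> x * (norm (weak_gradient U w x))\<^sup>2)" by (auto simp: L2w_def)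
  have "grad_form \<rho> U (\<lambda>_ p. p) (\<lambda>_. 1) w w = (LINT x|lebesgue_on U. \<rho> x * (w x)\<^sup>2 + \<rho> x * (norm (weak_gradient U w x))\<^sup>2)"
    unfolding grad_form_def by (simp add: power2_norm_eq_inner power2_eq_square[of "w _"] algebra_simps)
  then show ?thesis unfolding H1w_norm_def using i by (simp add: Bochner_Integration.integral_add)
qed

lemma (in weighted_domain) semi_inner_L2w:
  "semi_inner (L2w \<rho> U) (\<lambda>f g. LINT x|lebesgue_on U. \<rho> x * (f x * g x))"
proof
  have int: "integrable (lebesgue_on U) (\<lambda>x. \<rho> x * (f x * g x))"
    if "f \<in> L2w \<rho> U" "g \<in> L2w \<rho> U" for f g :: "'a \<Rightarrow> real"
    using L2w_inner_integrable[OF that] by simp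
  show "(\<lambda>_. 0) \<in> L2w \<rho> U" by (auto simp: L2w_def)
  fix u v w :: "'a \<Rightarrow> real" and a b :: real
  show "(\<lambda>x. a * u x + b * v x) \<in> L2w \<rho> U" if "u \<in> L2w \<rho> U" "v \<in> L2w \<rho> U"
    using L2w_lincomb[OF that, of a b] by simp
  show "(LINT x|lebesgue_on U. \<rho> x * ((a * u x + b * v x) * w x))
      = a * (LINT x|lebesgue_on U. \<rho> x * (u x * w x)) + b * (LINT x|lebesgue_on U. \<rho> x * (v x * w x))"
    if "u \<in> L2w \<rho> U" "v \<in> L2w \<rho> U" "w \<in> L2w \<rho> U"
    using LINT_lincomb[OF int[OF that(1,3)] int[OF that(2,3)], of a b] by (simp add: algebra_simps)
  show "(LINT x|lebesgue_on U. \<rho> x * (u x * v x)) = (LINT x|lebesgue_on U. \<rho> x * (v x * u x))"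
    by (simp add: mult.commute)
  show "0 \<le> (LINT x|lebesgue_on U. \<rho> x * (u x * u x))" by (simp add: weight_nonneg)
qed

lemma semi_inner_L2:
  assumes "open U"
  shows "semi_inner (L2 U) (L2_inner U)"
proof -
  interpret weighted_domain "\<lambda>_. 1" U by (rule weighted_domain_one[OF assms])
  have "L2_inner U = (\<lambda>f g. LINT x|lebesgue_on U. 1 * (f x * g x))" by (simp add: L2_inner_def fun_eq_iff)
  then show ?thesis using semi_inner_L2w by (simp add: L2_def)
qed

lemma L2_inner_cong_AE:
  assumes "U \<in> sets lebesgue" "f' \<in> borel_measurable (lebesgue_on U)" "g' \<in> borel_measurable (lebesgue_on U)"
    "AE x in lebesgue_on U. f x = f' x" "AE x in lebesgue_on U. g x = g' x"
  shows "L2_inner U f g = L2_inner U f' g'"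
proof -
  have "f \<in> borel_measurable (lebesgue_on U)" "g \<in> borel_measurable (lebesgue_on U)"
    using borel_measurable_lebesgue_on_AE assms by blast+
  moreover have "AE x in lebesgue_on U. f x * g x = f' x * g' x"
    using assms(4,5) by eventually_elim simp
  ultimately show ?thesis
    unfolding L2_inner_def using assms(2,3) by (intro integral_cong_AE) auto
qed

locale extension_problem =
  fixes \<Omega> :: "(real^'n) set" and A :: "real^'n \<Rightarrow> real^'n^'n" and c :: "real^'n \<Rightarrow> real"
    and s Y :: real
  assumes polytope: "open_convex_polytope \<Omega>"
    and admissible: "admissible_coefficients \<Omega> A c"
    and s_range: "0 < s" "s < 1"
    and Y_pos: "0 < Y"
begin

abbreviation C where "C \<equiv> cyl \<Omega> Y"
abbreviation \<rho> :: "(real^'n) \<times> real \<Rightarrow> real" where "\<rho> \<equiv> y_weight s"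

lemma Omega: "open \<Omega>" "\<Omega> \<noteq> {}" "bounded \<Omega>" "convex \<Omega>" "\<Omega> \<in> sets lebesgue"
  using polytope by (auto simp: open_convex_polytope_def)

lemma C_eq: "C = \<Omega> \<times> {0<..<Y}" by (simp add: cyl_def)

lemma open_C: "open C" using Omega by (simp add: cyl_def open_Times)

lemma bounded_C: "bounded C" using Omega by (simp add: cyl_def bounded_Times)

sublocale weighted_domain \<rho> C
proof
  show "open C" by (rule open_C)
  have "(\<lambda>z::(real^'n) \<times> real. snd z powr (1 - 2 * s)) \<in> borel_measurable borel"
    by (intro powr_real_measurable borel_measurable_continuous_onI[OF continuous_on_snd[OF continuous_on_id]]) simp
  then show "\<rho> \<in> borel_measurable (lebesgue_on C)"
    unfolding y_weight_def[abs_def] by (rule borel_measurable_lebesgue_on_borel)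
  show "0 \<le> \<rho> z" for z by (simp add: y_weight_def)
qed

lemma weight_integrable: "integrable (lebesgue_on C) \<rho>"
  unfolding y_weight_def[abs_def] C_eq
  using Omega s_range Y_pos by (intro integrable_snd_powr) auto

lemma d_s_pos: "0 < d_s s"
  using s_range by (simp add: d_s_def Gamma_real_pos)

lemma A_bounded: "\<exists>K. \<forall>x\<in>\<Omega>. norm (A x) \<le> K"
proof -
  obtain L where L: "L-lipschitz_on \<Omega> A" using admissible by (auto simp: admissible_coefficients_def)
  obtain x0 where x0: "x0 \<in> \<Omega>" using Omega by auto
  obtain R where R: "\<And>x. x \<in> \<Omega> \<Longrightarrow> norm x \<le> R" using Omega(3) by (auto simp: bounded_iff)
  show ?thesis
  proof (intro exI ballI)
    fix x assume x: "x \<in> \<Omega>"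
    have "norm (A x - A x0) \<le> L * norm (x - x0)"
      using lipschitz_onD[OF L x x0] by (simp add: dist_norm)
    also have "\<dots> \<le> L * (R + R)"
      using R[OF x] R[OF x0] norm_triangle_ineq4[of x x0] lipschitz_on_nonneg[OF L]
      by (intro mult_left_mono) auto
    finally show "norm (A x) \<le> L * (R + R) + norm (A x0)"
      using norm_triangle_sub[of "A x" "A x0"] by simp
  qed
qed

lemma elliptic_form_A_ext: "\<exists>K b. elliptic_form \<rho> C (A_ext A) (\<lambda>z. c (fst z)) K b"
proof -
  obtain K0 where K0: "\<And>x. x \<in> \<Omega> \<Longrightarrow> norm (A x) \<le> K0" using A_bounded by blast
  obtain b where b: "AE x in lebesgue_on \<Omega>. 0 \<le> c x \<and> c x \<le> b"
    using admissible by (auto simp: admissible_coefficients_def)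
  obtain a where a: "a > 0" "\<And>x \<xi>. x \<in> \<Omega> \<Longrightarrow> (A x *v \<xi>) \<bullet> \<xi> \<ge> a * (norm \<xi>)\<^sup>2"
    using admissible by (auto simp: admissible_coefficients_def)
  obtain L where L: "L-lipschitz_on \<Omega> A" using admissible by (auto simp: admissible_coefficients_def)
  have fO: "fst z \<in> \<Omega>" if "z \<in> C" for z using that by (auto simp: cyl_def)
  \<comment> \<open>The first summand bounds the matrix block, estimated coordinate by coordinate;
    the 1 accounts for the identity in the extended variable.\<close>
  let ?K = "real CARD('n) * K0 + 1"
  have "elliptic_form \<rho> C (A_ext A) (\<lambda>z. c (fst z)) ?K b"
  proof (intro elliptic_form.intro elliptic_form_axioms.intro weighted_domain_axioms)
    fix z p q :: "(real^'n) \<times> real"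
    assume z: "z \<in> C"
    show "linear (A_ext A z)"
      unfolding A_ext_def
      by (rule linearI) (auto simp: matrix_vector_right_distrib matrix_vector_mult_scaleR)
    have "transpose (A (fst z)) = A (fst z)"
      using admissible fO[OF z] by (auto simp: admissible_coefficients_def)
    then have "(A (fst z) *v fst p) \<bullet> fst q = (A (fst z) *v fst q) \<bullet> fst p"
      by (metis dot_lmul_matrix inner_commute transpose_matrix_vector)
    then show "A_ext A z p \<bullet> q = A_ext A z q \<bullet> p"
      by (simp add: A_ext_def inner_prod_def mult.commute)
    have "0 \<le> a * (norm (fst p))\<^sup>2" using a(1) by simp
    also have "\<dots> \<le> (A (fst z) *v fst p) \<bullet> fst p" using a(2) fO[OF z] by simp
    finally show "0 \<le> A_ext A z p \<bullet> p" by (simp add: A_ext_def inner_prod_def)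
    have "norm (A_ext A z p) \<le> norm (A (fst z) *v fst p) + norm (snd p)"
      unfolding A_ext_def norm_Pair using sqrt_sum_squares_le_sum[of "norm (A (fst z) *v fst p)" "norm (snd p)"] by simp
    also have "norm (A (fst z) *v fst p) \<le> (real CARD('n) * norm (A (fst z))) * norm (fst p)"
      by (rule norm_matrix_vector_le)
    also have "\<dots> \<le> (real CARD('n) * K0) * norm p"
      using K0[OF fO[OF z]] norm_fst_le[of "fst p" "snd p"] order_trans[OF norm_ge_zero K0[OF fO[OF z]]]
      by (intro mult_mono) auto
    also have "norm (snd p) \<le> 1 * norm p" using norm_snd_le[of "snd p" "fst p"] by simp
    finally show "norm (A_ext A z p) \<le> ?K * norm p" by (simp add: distrib_right)
  next
    fix g :: "(real^'n) \<times> real \<Rightarrow> (real^'n) \<times> real"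
    assume g: "g \<in> borel_measurable (lebesgue_on C)"
    have g1: "(\<lambda>z. fst (g z)) \<in> borel_measurable (lebesgue_on C)" "(\<lambda>z. snd (g z)) \<in> borel_measurable (lebesgue_on C)"
      by (rule measurable_compose[OF g borel_measurable_continuous_onI[OF continuous_on_fst[OF continuous_on_id]]],
          rule measurable_compose[OF g borel_measurable_continuous_onI[OF continuous_on_snd[OF continuous_on_id]]])
    have "continuous_on C (\<lambda>z. A (fst z))"
      by (rule continuous_on_compose2[OF lipschitz_on_continuous_on[OF L] continuous_on_fst[OF continuous_on_id]])
        (use fO in auto)
    then have "(\<lambda>z. A (fst z)) \<in> borel_measurable (lebesgue_on C)"
      by (rule continuous_imp_measurable_on_sets_lebesgue) (use open_C in auto)
    then have "(\<lambda>z. A (fst z) *v fst (g z)) \<in> borel_measurable (lebesgue_on C)"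
      using g1 by (intro borel_measurable_continuous_Pair[OF _ _ continuous_on_matrix_vector])
    then show "(\<lambda>z. A_ext A z (g z)) \<in> borel_measurable (lebesgue_on C)"
      unfolding A_ext_def using g1 by (intro borel_measurable_Pair)
  next
    show "(\<lambda>z. c (fst z)) \<in> borel_measurable (lebesgue_on C)"
      unfolding C_eq using admissible Omega
      by (intro borel_measurable_lebesgue_on_fst) (auto simp: admissible_coefficients_def)
    have "AE x in lebesgue. x \<in> \<Omega> \<longrightarrow> 0 \<le> c x \<and> c x \<le> b"
      by (rule AE_restrict_space_iff[THEN iffD1, OF _ b]) (use Omega in simp)
    from AE_lebesgue_fst[OF this] show "AE z in lebesgue_on C. 0 \<le> c (fst z) \<and> c (fst z) \<le> b"
      using open_C by (subst AE_restrict_space_iff) (auto elim!: eventually_mono intro: fO)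
  qed
  then show ?thesis by blast
qed

abbreviation a where "a \<equiv> a_form \<Omega> A c s Y"

lemma a_form_grad_form: "a u v = 1 / d_s s * grad_form \<rho> C (A_ext A) (\<lambda>z. c (fst z)) u v"
  by (simp add: a_form_def grad_form_def A_ext_def Let_def)

lemma semi_inner_a: "semi_inner (H1w \<rho> C) a"
proof -
  obtain K b where "elliptic_form \<rho> C (A_ext A) (\<lambda>z. c (fst z)) K b" using elliptic_form_A_ext by blast
  then interpret e: elliptic_form \<rho> C "A_ext A" "\<lambda>z. c (fst z)" K b .
  have "semi_inner (H1w \<rho> C) (\<lambda>u v. 1 / d_s s * grad_form \<rho> C (A_ext A) (\<lambda>z. c (fst z)) u v)"
    by (rule semi_inner_scale[OF e.semi_inner_axioms]) (use d_s_pos in simp)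
  moreover have "a = (\<lambda>u v. 1 / d_s s * grad_form \<rho> C (A_ext A) (\<lambda>z. c (fst z)) u v)"
    by (intro ext) (rule a_form_grad_form)
  ultimately show ?thesis by simp
qed

end

section \<open>Lipschitz functions in weighted Sobolev spaces\<close>

lemma has_weak_gradient_cong:
  assumes "\<And>x. x \<in> U \<Longrightarrow> w x = w' x"
  shows "has_weak_gradient U w = has_weak_gradient U w'"
proof
  fix g
  have "integrable (lebesgue_on S) w \<longleftrightarrow> integrable (lebesgue_on S) w'" if "S \<subseteq> U" for S
    using that assms by (intro Bochner_Integration.integrable_cong) auto
  then have 1: "locally_integrable U w \<longleftrightarrow> locally_integrable U w'"
    by (auto simp: locally_integrable_def)
  have 2: "(LINT x|lebesgue_on U. w x *\<^sub>R \<psi>' x) = (LINT x|lebesgue_on U. w' x *\<^sub>R \<psi>' x)" for \<psi>'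
    using assms by (intro Bochner_Integration.integral_cong) auto
  show "has_weak_gradient U w g = has_weak_gradient U w' g"
    unfolding has_weak_gradient_def 1 2 ..
qed

lemma H1w_cong:
  assumes "\<And>x. x \<in> U \<Longrightarrow> w x = w' x" "w \<in> H1w \<rho> U"
  shows "w' \<in> H1w \<rho> U"
proof -
  have wg: "has_weak_gradient U w' = has_weak_gradient U w"
    by (rule has_weak_gradient_cong[symmetric]) (rule assms)
  have "w \<in> borel_measurable (lebesgue_on U) \<longleftrightarrow> w' \<in> borel_measurable (lebesgue_on U)"
    using assms(1) by (intro measurable_cong) auto
  moreover have "integrable (lebesgue_on U) (\<lambda>x. \<rho> x * (norm (w x))\<^sup>2) \<longleftrightarrow>
      integrable (lebesgue_on U) (\<lambda>x. \<rho> x * (norm (w' x))\<^sup>2)"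
    using assms(1) by (intro Bochner_Integration.integrable_cong) auto
  ultimately show ?thesis
    using assms(2) by (simp add: H1w_def L2w_def weak_gradient_def wg)
qed

text \<open>The candidate gradient is the coordinatewise limit of difference quotients, hence
  measurable by construction. The Lipschitz constant bounds it, and the function is bounded on the
  bounded domain, so integrability of the weight puts both in the weighted L2 space.\<close>

lemma (in weighted_domain) H1w_lipschitz:
  assumes "bounded U" "integrable (lebesgue_on U) \<rho>" "L-lipschitz_on UNIV w"
    and conv: "\<And>b. b \<in> Basis \<Longrightarrow> AE x in lebesgue_on U.
      convergent (\<lambda>n. real (Suc n) * (w (x + (1 / real (Suc n)) *\<^sub>R b) - w x))"
  shows "w \<in> H1w \<rho> U"
proof -
  define q where "q b n x = real (Suc n) * (w (x + (1 / real (Suc n)) *\<^sub>R b) - w x)" for b n x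
  define g where "g x = (\<Sum>b\<in>Basis. lim (\<lambda>n. q b n x) *\<^sub>R b)" for x
  have wc: "continuous_on UNIV w" using assms(3) by (rule lipschitz_on_continuous_on)
  have wm: "w \<in> borel_measurable (lebesgue_on U)"
    using wc by (intro borel_measurable_lebesgue_on_borel borel_measurable_continuous_onI)
  have qm: "q b n \<in> borel_measurable (lebesgue_on U)" for b n
    unfolding q_def[abs_def]
    by (intro borel_measurable_lebesgue_on_borel borel_measurable_continuous_onI continuous_on_mult
        continuous_on_const continuous_on_diff wc continuous_on_compose2[OF wc] continuous_on_add continuous_on_id) simp
  have gm: "g \<in> borel_measurable (lebesgue_on U)"
    unfolding g_def[abs_def] using qm
    by (intro borel_measurable_sum borel_measurable_scaleR borel_measurable_const borel_measurable_lim_metric)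
  have lim: "AE x in lebesgue_on U. (\<lambda>n. real (Suc n) * (w (x + (1 / real (Suc n)) *\<^sub>R b) - w x)) \<longlonglongrightarrow> g x \<bullet> b"
    if b: "b \<in> Basis" for b
    using conv[OF b]
  proof eventually_elim
    case (elim x)
    have "g x \<bullet> b = lim (\<lambda>n. q b n x)"
      unfolding g_def using b by (simp add: inner_sum_left_Basis)
    then show ?case using elim by (simp add: q_def convergent_LIMSEQ_iff)
  qed
  have one: "(\<lambda>_. 1::real) \<in> L2w \<rho> U" using assms(2) by (simp add: L2w_def)
  note wg = has_weak_gradient_lipschitz[OF open_U assms(3) gm lim]
  have "bounded (w ` closure U)"
    using assms(1) wc by (intro compact_imp_bounded compact_continuous_image)
      (auto intro: continuous_on_subset simp: compact_closure)
  then obtain B where B: "\<And>x. x \<in> closure U \<Longrightarrow> \<bar>w x\<bar> \<le> B" by (auto simp: bounded_iff)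
  show ?thesis
  proof (rule H1wI[OF _ wg(1)])
    show "w \<in> L2w \<rho> U"
      by (rule L2w_bound[OF one wm, where K=B]) (use B closure_subset[of U] in \<open>auto intro!: AE_I2\<close>)
    show "g \<in> L2w \<rho> U"
      by (rule L2w_bound[OF one gm, where K="L * DIM('a)"]) (use wg(2) in simp)
  qed
qed

section \<open>The discrete space\<close>

text \<open>The segment between two points stays in the convex set and is cut by the closed cells
  into finitely many closed pieces with bounded slope. Gluing along this one-dimensional closed
  cover gives the estimate; the sum of the slopes stands in for their maximum.\<close>

lemma piecewise_affine_lipschitz:
  fixes v :: "'a::euclidean_space \<Rightarrow> real"
  assumes "convex D" "finite \<T>" "\<And>T. T \<in> \<T> \<Longrightarrow> closed T" "D \<subseteq> \<Union>\<T>"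
    "\<And>T. T \<in> \<T> \<Longrightarrow> \<exists>a b. \<forall>x\<in>T. v x = a \<bullet> x + b"
  obtains L where "L-lipschitz_on D v"
proof -
  obtain \<alpha> \<beta> where ab: "\<And>T x. T \<in> \<T> \<Longrightarrow> x \<in> T \<Longrightarrow> v x = \<alpha> T \<bullet> x + \<beta> T"
    using assms(5) by metis
  define L where "L = (\<Sum>T\<in>\<T>. norm (\<alpha> T))"
  have L: "norm (\<alpha> T) \<le> L" if "T \<in> \<T>" for T
    unfolding L_def using that assms(2) by (intro member_le_sum) auto
  have L0: "L \<ge> 0" unfolding L_def by (intro sum_nonneg) auto
  have "L-lipschitz_on D v"
  proof (rule lipschitz_onI[OF _ L0])
    fix x y assume xy: "x \<in> D" "y \<in> D"
    define \<gamma> where "\<gamma> t = x + t *\<^sub>R (y - x)" for t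
    have \<gamma>D: "\<gamma> t \<in> D" if "t \<in> {0..1}" for t
      using convexD_alt[OF assms(1) xy, of t] that by (simp add: \<gamma>_def algebra_simps)
    have "(L * norm (y - x))-lipschitz_on {0..1} (\<lambda>t. v (\<gamma> t))"
    proof (rule lipschitz_on_closed_Union[where I=\<T> and U="\<lambda>T. {0..1} \<inter> \<gamma> -` T"])
      show "(L * norm (y - x))-lipschitz_on ({0..1} \<inter> \<gamma> -` T) (\<lambda>t. v (\<gamma> t))" if "T \<in> \<T>" for T
      proof (rule lipschitz_onI)
        fix t u assume "t \<in> {0..1} \<inter> \<gamma> -` T" "u \<in> {0..1} \<inter> \<gamma> -` T"
        then have "v (\<gamma> t) - v (\<gamma> u) = \<alpha> T \<bullet> (\<gamma> t - \<gamma> u)"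
          using ab[OF that] by (simp add: inner_diff_right)
        also have "\<gamma> t - \<gamma> u = (t - u) *\<^sub>R (y - x)" by (simp add: \<gamma>_def algebra_simps)
        finally have "\<bar>v (\<gamma> t) - v (\<gamma> u)\<bar> = \<bar>t - u\<bar> * \<bar>\<alpha> T \<bullet> (y - x)\<bar>" by (simp add: abs_mult)
        also have "\<dots> \<le> \<bar>t - u\<bar> * (L * norm (y - x))"
          using order_trans[OF Cauchy_Schwarz_ineq2 mult_right_mono[OF L[OF that] norm_ge_zero]]
          by (intro mult_left_mono) auto
        finally show "dist (v (\<gamma> t)) (v (\<gamma> u)) \<le> L * norm (y - x) * dist t u"
          by (simp add: dist_real_def mult.commute)
      qed (use L0 in simp)
      show "closed ({0..1} \<inter> \<gamma> -` T)" if "T \<in> \<T>" for T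
        unfolding \<gamma>_def[abs_def] using assms(3)[OF that]
        by (intro continuous_closed_preimage) (auto intro!: continuous_intros)
      show "{0..1} \<subseteq> (\<Union>T\<in>\<T>. {0..1} \<inter> \<gamma> -` T)"
        using \<gamma>D assms(4) by fastforce
    qed (use assms(2) L0 in auto)
    from lipschitz_onD[OF this, of 1 0] show "dist (v x) (v y) \<le> L * dist x y"
      by (simp add: \<gamma>_def dist_norm norm_minus_commute dist_commute)
  qed
  then show ?thesis by (rule that)
qed

lemma poly_lipschitz:
  fixes q :: "real poly"
  obtains L where "L-lipschitz_on {a..b} (poly q)"
proof -
  have "bounded (poly (pderiv q) ` {a..b})"
    by (intro compact_imp_bounded compact_continuous_image) (auto intro: continuous_intros)
  then obtain B where "\<forall>y\<in>{a..b}. \<bar>poly (pderiv q) y\<bar> \<le> B" by (auto simp: bounded_iff)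
  then have B: "\<bar>poly (pderiv q) y\<bar> \<le> B" if "y \<in> {a..b}" for y using that by blast
  have "norm (poly q x - poly q y) \<le> max B 0 * norm (x - y)" if "x \<in> {a..b}" "y \<in> {a..b}" for x y
  proof (rule field_differentiable_bound[of "{a..b}"])
    show "norm (poly (pderiv q) z) \<le> max B 0" if "z \<in> {a..b}" for z using B[OF that] by simp
  qed (use that in \<open>auto intro: has_field_derivative_at_within poly_DERIV\<close>)
  then have "(max B 0)-lipschitz_on {a..b} (poly q)"
    by (intro lipschitz_onI) (auto simp: dist_norm)
  then show ?thesis by (rule that)
qed

lemma lipschitz_on_tensor_product:
  fixes v :: "'a::metric_space \<Rightarrow> real" and p :: "'b::metric_space \<Rightarrow> real"
  assumes "Lv-lipschitz_on D v" "Lp-lipschitz_on E p"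
    "\<And>x. x \<in> D \<Longrightarrow> \<bar>v x\<bar> \<le> Bv" "\<And>y. y \<in> E \<Longrightarrow> \<bar>p y\<bar> \<le> Bp" "0 \<le> Bv" "0 \<le> Bp"
  shows "(Lv * Bp + Bv * Lp)-lipschitz_on (D \<times> E) (\<lambda>z. v (fst z) * p (snd z))"
proof (rule lipschitz_onI)
  have L: "Lv \<ge> 0" "Lp \<ge> 0" using assms lipschitz_on_nonneg by blast+
  then show "0 \<le> Lv * Bp + Bv * Lp" using assms by simp
  fix z z' assume z: "z \<in> D \<times> E" "z' \<in> D \<times> E"
  have "v (fst z) * p (snd z) - v (fst z') * p (snd z')
      = (v (fst z) - v (fst z')) * p (snd z) + v (fst z') * (p (snd z) - p (snd z'))"
    by (simp add: algebra_simps)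
  then have "\<bar>v (fst z) * p (snd z) - v (fst z') * p (snd z')\<bar>
      \<le> \<bar>v (fst z) - v (fst z')\<bar> * \<bar>p (snd z)\<bar> + \<bar>v (fst z')\<bar> * \<bar>p (snd z) - p (snd z')\<bar>"
    by (metis abs_mult abs_triangle_ineq)
  also have "\<dots> \<le> (Lv * dist (fst z) (fst z')) * Bp + Bv * (Lp * dist (snd z) (snd z'))"
    using z assms lipschitz_onD[OF assms(1), of "fst z" "fst z'"] lipschitz_onD[OF assms(2), of "snd z" "snd z'"] L
    by (intro add_mono mult_mono) (auto simp: dist_real_def)
  also have "\<dots> \<le> (Lv * dist z z') * Bp + Bv * (Lp * dist z z')"
    using L assms by (intro add_mono mult_mono mult_left_mono dist_fst_le dist_snd_le) auto
  finally show "dist (v (fst z) * p (snd z)) (v (fst z') * p (snd z')) \<le> (Lv * Bp + Bv * Lp) * dist z z'"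
    by (simp add: dist_real_def algebra_simps)
qed

lemma lipschitz_on_finite_sum:
  assumes "\<And>i. i < (N::nat) \<Longrightarrow> \<exists>L. L-lipschitz_on D (f i :: _ \<Rightarrow> real)"
  shows "\<exists>L. L-lipschitz_on D (\<lambda>z. \<Sum>i<N. f i z)"
  using assms
proof (induction N)
  case 0
  then show ?case by (auto intro!: exI[of _ 0] lipschitz_on_constant)
next
  case (Suc N)
  then obtain L L' where "L-lipschitz_on D (\<lambda>z. \<Sum>i<N. f i z)" "L'-lipschitz_on D (f N)"
    using less_Suc_eq by blast
  from lipschitz_on_add[OF this] show ?case by auto
qed

section \<open>The geometric partition in the extended variable\<close>

lemma geo_interval_cover:
  assumes "0 < Y" "0 < \<sigma>" "\<sigma> < 1" "1 \<le> M" "y \<in> {0..Y}"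
  obtains m where "m \<in> {1..M}" "y \<in> geo_interval Y \<sigma> M m"
proof -
  \<comment> \<open>The right end points increase with m and reach Y at m = M. The least m whose end
    point is not below y works: minimality excludes m - 1, whose right end point is the left end
    point of the interval with index m, and m = 1 starts at 0.\<close>
  define P where "P m \<longleftrightarrow> 1 \<le> m \<and> y \<le> Y * \<sigma> ^ (M - m)" for m
  define m where "m = Least P"
  have ex: "P M" using assms by (simp add: P_def)
  then have "P m" "m \<le> M" unfolding m_def by (rule LeastI, rule Least_le)
  then have m: "1 \<le> m" "y \<le> Y * \<sigma> ^ (M - m)" "m \<le> M" by (auto simp: P_def)
  have "y \<in> geo_interval Y \<sigma> M m"
  proof (cases "m = 1")
    case True
    then show ?thesis using m assms by (simp add: geo_interval_def)
  next
    case False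
    have "m - 1 < Least P" using m(1) by (simp flip: m_def)
    then have "\<not> (1 \<le> m - 1 \<and> y \<le> Y * \<sigma> ^ (M - (m - 1)))"
      using not_less_Least by (fastforce simp: P_def)
    moreover have "M - (m - 1) = M - m + 1" using m False by simp
    moreover have "1 \<le> m - 1" using m False by simp
    ultimately show ?thesis using m False by (simp add: geo_interval_def)
  qed
  then show ?thesis using that m by auto
qed

lemma geo_interval_subset:
  assumes "0 < Y" "0 < \<sigma>" "\<sigma> < 1"
  shows "geo_interval Y \<sigma> M m \<subseteq> {0..Y}"
proof -
  have "Y * \<sigma> ^ j \<le> Y" for j using assms by (simp add: mult_le_cancel_left1 power_le_one)
  moreover have "0 \<le> Y * \<sigma> ^ j" "0 \<le> Y * (\<sigma> * \<sigma> ^ j)" for j using assms by simp_all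
  ultimately show ?thesis unfolding geo_interval_def by (auto intro: order_trans)
qed

lemma Sr_lipschitz:
  assumes "0 < Y" "0 < \<sigma>" "\<sigma> < 1" "1 \<le> M" "p \<in> Sr Y \<sigma> M \<ss>"
  obtains L where "L-lipschitz_on {0..Y} p"
proof -
  have "\<exists>L. L-lipschitz_on (geo_interval Y \<sigma> M m) p" if m: "m \<in> {1..M}" for m
  proof -
    obtain q where q: "\<And>y. y \<in> geo_interval Y \<sigma> M m \<Longrightarrow> p y = poly q y"
      using assms(5) m unfolding Sr_def by blast
    obtain L where "L-lipschitz_on {0..Y} (poly q)" using poly_lipschitz by blast
    then have "L-lipschitz_on (geo_interval Y \<sigma> M m) (poly q)"
      using geo_interval_subset[OF assms(1-3)] lipschitz_on_subset by blast
    then have "L-lipschitz_on (geo_interval Y \<sigma> M m) p"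
      by (rule lipschitz_on_transform) (use q in auto)
    then show ?thesis ..
  qed
  then obtain L where L: "\<And>m. m \<in> {1..M} \<Longrightarrow> (L m)-lipschitz_on (geo_interval Y \<sigma> M m) p" by metis
  have L0: "0 \<le> L m" if "m \<in> {1..M}" for m using lipschitz_on_nonneg[OF L[OF that]] .
  have "(\<Sum>m=1..M. L m)-lipschitz_on {0..Y} p"
  proof (rule lipschitz_on_closed_Union[where I="{1..M}" and U="geo_interval Y \<sigma> M"])
    show "(\<Sum>m=1..M. L m)-lipschitz_on (geo_interval Y \<sigma> M m) p" if "m \<in> {1..M}" for m
      using that L0 by (intro lipschitz_on_mono[OF L[OF that]] member_le_sum) auto
    show "closed (geo_interval Y \<sigma> M m)" for m by (simp add: geo_interval_def)
    show "0 \<le> (\<Sum>m=1..M. L m)" by (intro sum_nonneg L0)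
    show "{0..Y} \<subseteq> (\<Union>m\<in>{1..M}. geo_interval Y \<sigma> M m)"
    proof
      fix y assume "y \<in> {0..Y}"
      then obtain m where "m \<in> {1..M}" "y \<in> geo_interval Y \<sigma> M m"
        using geo_interval_cover[OF assms(1-4)] by blast
      then show "y \<in> (\<Union>m\<in>{1..M}. geo_interval Y \<sigma> M m)" by blast
    qed
  qed simp
  then show ?thesis by (rule that)
qed

section \<open>Linear structure of the tensor product space\<close>

lemma sum_lessThan_add:
  fixes f :: "nat \<Rightarrow> real"
  shows "(\<Sum>i<m + n. f i) = (\<Sum>i<m. f i) + (\<Sum>i<n. f (m + i))"
  by (induction n) (auto simp: algebra_simps)

lemma S10_scale:
  assumes "v \<in> S10 \<Omega> \<T>"
  shows "(\<lambda>x. a * v x) \<in> S10 \<Omega> \<T>"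
proof -
  have "\<exists>a' b'. \<forall>x\<in>T. a * v x = a' \<bullet> x + b'" if T: "T \<in> \<T>" for T
  proof -
    obtain a' b' where "\<forall>x\<in>T. v x = a' \<bullet> x + b'" using assms T unfolding S10_def by blast
    then have "\<forall>x\<in>T. a * v x = (a *\<^sub>R a') \<bullet> x + a * b'" by (simp add: algebra_simps)
    then show ?thesis by blast
  qed
  then show ?thesis using assms by (auto simp: S10_def intro!: continuous_intros)
qed

text \<open>Names the data behind membership in \<open>V_space\<close>. A member is prescribed on
  the closed cylinder only, so its values elsewhere must never enter an argument.\<close>

definition tensor_rep where
  "tensor_rep \<Omega> \<T> Y \<sigma> M \<ss> W N v p \<longleftrightarrow> (\<forall>i<N::nat. v i \<in> S10 \<Omega> \<T> \<and> p i \<in> Sr Y \<sigma> M \<ss>) \<and>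
     (\<forall>x\<in>closure \<Omega>. \<forall>y\<in>{0..Y}. W (x, y) = (\<Sum>i<N. v i x * p i y))"

lemma V_space_iff: "W \<in> V_space \<Omega> \<T> Y \<sigma> M \<ss> \<longleftrightarrow> (\<exists>N v p. tensor_rep \<Omega> \<T> Y \<sigma> M \<ss> W N v p)"
  by (simp add: V_space_def tensor_rep_def)

lemma tensor_repD:
  assumes "tensor_rep \<Omega> \<T> Y \<sigma> M \<ss> W N v p"
  shows "i < N \<Longrightarrow> v i \<in> S10 \<Omega> \<T>" "i < N \<Longrightarrow> p i \<in> Sr Y \<sigma> M \<ss>"
    "x \<in> closure \<Omega> \<Longrightarrow> y \<in> {0..Y} \<Longrightarrow> W (x, y) = (\<Sum>i<N. v i x * p i y)"
  using assms by (auto simp: tensor_rep_def)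

lemma V_space_lincomb:
  assumes "u \<in> V_space \<Omega> \<T> Y \<sigma> M \<ss>" "w \<in> V_space \<Omega> \<T> Y \<sigma> M \<ss>"
  shows "(\<lambda>z. a * u z + b * w z) \<in> V_space \<Omega> \<T> Y \<sigma> M \<ss>"
proof -
  obtain N v p where "tensor_rep \<Omega> \<T> Y \<sigma> M \<ss> u N v p" using assms(1) unfolding V_space_iff by blast
  note 1 = tensor_repD[OF this]
  obtain N' v' p' where "tensor_rep \<Omega> \<T> Y \<sigma> M \<ss> w N' v' p'" using assms(2) unfolding V_space_iff by blast
  note 2 = tensor_repD[OF this]
  define v'' where "v'' i = (if i < N then (\<lambda>x. a * v i x) else (\<lambda>x. b * v' (i - N) x))" for i
  define p'' where "p'' i = (if i < N then p i else p' (i - N))" for i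
  show ?thesis
    unfolding V_space_iff tensor_rep_def
  proof (intro exI conjI allI ballI impI)
    fix i assume "i < N + N'"
    then show "v'' i \<in> S10 \<Omega> \<T>" "p'' i \<in> Sr Y \<sigma> M \<ss>"
      using 1(1,2)[of i] 2(1,2)[of "i - N"] by (auto simp: v''_def p''_def intro!: S10_scale)
  next
    fix x y assume xy: "x \<in> closure \<Omega>" "y \<in> {0..Y}"
    show "a * u (x, y) + b * w (x, y) = (\<Sum>i<N + N'. v'' i x * p'' i y)"
      unfolding sum_lessThan_add 1(3)[OF xy] 2(3)[OF xy]
      by (simp add: v''_def p''_def sum_distrib_left mult.assoc)
  qed
qed

lemma V_space_zero: "(\<lambda>_. 0) \<in> V_space \<Omega> \<T> Y \<sigma> M \<ss>"
  unfolding V_space_def by (intro CollectI exI[of _ 0]) auto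

context extension_problem
begin

lemma closure_C: "closure C = closure \<Omega> \<times> {0..Y}"
  using Y_pos by (simp add: cyl_def closure_Times)

lemma compact_closure_Omega: "compact (closure \<Omega>)" using Omega by (simp add: compact_closure)

text \<open>Lets a continuous member serve as its own approximating sequence. The gradient of the
  zero function is a chosen one too, so its norm is seen to vanish by homogeneity.\<close>

lemma H1w_tendsto_const: "H1w_tendsto \<rho> C (\<lambda>_. W) W"
proof -
  interpret e: elliptic_form \<rho> C "\<lambda>_ p. p" "\<lambda>_. 1" 1 1
    by (rule elliptic_form_id) (rule weighted_domain_axioms)
  have "H1w_norm \<rho> C (\<lambda>_. 0) = 0"
    using e.N_scale[OF H1w_zero, of 0] by (simp add: H1w_norm_grad_form[OF weighted_domain_axioms H1w_zero] e.N_def)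
  then show ?thesis by (simp add: H1w_tendsto_def)
qed

lemma continuous_on_closure_L2:
  assumes "continuous_on (closure \<Omega>) f"
  shows "f \<in> L2 \<Omega>"
proof -
  interpret o: weighted_domain "\<lambda>_. 1" \<Omega> by (rule weighted_domain_one[OF Omega(1)])
  have "bounded (f ` closure \<Omega>)"
    using assms compact_closure_Omega by (intro compact_imp_bounded compact_continuous_image)
  then obtain B where B: "\<forall>x\<in>closure \<Omega>. \<bar>f x\<bar> \<le> B" by (auto simp: bounded_iff)
  have one: "(\<lambda>_. 1::real) \<in> L2w (\<lambda>_. 1) \<Omega>"
    using Omega by (auto simp: L2w_def intro!: integrable_const_lebesgue_on bounded_set_imp_lmeasurable)
  have "f \<in> L2w (\<lambda>_. 1) \<Omega>"
  proof (rule o.L2w_bound[OF one, where K=B])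
    show "f \<in> borel_measurable (lebesgue_on \<Omega>)"
      using continuous_on_subset[OF assms closure_subset] Omega(5)
      by (rule continuous_imp_measurable_on_sets_lebesgue)
  qed (use B closure_subset[of \<Omega>] in \<open>auto intro!: AE_I2\<close>)
  then show ?thesis by (simp add: L2_def)
qed

end

locale discrete_problem = extension_problem \<Omega> A c s Y
  for \<Omega> :: "(real^'n) set" and A c s Y +
  fixes \<T> :: "(real^'n) set set" and \<sigma> :: real and M :: nat and \<ss> :: real
  assumes sigma: "0 < \<sigma>" "\<sigma> < 1" and M_pos: "1 \<le> M"
    and mesh: "simplicial_mesh \<Omega> \<T>"
begin

abbreviation \<V> where "\<V> \<equiv> V_space \<Omega> \<T> Y \<sigma> M \<ss>"

lemma mesh_facts: "finite \<T>" "T \<in> \<T> \<Longrightarrow> closed T" "T \<in> \<T> \<Longrightarrow> convex T" "\<Union>\<T> = closure \<Omega>"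
  "T \<in> \<T> \<Longrightarrow> \<exists>P. finite P \<and> T = convex hull P"
proof -
  show "finite \<T>" using mesh by (auto simp: simplicial_mesh_def triangulation_def)
  have simp: "int CARD('n) simplex T" if "T \<in> \<T>" for T using mesh that by (auto simp: simplicial_mesh_def)
  show "T \<in> \<T> \<Longrightarrow> closed T" using simp closed_simplex by blast
  show "T \<in> \<T> \<Longrightarrow> convex T" using simp convex_simplex by blast
  show "\<Union>\<T> = closure \<Omega>" using mesh by (auto simp: simplicial_mesh_def)
  show "T \<in> \<T> \<Longrightarrow> \<exists>P. finite P \<and> T = convex hull P" using simp[of T] unfolding simplex by blast
qed

lemma S10_lipschitz: "v \<in> S10 \<Omega> \<T> \<Longrightarrow> \<exists>L. L-lipschitz_on (closure \<Omega>) v"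
  by (rule piecewise_affine_lipschitz[of "closure \<Omega>" \<T> v])
    (use mesh_facts Omega(4) in \<open>auto simp: S10_def convex_closure\<close>)

lemma V_lipschitz:
  assumes "W \<in> \<V>"
  shows "\<exists>L. L-lipschitz_on (closure C) W"
proof -
  obtain N v p where rep: "tensor_rep \<Omega> \<T> Y \<sigma> M \<ss> W N v p" using assms unfolding V_space_iff by blast
  note v = tensor_repD(1)[OF rep] and p = tensor_repD(2)[OF rep] and W = tensor_repD(3)[OF rep]
  have "\<exists>L. L-lipschitz_on (closure \<Omega> \<times> {0..Y}) (\<lambda>z. v i (fst z) * p i (snd z))" if i: "i < N" for i
  proof -
    obtain Lv where Lv: "Lv-lipschitz_on (closure \<Omega>) (v i)" using S10_lipschitz[OF v[OF i]] ..
    obtain Lp where Lp: "Lp-lipschitz_on {0..Y} (p i)"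
      by (rule Sr_lipschitz[OF Y_pos sigma M_pos p[OF i]])
    have "bounded (v i ` closure \<Omega>)" "bounded (p i ` {0..Y})"
      using Lv Lp compact_closure_Omega
      by (auto intro!: compact_imp_bounded compact_continuous_image lipschitz_on_continuous_on)
    then obtain Bv Bp where B: "\<forall>x\<in>closure \<Omega>. \<bar>v i x\<bar> \<le> Bv" "\<forall>y\<in>{0..Y}. \<bar>p i y\<bar> \<le> Bp"
      unfolding bounded_iff by auto
    then have "0 \<le> Bv" "0 \<le> Bp" using Omega(2) closure_subset[of \<Omega>] Y_pos
      by (force intro: order_trans[OF abs_ge_zero])+
    with B have "(Lv * Bp + Bv * Lp)-lipschitz_on (closure \<Omega> \<times> {0..Y}) (\<lambda>z. v i (fst z) * p i (snd z))"
      by (intro lipschitz_on_tensor_product[OF Lv Lp]) auto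
    then show ?thesis ..
  qed
  from lipschitz_on_finite_sum[where f="\<lambda>i z. v i (fst z) * p i (snd z)", OF this] obtain L
    where "L-lipschitz_on (closure \<Omega> \<times> {0..Y}) (\<lambda>z. \<Sum>i<N. v i (fst z) * p i (snd z))" by blast
  then have "L-lipschitz_on (closure C) W"
    unfolding closure_C by (rule lipschitz_on_transform) (auto simp: W)
  then show ?thesis ..
qed

text \<open>Away from the frontiers of the simplices and the break points of the partition, W is
  locally a sum of affine functions times polynomials, and the exceptional sets are cylinders over
  null sets. The local model F and the neighbourhood G make the conclusion transferable to any
  extension of W beyond the cylinder.\<close>

lemma V_differentiable_AE:
  assumes "W \<in> \<V>"
  shows "AE z in lebesgue_on C. \<exists>D F. (F has_derivative D) (at z) \<and> (\<exists>G. open G \<and> z \<in> G \<and> G \<subseteq> C \<and> (\<forall>z'\<in>G. W z' = F z'))"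
proof -
  obtain N v p where rep: "tensor_rep \<Omega> \<T> Y \<sigma> M \<ss> W N v p" using assms unfolding V_space_iff by blast
  note v = tensor_repD(1)[OF rep] and p = tensor_repD(2)[OF rep] and W = tensor_repD(3)[OF rep]
  have "negligible (\<Union>T\<in>\<T>. frontier T)"
    using mesh_facts by (intro negligible_Union) (auto intro: negligible_convex_frontier)
  then have 1: "AE x in lebesgue. x \<notin> (\<Union>T\<in>\<T>. frontier T)"
    by (intro AE_not_in) (simp add: negligible_iff_null_sets)
  have "negligible (\<Union>m\<in>{1..M}. frontier (geo_interval Y \<sigma> M m))"
    by (intro negligible_Union) (auto intro!: negligible_convex_frontier simp: geo_interval_def)
  then have 2: "AE y in lebesgue. y \<notin> (\<Union>m\<in>{1..M}. frontier (geo_interval Y \<sigma> M m))"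
    by (intro AE_not_in) (simp add: negligible_iff_null_sets)
  have "AE z in (lebesgue :: ((real^'n) \<times> real) measure). z \<in> C \<longrightarrow>
    (\<exists>D F. (F has_derivative D) (at z) \<and> (\<exists>G. open G \<and> z \<in> G \<and> G \<subseteq> C \<and> (\<forall>z'\<in>G. W z' = F z')))"
    using AE_lebesgue_fst[OF 1, where 'b=real] AE_lebesgue_snd[OF 2, where 'a="real^'n"]
  proof eventually_elim
    case (elim z)
    show ?case
    proof
      assume z: "z \<in> C"
      then have zx: "fst z \<in> closure \<Omega>" "snd z \<in> {0..Y}" using closure_subset[of \<Omega>] by (auto simp: cyl_def)
      obtain T where T: "T \<in> \<T>" "fst z \<in> T" using zx(1) mesh_facts(4) by blast
      then have Ti: "fst z \<in> interior T"
        using elim(1) mesh_facts(2)[OF T(1)] by (auto simp: frontier_def)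
      obtain m where m: "m \<in> {1..M}" "snd z \<in> geo_interval Y \<sigma> M m"
        using geo_interval_cover[OF Y_pos sigma M_pos zx(2)] by blast
      have "closed (geo_interval Y \<sigma> M m)" by (simp add: geo_interval_def)
      then have mi: "snd z \<in> interior (geo_interval Y \<sigma> M m)"
        using elim(2) m by (auto simp: frontier_def)
      have "\<exists>\<alpha> \<beta>. \<forall>x\<in>T. v i x = \<alpha> \<bullet> x + \<beta>" if "i < N" for i
        using v[OF that] T(1) unfolding S10_def by blast
      then obtain \<alpha> \<beta> where ab: "\<And>i x. i < N \<Longrightarrow> x \<in> T \<Longrightarrow> v i x = \<alpha> i \<bullet> x + \<beta> i" by metis
      have "\<exists>q. \<forall>y\<in>geo_interval Y \<sigma> M m. p i y = poly q y" if "i < N" for i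
        using p[OF that] m(1) unfolding Sr_def by blast
      then obtain q where q: "\<And>i y. i < N \<Longrightarrow> y \<in> geo_interval Y \<sigma> M m \<Longrightarrow> p i y = poly (q i) y" by metis
      define F where "F = (\<lambda>z::(real^'n) \<times> real. \<Sum>i<N. (\<alpha> i \<bullet> fst z + \<beta> i) * poly (q i) (snd z))"
      have "((\<lambda>z::(real^'n) \<times> real. poly (q i) (snd z)) has_derivative (\<lambda>h. snd h * poly (pderiv (q i)) (snd z))) (at z)" for i
      proof -
        have "C1_gradient (\<lambda>z::(real^'n) \<times> real. poly (q i) (snd z)) (\<lambda>z. (0, poly (pderiv (q i)) (snd z)))"
          by (rule C1_gradient_snd) (auto intro: poly_DERIV continuous_intros)
        then show ?thesis by (cases z) (simp add: C1_gradient_def inner_prod_def mult.commute)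
      qed
      then have der: "(F has_derivative (\<lambda>h. \<Sum>i<N. (\<alpha> i \<bullet> fst z + \<beta> i) * (snd h * poly (pderiv (q i)) (snd z))
           + (\<alpha> i \<bullet> fst h) * poly (q i) (snd z))) (at z)"
        unfolding F_def by (auto intro!: derivative_eq_intros)
      define G where "G = (interior T \<times> interior (geo_interval Y \<sigma> M m)) \<inter> C"
      have G: "open G" "z \<in> G" "G \<subseteq> C"
        using z Ti mi open_C by (auto simp: G_def open_Times open_Int mem_Times_iff)
      have "W z' = F z'" if "z' \<in> G" for z'
      proof -
        obtain x y where z': "z' = (x, y)" by (cases z')
        have xy: "x \<in> T" "y \<in> geo_interval Y \<sigma> M m" "x \<in> closure \<Omega>" "y \<in> {0..Y}"
          using that interior_subset closure_subset[of \<Omega>] by (auto simp: G_def z' cyl_def)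
        show ?thesis unfolding z' W[OF xy(3,4)] F_def using ab[OF _ xy(1)] q[OF _ xy(2)] by simp
      qed
      then show "\<exists>D F. (F has_derivative D) (at z) \<and> (\<exists>G. open G \<and> z \<in> G \<and> G \<subseteq> C \<and> (\<forall>z'\<in>G. W z' = F z'))"
        using der G by blast
    qed
  qed
  then show ?thesis using open_C by (subst AE_restrict_space_iff) auto
qed

lemma V_H1w:
  assumes "W \<in> \<V>"
  shows "W \<in> H1w \<rho> C"
proof -
  obtain L where L: "L-lipschitz_on (closure C) W" using V_lipschitz[OF assms] ..
  have cl: "closed (closure C)" "convex (closure C)" "closure C \<noteq> {}"
    using Omega Y_pos closed_closure[of C] by (auto simp: closure_C convex_Times convex_closure)
  \<comment> \<open>The criterion for Lipschitz functions needs one on the whole space, because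
    difference quotients may leave C. Composition with the nearest-point projection, nonexpansive
    since the closed cylinder is convex, keeps the Lipschitz constant.\<close>
  define Z where "Z z = W (closest_point (closure C) z)" for z
  have ZW: "Z z = W z" if "z \<in> closure C" for z
    using that by (simp add: Z_def closest_point_self)
  have LZ: "L-lipschitz_on UNIV Z"
  proof (rule lipschitz_onI)
    fix x y
    have "dist (Z x) (Z y) \<le> L * dist (closest_point (closure C) x) (closest_point (closure C) y)"
      unfolding Z_def by (rule lipschitz_onD[OF L]) (use cl in \<open>auto intro: closest_point_in_set\<close>)
    also have "\<dots> \<le> L * dist x y"
      using closest_point_lipschitz[OF cl(2,1,3)] lipschitz_on_nonneg[OF L] by (intro mult_left_mono) auto
    finally show "dist (Z x) (Z y) \<le> L * dist x y" .
  qed (use lipschitz_on_nonneg[OF L] in auto)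
  have "Z \<in> H1w \<rho> C"
  proof (rule H1w_lipschitz[OF bounded_C weight_integrable LZ])
    fix b :: "(real^'n) \<times> real" assume "b \<in> Basis"
    show "AE z in lebesgue_on C. convergent (\<lambda>n. real (Suc n) * (Z (z + (1 / real (Suc n)) *\<^sub>R b) - Z z))"
      using V_differentiable_AE[OF assms]
    proof eventually_elim
      case (elim z)
      then obtain D F G where F: "(F has_derivative D) (at z)" and G: "open G" "z \<in> G" "G \<subseteq> C" "\<And>z'. z' \<in> G \<Longrightarrow> W z' = F z'"
        by blast
      have "(Z has_derivative D) (at z)"
        by (rule has_derivative_transform_within_open[OF F G(1,2)]) (use G closure_subset[of C] ZW in auto)
      from has_derivative_sequential[OF this] show ?case by (rule convergentI)
    qed
  qed
  then show ?thesis
    by (rule H1w_cong[rotated]) (use ZW closure_subset[of C] in auto)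
qed

lemma V_continuous: "W \<in> \<V> \<Longrightarrow> continuous_on (closure C) W"
  using V_lipschitz lipschitz_on_continuous_on by blast

text \<open>Harmonic extensions are energy-orthogonal to the zero-trace members of
  \<open>HL\<close>; this inclusion makes discrete functions admissible there. Each one is its own
  continuous approximation.\<close>

lemma V_HL: "W \<in> \<V> \<Longrightarrow> W \<in> HL \<Omega> s Y"
proof -
  assume W: "W \<in> \<V>"
  obtain N v p where rep: "tensor_rep \<Omega> \<T> Y \<sigma> M \<ss> W N v p" using W unfolding V_space_iff by blast
  note v = tensor_repD(1)[OF rep] and p = tensor_repD(2)[OF rep] and eq = tensor_repD(3)[OF rep]
  have "W z = 0" if "z \<in> frontier \<Omega> \<times> {0<..<Y} \<union> \<Omega> \<times> {Y}" for z
  proof -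
    obtain x y where z: "z = (x, y)" by (cases z)
    have "x \<in> closure \<Omega>" "y \<in> {0..Y}"
      using that Y_pos closure_subset[of \<Omega>] by (auto simp: z frontier_def)
    moreover have "v i x * p i y = 0" if "i < N" for i
      using v[OF that] p[OF that] \<open>z \<in> _\<close> by (auto simp: z S10_def Sr_def)
    ultimately show ?thesis unfolding z by (subst eq) (auto intro!: sum.neutral)
  qed
  then show ?thesis
    unfolding HL_def H1w_vanishing_def using V_H1w[OF W] V_continuous[OF W] H1w_tendsto_const[of W]
    by (intro CollectI conjI exI[of _ "\<lambda>_. W"]) auto
qed

lemma V_bottom_continuous:
  assumes "W \<in> \<V>"
  shows "continuous_on (closure \<Omega>) (\<lambda>x. W (x, 0))"
  by (rule continuous_on_compose2[OF V_continuous[OF assms]])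
    (use Y_pos in \<open>auto simp: closure_C intro!: continuous_intros\<close>)

lemma V_has_trace: "W \<in> \<V> \<Longrightarrow> has_trace \<Omega> s Y W (\<lambda>x. W (x, 0))"
  unfolding has_trace_def
  using V_H1w[of W] V_continuous[of W] H1w_tendsto_const[of W] V_bottom_continuous[of W]
    continuous_on_closure_L2[of "\<lambda>x. W (x, 0)"]
  by (intro conjI exI[of _ "\<lambda>_. W"]) (auto simp: L2_norm_def L2_inner_def)

text \<open>The points are the mesh vertices at height 0: bottom values are affine on each simplex,
  so zeros at the vertices propagate to their convex hull. This finite set plays the part of finite
  dimensionality in \<open>riesz_representation\<close>; nothing is claimed about W above the
  bottom.\<close>

lemma V_determining_points:
  obtains P where "finite P"
    "\<And>W. W \<in> \<V> \<Longrightarrow> (\<forall>z\<in>P. W z = 0) \<Longrightarrow> (\<forall>x\<in>closure \<Omega>. W (x, 0) = 0)"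
proof -
  obtain Q where Q: "\<And>T. T \<in> \<T> \<Longrightarrow> finite (Q T) \<and> T = convex hull (Q T)"
    using mesh_facts(5) by metis
  define P where "P = (\<Union>T\<in>\<T>. Q T) \<times> {0::real}"
  have "W (x, 0) = 0" if W: "W \<in> \<V>" "\<forall>z\<in>P. W z = 0" and x: "x \<in> closure \<Omega>" for W x
  proof -
    obtain N v p where rep: "tensor_rep \<Omega> \<T> Y \<sigma> M \<ss> W N v p" using W(1) unfolding V_space_iff by blast
    note v = tensor_repD(1)[OF rep] and p = tensor_repD(2)[OF rep] and eq = tensor_repD(3)[OF rep]
    obtain T where T: "T \<in> \<T>" "x \<in> T" using x mesh_facts(4) by blast
    have "\<exists>\<alpha> \<beta>. \<forall>x\<in>T. v i x = \<alpha> \<bullet> x + \<beta>" if "i < N" for i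
      using v[OF that] T(1) unfolding S10_def by blast
    then obtain \<alpha> \<beta> where ab: "\<And>i x. i < N \<Longrightarrow> x \<in> T \<Longrightarrow> v i x = \<alpha> i \<bullet> x + \<beta> i" by metis
    define a b where "a = (\<Sum>i<N. p i 0 *\<^sub>R \<alpha> i)" and "b = (\<Sum>i<N. p i 0 * \<beta> i)"
    have aff: "W (x, 0) = a \<bullet> x + b" if "x \<in> T" for x
    proof -
      have "x \<in> closure \<Omega>" using that T(1) mesh_facts(4) by blast
      then have "W (x, 0) = (\<Sum>i<N. v i x * p i 0)" using eq[of x 0] Y_pos by simp
      also have "\<dots> = (\<Sum>i<N. p i 0 * (\<alpha> i \<bullet> x) + p i 0 * \<beta> i)"
        using ab[OF _ that] by (intro sum.cong) (auto simp: algebra_simps)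
      also have "\<dots> = a \<bullet> x + b" by (simp add: a_def b_def sum.distrib inner_sum_left)
      finally show ?thesis .
    qed
    have "Q T \<subseteq> {x. a \<bullet> x = - b}"
    proof
      fix y assume y: "y \<in> Q T"
      then have "y \<in> T" using Q[OF T(1)] hull_inc by metis
      moreover have "W (y, 0) = 0" using W(2) y T(1) by (auto simp: P_def)
      ultimately show "y \<in> {x. a \<bullet> x = - b}" using aff[of y] by simp
    qed
    then have "convex hull (Q T) \<subseteq> {x. a \<bullet> x = - b}"
      by (intro hull_minimal convex_hyperplane)
    then show ?thesis using aff[OF T(2)] T(2) Q[OF T(1)] by auto
  qed
  moreover have "finite P" unfolding P_def using Q mesh_facts(1) by auto
  ultimately show ?thesis using that by blast
qed

end

section \<open>Uniqueness of the trace\<close>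

lemma hat_le_2: "hat t \<le> 2"
  by (auto simp: hat_def max_def)

text \<open>The slope of the cutoff that rises from 0 at \<epsilon> to 1 at 2 \<epsilon>. It has
  mass 1 and support strictly above the bottom, so it can occur in the gradient of a test function
  on the open cylinder and still concentrate at y = 0.\<close>

definition hat_kernel :: "real \<Rightarrow> real \<Rightarrow> real" where "hat_kernel \<epsilon> y = hat (y / \<epsilon> - 1) / \<epsilon>"

lemma continuous_hat_kernel: "continuous_on S (hat_kernel \<epsilon>)"
  unfolding hat_kernel_def[abs_def] divide_inverse
  by (intro continuous_intros continuous_on_compose2[OF continuous_on_hat[of UNIV]]) auto

lemma hat_kernel_nonneg: "0 < \<epsilon> \<Longrightarrow> 0 \<le> hat_kernel \<epsilon> y"
  by (simp add: hat_kernel_def hat_nonneg)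

lemma hat_kernel_eq_0: "0 < \<epsilon> \<Longrightarrow> y \<notin> {\<epsilon>..2 * \<epsilon>} \<Longrightarrow> hat_kernel \<epsilon> y = 0"
  unfolding hat_kernel_def by (subst hat_eq_0) (auto simp: field_simps)

lemma DERIV_smoothstep_scaled:
  "\<epsilon> \<noteq> 0 \<Longrightarrow> ((\<lambda>y. smoothstep (y / \<epsilon> - 1)) has_real_derivative hat_kernel \<epsilon> y) (at y)"
  unfolding hat_kernel_def
  by (rule DERIV_chain2[OF DERIV_smoothstep, THEN DERIV_cong]) (auto intro!: derivative_eq_intros)

lemma hat_kernel_integral:
  assumes "0 < \<epsilon>"
  shows "integrable lborel (hat_kernel \<epsilon>)" "(LINT y|lborel. hat_kernel \<epsilon> y) = 1"
proof -
  have "has_bochner_integral lborel (\<lambda>y. hat_kernel \<epsilon> y * indicator {\<epsilon>..2 * \<epsilon>} y)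
      (smoothstep (2 * \<epsilon> / \<epsilon> - 1) - smoothstep (\<epsilon> / \<epsilon> - 1))"
    using assms by (intro has_bochner_integral_FTC_Icc_real DERIV_smoothstep_scaled)
      (auto intro: continuous_on_interior[OF continuous_hat_kernel[of UNIV]])
  moreover have "(\<lambda>y. hat_kernel \<epsilon> y * indicator {\<epsilon>..2 * \<epsilon>} y) = hat_kernel \<epsilon>"
    using hat_kernel_eq_0[OF assms] by (fastforce simp: indicator_def fun_eq_iff)
  moreover have "smoothstep (2 * \<epsilon> / \<epsilon> - 1) - smoothstep (\<epsilon> / \<epsilon> - 1) = 1"
    using assms smoothstep_ge_1[of 1] smoothstep_le_0[of 0] by simp
  ultimately have "has_bochner_integral lborel (hat_kernel \<epsilon>) 1" by simp
  then show "integrable lborel (hat_kernel \<epsilon>)" "(LINT y|lborel. hat_kernel \<epsilon> y) = 1"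
    by (auto simp: has_bochner_integral_iff)
qed

text \<open>Testing the weak \<open>y\<close>-derivative with \<open>\<xi>(x)\<close> times a cutoff that rises from 0 to 1 near the
  bottom bounds the moments of the bottom values by the weighted norm.\<close>

context extension_problem
begin

text \<open>Cauchy-Schwarz in the weighted space against the reciprocal weight y^(2s-1): the weight
  cancels in the product, and the squared weighted norm of the reciprocal is its own integral, which
  is finite because 2s-1 > -1.\<close>

lemma LINT_abs_le:
  assumes "f \<in> L2w \<rho> C"
  shows "integrable (lebesgue_on C) f"
    and "(LINT z|lebesgue_on C. \<bar>f z\<bar>)
      \<le> sqrt (LINT z|lebesgue_on C. snd z powr (2 * s - 1)) * sqrt (LINT z|lebesgue_on C. \<rho> z * (f z)\<^sup>2)"
proof -
  interpret l: semi_inner "L2w \<rho> C" "\<lambda>f g. LINT x|lebesgue_on C. \<rho> x * (f x * g x)"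
    by (rule semi_inner_L2w)
  let ?r = "\<lambda>z::(real^'n) \<times> real. snd z powr (2 * s - 1)"
  have int: "integrable (lebesgue_on C) ?r"
    unfolding C_eq using Omega s_range Y_pos by (intro integrable_snd_powr) auto
  have one: "\<rho> z * ?r z = 1" if "z \<in> C" for z
    using that by (auto simp: y_weight_def cyl_def simp flip: powr_add)
  have rsq: "\<rho> z * (?r z * ?r z) = ?r z" if "z \<in> C" for z
    using one[OF that] by (metis mult.assoc mult_1)
  have "integrable (lebesgue_on C) (\<lambda>z. \<rho> z * (norm (?r z))\<^sup>2)"
    by (rule Bochner_Integration.integrable_cong[THEN iffD1, OF refl _ int])
      (simp add: rsq power2_eq_square)
  then have r: "?r \<in> L2w \<rho> C" using int by (auto simp: L2w_def)
  have fm: "f \<in> borel_measurable (lebesgue_on C)" using assms by (auto simp: L2w_def)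
  have absf: "(\<lambda>z. \<bar>f z\<bar>) \<in> L2w \<rho> C" using assms fm by (auto simp: L2w_def)
  have eq: "\<rho> z * (\<bar>f z\<bar> * ?r z) = \<bar>f z\<bar>" if "z \<in> C" for z
    using one[OF that] by (metis mult.left_commute mult.right_neutral)
  have "integrable (lebesgue_on C) (\<lambda>z. \<rho> z * (\<bar>f z\<bar> * ?r z))"
    using L2w_inner_integrable[OF absf r] by simp
  then have "integrable (lebesgue_on C) (\<lambda>z. \<bar>f z\<bar>)"
    by (rule Bochner_Integration.integrable_cong[THEN iffD1, OF refl, rotated]) (simp add: eq)
  then show "integrable (lebesgue_on C) f" using fm by (simp add: integrable_abs_iff)
  have "(LINT z|lebesgue_on C. \<bar>f z\<bar>) = (LINT z|lebesgue_on C. \<rho> z * (\<bar>f z\<bar> * ?r z))"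
    by (intro Bochner_Integration.integral_cong) (auto simp: eq)
  also have "\<dots> \<le> l.N (\<lambda>z. \<bar>f z\<bar>) * l.N ?r"
    using l.cauchy_schwarz[OF absf r] by linarith
  also have "l.N ?r = sqrt (LINT z|lebesgue_on C. ?r z)"
    unfolding l.N_def by (intro arg_cong[where f=sqrt] Bochner_Integration.integral_cong) (auto simp: rsq)
  also have "l.N (\<lambda>z. \<bar>f z\<bar>) = sqrt (LINT z|lebesgue_on C. \<rho> z * (f z)\<^sup>2)"
    by (simp add: l.N_def power2_eq_square)
  finally show "(LINT z|lebesgue_on C. \<bar>f z\<bar>)
      \<le> sqrt (LINT z|lebesgue_on C. ?r z) * sqrt (LINT z|lebesgue_on C. \<rho> z * (f z)\<^sup>2)"
    by (simp add: mult.commute)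
qed

text \<open>Equal to 1 below Y/4 and 0 above Y/2. It keeps test functions away from the lid, where
  no boundary values are prescribed for the functions to be tested.\<close>

definition tail_cutoff :: "real \<Rightarrow> real" where "tail_cutoff y = smoothstep (2 - 4 * y / Y)"

lemma DERIV_tail_cutoff:
  "(tail_cutoff has_real_derivative hat (2 - 4 * y / Y) * (- 4 / Y)) (at y)"
  unfolding tail_cutoff_def[abs_def]
  by (rule DERIV_chain2[OF DERIV_smoothstep]) (use Y_pos in \<open>auto intro!: derivative_eq_intros\<close>)

lemma tail_cutoff_simps: "y \<le> Y / 4 \<Longrightarrow> tail_cutoff y = 1" "Y / 2 \<le> y \<Longrightarrow> tail_cutoff y = 0"
  using Y_pos by (auto simp: tail_cutoff_def field_simps intro!: smoothstep_ge_1 smoothstep_le_0)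

lemma trace_moment_bound:
  assumes tf: "test_function \<Omega> \<xi> \<xi>'"
  shows "\<exists>K. \<forall>d \<in> H1w \<rho> C. continuous_on (closure C) d \<longrightarrow>
      \<bar>LINT x|lebesgue_on \<Omega>. d (x, 0) * \<xi> x\<bar> \<le> K * H1w_norm \<rho> C d"
proof -
  obtain S where S: "compact S" "S \<subseteq> \<Omega>" "\<And>x. x \<notin> S \<Longrightarrow> \<xi> x = 0"
    and cont: "continuous_on UNIV \<xi>"
    using test_function_support[OF tf] by metis
  have C1: "C1_gradient \<xi> \<xi>'" using tf by (simp add: test_function_iff)
  have "bounded (\<xi> ` S)" using S(1) cont
    by (intro compact_imp_bounded compact_continuous_image) (auto intro: continuous_on_subset)
  then obtain B0 where "\<forall>x\<in>S. \<bar>\<xi> x\<bar> \<le> B0" by (auto simp: bounded_iff)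
  define B where "B = max B0 0"
  have B: "\<bar>\<xi> x\<bar> \<le> B" "0 \<le> B" for x
    using \<open>\<forall>x\<in>S. \<bar>\<xi> x\<bar> \<le> B0\<close> S(3)[of x] by (cases "x \<in> S"; force simp: B_def)+
  define \<kappa> where "\<kappa> = sqrt (LINT z|lebesgue_on C. snd z powr (2 * s - 1))"
  have \<kappa>: "0 \<le> \<kappa>" by (simp add: \<kappa>_def)
  \<comment> \<open>The first term comes from the slope of the tail cutoff, at most 2 times 4/Y,
    acting on d; the second from the weak y-derivative of d. The factor \<kappa> converts weighted
    L2 norms into L1 norms.\<close>
  define K where "K = B * (8 / Y) * \<kappa> + B * \<kappa>"
  have int\<xi>: "integrable lborel (\<lambda>x. \<bar>\<xi> x\<bar>)"
    using integrable_lborel_compact_support[OF cont S(1,3)] by simp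
  have "\<bar>LINT x|lebesgue_on \<Omega>. d (x, 0) * \<xi> x\<bar> \<le> K * H1w_norm \<rho> C d"
    if dH: "d \<in> H1w \<rho> C" and dc: "continuous_on (closure C) d" for d
  proof -
    define g where "g = weak_gradient C d"
    define h where "h z = snd (g z)" for z
    have dL: "d \<in> L2w \<rho> C" and gL: "g \<in> L2w \<rho> C" using dH by (auto simp: H1w_def g_def)
    have wg: "has_weak_gradient C d g" unfolding g_def by (rule H1w_has_weak_gradient[OF dH])
    have gm: "g \<in> borel_measurable (lebesgue_on C)" using gL by (auto simp: L2w_def)
    have hL: "h \<in> L2w \<rho> C"
    proof (rule L2w_bound[OF gL, where K=1])
      show "h \<in> borel_measurable (lebesgue_on C)" unfolding h_def
        by (rule measurable_compose[OF gm borel_measurable_continuous_onI[OF continuous_on_snd[OF continuous_on_id]]])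
      show "AE z in lebesgue_on C. norm (h z) \<le> 1 * norm (g z)"
      proof (rule AE_I2)
        fix z show "norm (h z) \<le> 1 * norm (g z)"
          using norm_snd_le[of "snd (g z)" "fst (g z)"] by (simp add: h_def)
      qed
    qed
    have i2: "integrable (lebesgue_on C) (\<lambda>z. \<rho> z * (h z)\<^sup>2)" "integrable (lebesgue_on C) (\<lambda>z. \<rho> z * (norm (g z))\<^sup>2)"
      using hL gL by (auto simp: L2w_def)
    have nn: "0 \<le> (LINT z|lebesgue_on C. \<rho> z * (d z)\<^sup>2)" "0 \<le> (LINT z|lebesgue_on C. \<rho> z * (norm (g z))\<^sup>2)"
      by (simp_all add: weight_nonneg)
    have "(LINT z|lebesgue_on C. \<rho> z * (h z)\<^sup>2) \<le> (LINT z|lebesgue_on C. \<rho> z * (norm (g z))\<^sup>2)"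
    proof (rule integral_mono[OF i2])
      fix z
      have "(h z)\<^sup>2 \<le> (norm (g z))\<^sup>2"
        using norm_snd_le[of "snd (g z)" "fst (g z)"] power_mono[of "\<bar>h z\<bar>" "norm (g z)" 2] by (simp add: h_def)
      then show "\<rho> z * (h z)\<^sup>2 \<le> \<rho> z * (norm (g z))\<^sup>2" using weight_nonneg by (rule mult_left_mono)
    qed
    then have Nh: "sqrt (LINT z|lebesgue_on C. \<rho> z * (h z)\<^sup>2) \<le> H1w_norm \<rho> C d"
      using nn unfolding H1w_norm_def g_def by (intro real_sqrt_le_mono) linarith
    have Nd: "sqrt (LINT z|lebesgue_on C. \<rho> z * (d z)\<^sup>2) \<le> H1w_norm \<rho> C d"
      using nn unfolding H1w_norm_def g_def by (intro real_sqrt_le_mono) linarith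
    have Id: "(LINT z|lebesgue_on C. \<bar>d z\<bar>) \<le> \<kappa> * H1w_norm \<rho> C d"
      using LINT_abs_le(2)[OF dL] mult_left_mono[OF Nd \<kappa>] unfolding \<kappa>_def by linarith
    have Ih: "(LINT z|lebesgue_on C. \<bar>h z\<bar>) \<le> \<kappa> * H1w_norm \<rho> C d"
      using LINT_abs_le(2)[OF hL] mult_left_mono[OF Nh \<kappa>] unfolding \<kappa>_def by linarith
    have di: "integrable (lebesgue_on C) d" and hi: "integrable (lebesgue_on C) h"
      using LINT_abs_le(1) dL hL by auto
    \<comment> \<open>A bound uniform in \<epsilon>. The condition 8 \<epsilon> < Y puts the support
      of the kernel below Y/4, where the tail cutoff is 1, so the two slopes do not interact and the
      remainder r stays bounded independently of \<epsilon>.\<close>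
    have step1: "integrable (lebesgue_on C) (\<lambda>z. d z * (\<xi> (fst z) * hat_kernel \<epsilon> (snd z))) \<and>
        \<bar>LINT z|lebesgue_on C. d z * (\<xi> (fst z) * hat_kernel \<epsilon> (snd z))\<bar> \<le> K * H1w_norm \<rho> C d"
      if e: "0 < \<epsilon>" "8 * \<epsilon> < Y" for \<epsilon>
    proof -
      define r where "r y = smoothstep (y / \<epsilon> - 1) * (hat (2 - 4 * y / Y) * (- 4 / Y))" for y
      define \<eta> where "\<eta> y = smoothstep (y / \<epsilon> - 1) * tail_cutoff y" for y
      have kt: "hat_kernel \<epsilon> y * tail_cutoff y = hat_kernel \<epsilon> y" for y
        using hat_kernel_eq_0[OF e(1), of y] tail_cutoff_simps(1)[of y] e by (cases "y \<in> {\<epsilon>..2 * \<epsilon>}") auto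
      have DE: "(\<eta> has_real_derivative hat_kernel \<epsilon> y + r y) (at y)" for y
        unfolding \<eta>_def
        by (rule DERIV_mult[OF DERIV_smoothstep_scaled DERIV_tail_cutoff, THEN DERIV_cong])
          (use e kt[of y] in \<open>auto simp: r_def\<close>)
      have rc: "continuous_on UNIV r"
        unfolding r_def[abs_def] divide_inverse
        by (intro continuous_intros continuous_on_compose2[OF continuous_on_hat[of UNIV]]
            continuous_on_compose2[OF continuous_on_smoothstep[of UNIV]]) auto
      have \<eta>'c: "continuous_on UNIV (\<lambda>y. hat_kernel \<epsilon> y + r y)"
        by (intro continuous_on_add continuous_hat_kernel rc)
      let ?\<psi> = "\<lambda>z. \<xi> (fst z) * \<eta> (snd z)"
      let ?\<psi>' = "\<lambda>z. \<xi> (fst z) *\<^sub>R (0, hat_kernel \<epsilon> (snd z) + r (snd z)) + \<eta> (snd z) *\<^sub>R (\<xi>' (fst z), 0)"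
      have "C1_gradient ?\<psi> ?\<psi>'"
        by (rule C1_gradient_mult[OF C1_gradient_fst[OF C1] C1_gradient_snd[OF DE \<eta>'c]])
      moreover have "?\<psi> z = 0" if "z \<notin> S \<times> {\<epsilon>..Y / 2}" for z
      proof (cases "fst z \<in> S")
        case False
        then show ?thesis using S(3) by simp
      next
        case True
        then have "snd z < \<epsilon> \<or> Y / 2 < snd z" using that by (auto simp: mem_Times_iff)
        then have "\<eta> (snd z) = 0"
          using smoothstep_le_0[of "snd z / \<epsilon> - 1"] tail_cutoff_simps(2)[of "snd z"] e by (auto simp: \<eta>_def field_simps)
        then show ?thesis by simp
      qed
      moreover have "compact (S \<times> {\<epsilon>..Y / 2})" "S \<times> {\<epsilon>..Y / 2} \<subseteq> C"
        using S e by (auto simp: compact_Times cyl_def)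
      ultimately have tfC: "test_function C ?\<psi> ?\<psi>'"
        unfolding test_function_iff by blast
      note int = has_weak_gradient_integrable[OF open_C wg tfC]
      have eq: "(LINT z|lebesgue_on C. d z *\<^sub>R ?\<psi>' z) = - (LINT z|lebesgue_on C. ?\<psi> z *\<^sub>R g z)"
        using wg tfC unfolding has_weak_gradient_def by blast
      have "(LINT z|lebesgue_on C. (d z *\<^sub>R ?\<psi>' z) \<bullet> (0, 1)) = - (LINT z|lebesgue_on C. (?\<psi> z *\<^sub>R g z) \<bullet> (0, 1))"
        using arg_cong[OF eq, of "\<lambda>v. v \<bullet> (0, 1)"] integral_inner_left[OF int(1), of "(0, 1)"]
          integral_inner_left[OF int(2), of "(0, 1)"] by (simp only: inner_minus_left)
      moreover have "(d z *\<^sub>R ?\<psi>' z) \<bullet> (0, 1) = d z * (\<xi> (fst z) * (hat_kernel \<epsilon> (snd z) + r (snd z)))" for z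
        by (simp add: inner_prod_def)
      moreover have "(?\<psi> z *\<^sub>R g z) \<bullet> (0, 1) = ?\<psi> z * h z" for z by (simp add: inner_prod_def h_def)
      ultimately have weak: "(LINT z|lebesgue_on C. d z * (\<xi> (fst z) * (hat_kernel \<epsilon> (snd z) + r (snd z))))
          = - (LINT z|lebesgue_on C. ?\<psi> z * h z)" by (simp only:)
      have "integrable (lebesgue_on C) (\<lambda>z. (d z *\<^sub>R ?\<psi>' z) \<bullet> (0, 1))"
        by (rule integrable_inner_left) (rule int(1))
      then have i\<psi>: "integrable (lebesgue_on C) (\<lambda>z. d z * (\<xi> (fst z) * (hat_kernel \<epsilon> (snd z) + r (snd z))))"
        by (simp add: inner_prod_def)
      have "integrable (lebesgue_on C) (\<lambda>z. (?\<psi> z *\<^sub>R g z) \<bullet> (0, 1))"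
        by (rule integrable_inner_left) (rule int(2))
      then have i\<psi>h: "integrable (lebesgue_on C) (\<lambda>z. ?\<psi> z * h z)" by (simp add: inner_prod_def h_def)
      have rb: "\<bar>r y\<bar> \<le> 8 / Y" for y
      proof -
        have "\<bar>r y\<bar> = smoothstep (y / \<epsilon> - 1) * (hat (2 - 4 * y / Y) * (4 / Y))"
          using Y_pos by (simp add: r_def abs_mult smoothstep_nonneg hat_nonneg)
        also have "\<dots> \<le> 1 * (2 * (4 / Y))"
          using Y_pos by (intro mult_mono smoothstep_le_1 hat_le_2 mult_nonneg_nonneg hat_nonneg) auto
        finally show ?thesis by simp
      qed
      have b2: "\<bar>d z * (\<xi> (fst z) * r (snd z))\<bar> \<le> B * (8 / Y) * \<bar>d z\<bar>" for z
      proof -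
        have "\<bar>\<xi> (fst z) * r (snd z)\<bar> \<le> B * (8 / Y)"
          unfolding abs_mult using B rb by (intro mult_mono) auto
        from mult_left_mono[OF this abs_ge_zero[of "d z"]] show ?thesis by (simp add: abs_mult mult.commute)
      qed
      have i2: "integrable (lebesgue_on C) (\<lambda>z. d z * (\<xi> (fst z) * r (snd z)))"
      proof (rule Bochner_Integration.integrable_bound)
        show "integrable (lebesgue_on C) (\<lambda>z. B * (8 / Y) * d z)" using di by simp
        have "continuous_on UNIV (\<lambda>z::(real^'n) \<times> real. \<xi> (fst z) * r (snd z))"
          by (intro continuous_on_mult continuous_on_compose2[OF cont] continuous_on_compose2[OF rc]
              continuous_on_fst continuous_on_snd continuous_on_id) auto
        then have "(\<lambda>z. \<xi> (fst z) * r (snd z)) \<in> borel_measurable (lebesgue_on C)"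
          by (intro borel_measurable_lebesgue_on_borel borel_measurable_continuous_onI)
        then show "(\<lambda>z. d z * (\<xi> (fst z) * r (snd z))) \<in> borel_measurable (lebesgue_on C)"
          by (rule borel_measurable_times[OF borel_measurable_integrable[OF di]])
        show "AE z in lebesgue_on C. norm (d z * (\<xi> (fst z) * r (snd z))) \<le> norm (B * (8 / Y) * d z)"
          using b2 B(2) Y_pos by (intro AE_I2) (simp add: abs_mult)
      qed
      have e1: "d z * (\<xi> (fst z) * hat_kernel \<epsilon> (snd z)) = d z * (\<xi> (fst z) * (hat_kernel \<epsilon> (snd z) + r (snd z)))
          - d z * (\<xi> (fst z) * r (snd z))" for z by (simp add: algebra_simps)
      have "\<bar>?\<psi> z * h z\<bar> \<le> B * \<bar>h z\<bar>" for z
      proof -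
        have "\<bar>\<eta> (snd z)\<bar> \<le> 1"
          unfolding \<eta>_def tail_cutoff_def abs_mult using smoothstep_nonneg smoothstep_le_1
          by (simp add: mult_le_one)
        then have "\<bar>?\<psi> z\<bar> \<le> B * 1" unfolding abs_mult using B by (intro mult_mono) auto
        then show ?thesis unfolding abs_mult[of "?\<psi> z"] by (intro mult_right_mono) auto
      qed
      then have "\<bar>LINT z|lebesgue_on C. ?\<psi> z * h z\<bar> \<le> (LINT z|lebesgue_on C. B * \<bar>h z\<bar>)"
        using i\<psi>h hi by (intro order_trans[OF integral_abs_bound] integral_mono) auto
      also have "\<dots> = B * (LINT z|lebesgue_on C. \<bar>h z\<bar>)" by simp
      also have "\<dots> \<le> B * (\<kappa> * H1w_norm \<rho> C d)" using Ih B(2) by (rule mult_left_mono)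
      finally have j1: "\<bar>LINT z|lebesgue_on C. ?\<psi> z * h z\<bar> \<le> B * (\<kappa> * H1w_norm \<rho> C d)" .
      have "\<bar>LINT z|lebesgue_on C. d z * (\<xi> (fst z) * r (snd z))\<bar> \<le> (LINT z|lebesgue_on C. B * (8 / Y) * \<bar>d z\<bar>)"
        using i2 di b2 by (intro order_trans[OF integral_abs_bound] integral_mono) auto
      also have "\<dots> = B * (8 / Y) * (LINT z|lebesgue_on C. \<bar>d z\<bar>)" by simp
      also have "\<dots> \<le> B * (8 / Y) * (\<kappa> * H1w_norm \<rho> C d)"
        using Id B(2) Y_pos by (intro mult_left_mono) auto
      finally have j2: "\<bar>LINT z|lebesgue_on C. d z * (\<xi> (fst z) * r (snd z))\<bar> \<le> B * (8 / Y) * (\<kappa> * H1w_norm \<rho> C d)" .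
      have "(LINT z|lebesgue_on C. d z * (\<xi> (fst z) * hat_kernel \<epsilon> (snd z)))
          = - (LINT z|lebesgue_on C. ?\<psi> z * h z) - (LINT z|lebesgue_on C. d z * (\<xi> (fst z) * r (snd z)))"
        unfolding e1 weak[symmetric] using i\<psi> i2 by (rule Bochner_Integration.integral_diff)
      moreover have "K * H1w_norm \<rho> C d = B * (8 / Y) * (\<kappa> * H1w_norm \<rho> C d) + B * (\<kappa> * H1w_norm \<rho> C d)"
        by (simp add: K_def distrib_right mult.assoc)
      ultimately have "\<bar>LINT z|lebesgue_on C. d z * (\<xi> (fst z) * hat_kernel \<epsilon> (snd z))\<bar> \<le> K * H1w_norm \<rho> C d"
        using j1 j2 by linarith
      moreover have "integrable (lebesgue_on C) (\<lambda>z. d z * (\<xi> (fst z) * hat_kernel \<epsilon> (snd z)))"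
        unfolding e1 using i\<psi> i2 by (rule Bochner_Integration.integrable_diff)
      ultimately show ?thesis by blast
    qed
    define f where "f x = d (x, 0) * \<xi> x" for x
    have fS: "(\<lambda>x. indicator S x *\<^sub>R f x) = f"
    proof
      fix x show "indicator S x *\<^sub>R f x = f x" using S(3)[of x] by (cases "x \<in> S") (auto simp: f_def)
    qed
    have "continuous_on S f" unfolding f_def[abs_def]
      using S(2) closure_subset[of \<Omega>] Y_pos
      by (intro continuous_on_mult continuous_on_compose2[OF dc] continuous_on_subset[OF cont])
        (auto simp: closure_C intro!: continuous_intros)
    then have fi: "integrable lborel f" using borel_integrable_compact[OF S(1), of f] fS by simp
    have f\<Omega>: "(LINT x|lebesgue_on \<Omega>. f x) = (LINT x|lborel. f x)"
    proof (rule LINT_lebesgue_on_eq_lborel[OF Omega(5)])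
      show "f \<in> borel_measurable borel" using borel_measurable_integrable[OF fi] by simp
      show "f x = 0" if "x \<notin> \<Omega>" for x using S(2) S(3)[of x] that by (auto simp: f_def)
    qed
    define I where "I = (LINT x|lborel. \<bar>\<xi> x\<bar>)"
    \<comment> \<open>By uniform continuity, d differs from its bottom value by at most \<delta> on
      the support of a sufficiently low kernel. As the kernel has mass 1, replacing d by its bottom
      value turns the cylinder integral into the moment on \<Omega>, at cost \<delta> I.\<close>
    have step2: "\<bar>LINT x|lborel. f x\<bar> \<le> K * H1w_norm \<rho> C d + \<delta> * I" if "\<delta> > 0" for \<delta>
    proof -
      have "compact (closure C)" using bounded_C by (simp add: compact_closure)
      then have "uniformly_continuous_on (closure C) d" using dc compact_uniformly_continuous by blast
      then obtain r where r: "r > 0" "\<And>z z'. z \<in> closure C \<Longrightarrow> z' \<in> closure C \<Longrightarrow> dist z' z < r \<Longrightarrow> dist (d z') (d z) < \<delta>"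
        using \<open>\<delta> > 0\<close> unfolding uniformly_continuous_on_def by metis
      define \<epsilon> where "\<epsilon> = min (r / 4) (Y / 16)"
      have e: "0 < \<epsilon>" "8 * \<epsilon> < Y" "2 * \<epsilon> < r" using r(1) Y_pos by (auto simp: \<epsilon>_def)
      have zero: "\<xi> (fst z) * hat_kernel \<epsilon> (snd z) = 0" if "z \<notin> C" for z
      proof (cases "fst z \<in> \<Omega>")
        case True
        then have "snd z \<notin> {\<epsilon>..2 * \<epsilon>}" using that e by (auto simp: cyl_def mem_Times_iff)
        then show ?thesis using hat_kernel_eq_0[OF e(1)] by simp
      next
        case False
        then show ?thesis using S(2,3) by auto
      qed
      have CL: "C \<in> sets lebesgue" using open_C by auto
      have t1: "integrable lborel (\<lambda>z. f (fst z) * hat_kernel \<epsilon> (snd z))"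
        "(LINT z|lborel. f (fst z) * hat_kernel \<epsilon> (snd z)) = (LINT x|lborel. f x)"
        using lborel_tensor_product[OF fi hat_kernel_integral(1)[OF e(1)]] hat_kernel_integral(2)[OF e(1)] by auto
      have t2: "integrable lborel (\<lambda>z. \<bar>\<xi> (fst z)\<bar> * hat_kernel \<epsilon> (snd z))"
        "(LINT z|lborel. \<bar>\<xi> (fst z)\<bar> * hat_kernel \<epsilon> (snd z)) = I"
        using lborel_tensor_product[OF int\<xi> hat_kernel_integral(1)[OF e(1)]] hat_kernel_integral(2)[OF e(1)] by (auto simp: I_def)
      have c1: "(LINT z|lebesgue_on C. f (fst z) * hat_kernel \<epsilon> (snd z)) = (LINT x|lborel. f x)"
        unfolding t1(2)[symmetric]
      proof (rule LINT_lebesgue_on_eq_lborel[OF CL])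
        show "(\<lambda>z. f (fst z) * hat_kernel \<epsilon> (snd z)) \<in> borel_measurable borel"
          using borel_measurable_integrable[OF t1(1)] by simp
        show "f (fst z) * hat_kernel \<epsilon> (snd z) = 0" if "z \<notin> C" for z
          using zero[OF that] by (simp add: f_def)
      qed
      have c2: "(LINT z|lebesgue_on C. \<bar>\<xi> (fst z)\<bar> * hat_kernel \<epsilon> (snd z)) = I"
        unfolding t2(2)[symmetric]
      proof (rule LINT_lebesgue_on_eq_lborel[OF CL])
        show "(\<lambda>z. \<bar>\<xi> (fst z)\<bar> * hat_kernel \<epsilon> (snd z)) \<in> borel_measurable borel"
          using borel_measurable_integrable[OF t2(1)] by simp
        show "\<bar>\<xi> (fst z)\<bar> * hat_kernel \<epsilon> (snd z) = 0" if "z \<notin> C" for z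
          using zero[OF that] by simp
      qed
      have ii: "integrable (lebesgue_on C) (\<lambda>z. f (fst z) * hat_kernel \<epsilon> (snd z))"
          "integrable (lebesgue_on C) (\<lambda>z. \<bar>\<xi> (fst z)\<bar> * hat_kernel \<epsilon> (snd z))"
        using t1(1) t2(1) CL by (auto intro: integrable_lebesgue_on_of_lborel)
      note s1 = step1[OF e(1,2)]
      have "\<bar>d z * (\<xi> (fst z) * hat_kernel \<epsilon> (snd z)) - f (fst z) * hat_kernel \<epsilon> (snd z)\<bar>
          \<le> \<delta> * (\<bar>\<xi> (fst z)\<bar> * hat_kernel \<epsilon> (snd z))" if z: "z \<in> C" for z
      proof (cases "snd z \<in> {\<epsilon>..2 * \<epsilon>}")
        case True
        have zc: "z \<in> closure C" "(fst z, 0) \<in> closure C"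
          unfolding closure_C using z closure_subset[of \<Omega>] Y_pos by (auto simp: cyl_def)
        have "dist z (fst z, 0) < r"
          using True e by (cases z) (auto simp: dist_Pair_Pair dist_real_def)
        then have "\<bar>d z - d (fst z, 0)\<bar> \<le> \<delta>" using r(2)[OF zc(2,1)] by (simp add: dist_real_def)
        moreover have "d z * (\<xi> (fst z) * hat_kernel \<epsilon> (snd z)) - f (fst z) * hat_kernel \<epsilon> (snd z)
            = (d z - d (fst z, 0)) * (\<xi> (fst z) * hat_kernel \<epsilon> (snd z))" by (simp add: f_def algebra_simps)
        moreover have "\<bar>\<xi> (fst z) * hat_kernel \<epsilon> (snd z)\<bar> = \<bar>\<xi> (fst z)\<bar> * hat_kernel \<epsilon> (snd z)"
          using hat_kernel_nonneg[OF e(1)] by (simp add: abs_mult)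
        ultimately show ?thesis using hat_kernel_nonneg[OF e(1), of "snd z"]
          by (simp add: abs_mult[of "d z - d (fst z, 0)"] mult_right_mono)
      next
        case False
        then show ?thesis using hat_kernel_eq_0[OF e(1)] by simp
      qed
      then have "\<bar>LINT z|lebesgue_on C. d z * (\<xi> (fst z) * hat_kernel \<epsilon> (snd z)) - f (fst z) * hat_kernel \<epsilon> (snd z)\<bar>
          \<le> (LINT z|lebesgue_on C. \<delta> * (\<bar>\<xi> (fst z)\<bar> * hat_kernel \<epsilon> (snd z)))"
        using s1 ii by (intro order_trans[OF integral_abs_bound] integral_mono) auto
      also have "\<dots> = \<delta> * I" using c2 by simp
      finally have "\<bar>(LINT z|lebesgue_on C. d z * (\<xi> (fst z) * hat_kernel \<epsilon> (snd z))) - (LINT x|lborel. f x)\<bar> \<le> \<delta> * I"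
        using s1 ii c1 by (simp add: Bochner_Integration.integral_diff)
      then show ?thesis using s1 by linarith
    qed
    have I0: "0 \<le> I" by (simp add: I_def)
    have "\<bar>LINT x|lborel. f x\<bar> \<le> K * H1w_norm \<rho> C d"
    proof (rule field_le_epsilon)
      fix e :: real assume "e > 0"
      \<comment> \<open>Dividing by I + 1 covers I = 0 as well.\<close>
      have "\<bar>LINT x|lborel. f x\<bar> \<le> K * H1w_norm \<rho> C d + e / (I + 1) * I"
        using \<open>e > 0\<close> I0 by (intro step2) simp
      also have "e / (I + 1) * I \<le> e" using \<open>e > 0\<close> I0 by (simp add: field_simps)
      finally show "\<bar>LINT x|lborel. f x\<bar> \<le> K * H1w_norm \<rho> C d + e" by simp
    qed
    then show ?thesis using f\<Omega> by (simp add: f_def)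
  qed
  then show ?thesis by (intro exI[of _ K]) simp
qed

text \<open>The difference d of two approximating sequences tends to 0 in the weighted norm, while
  its bottom values tend to the difference k of the traces in L2. The moment bound makes every
  integral of k against a test function vanish, and the fundamental lemma gives k = 0.\<close>

proposition trace_unique:
  assumes "has_trace \<Omega> s Y w g" "has_trace \<Omega> s Y w g'"
  shows "AE x in lebesgue_on \<Omega>. g x = g' x"
proof -
  interpret e: elliptic_form \<rho> C "\<lambda>_ p. p" "\<lambda>_. 1" 1 1
    by (rule elliptic_form_id) (rule weighted_domain_axioms)
  interpret l: semi_inner "L2 \<Omega>" "L2_inner \<Omega>" by (rule semi_inner_L2[OF Omega(1)])
  have w: "w \<in> H1w \<rho> C" and g: "g \<in> L2 \<Omega>" "g' \<in> L2 \<Omega>" using assms by (auto simp: has_trace_def)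
  obtain v where v: "\<And>j. v j \<in> H1w \<rho> C" "\<And>j. continuous_on (closure C) (v j)"
    and vw: "(\<lambda>j. H1w_norm \<rho> C (\<lambda>x. v j x - w x)) \<longlonglongrightarrow> 0"
    and vg: "(\<lambda>j. L2_norm \<Omega> (\<lambda>x. v j (x, 0) - g x)) \<longlonglongrightarrow> 0"
    using assms(1) by (auto simp: has_trace_def H1w_tendsto_def)
  obtain u where u: "\<And>j. u j \<in> H1w \<rho> C" "\<And>j. continuous_on (closure C) (u j)"
    and uw: "(\<lambda>j. H1w_norm \<rho> C (\<lambda>x. u j x - w x)) \<longlonglongrightarrow> 0"
    and ug: "(\<lambda>j. L2_norm \<Omega> (\<lambda>x. u j (x, 0) - g' x)) \<longlonglongrightarrow> 0"
    using assms(2) by (auto simp: has_trace_def H1w_tendsto_def)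
  define d where "d j = (\<lambda>z. 1 * v j z + (- 1) * u j z)" for j
  have dH: "d j \<in> H1w \<rho> C" for j unfolding d_def by (rule H1w_lincomb[OF v(1) u(1)])
  have dc: "continuous_on (closure C) (d j)" for j
    unfolding d_def using u(2) v(2) by (intro continuous_intros)
  have eN: "H1w_norm \<rho> C f = e.N f" if "f \<in> H1w \<rho> C" for f
    by (simp add: e.N_def H1w_norm_grad_form[OF weighted_domain_axioms that])
  have "H1w_norm \<rho> C (d j) \<le> H1w_norm \<rho> C (\<lambda>x. v j x - w x) + H1w_norm \<rho> C (\<lambda>x. u j x - w x)" for j
  proof -
    have m: "(\<lambda>x. v j x - w x) \<in> H1w \<rho> C" "(\<lambda>x. u j x - w x) \<in> H1w \<rho> C"
      using u v w by (auto intro: e.diff_mem)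
    have "d j = (\<lambda>x. 1 * (v j x - w x) + (- 1) * (u j x - w x))" by (auto simp: d_def)
    then have "e.N (d j) \<le> e.N (\<lambda>x. v j x - w x) + e.N (\<lambda>x. u j x - w x)"
      using e.N_triangle[OF m, of 1 "-1"] by simp
    then show ?thesis by (simp only: eN dH m)
  qed
  note dle = this
  have "(\<lambda>j. H1w_norm \<rho> C (\<lambda>x. v j x - w x) + H1w_norm \<rho> C (\<lambda>x. u j x - w x)) \<longlonglongrightarrow> 0"
    using tendsto_add[OF vw uw] by simp
  then have d0: "(\<lambda>j. H1w_norm \<rho> C (d j)) \<longlonglongrightarrow> 0"
  proof (rule Lim_null_comparison[rotated], intro always_eventually allI)
    fix j
    have "0 \<le> H1w_norm \<rho> C (d j)" using e.N_nonneg[OF dH] by (simp only: eN dH)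
    then show "norm (H1w_norm \<rho> C (d j)) \<le> H1w_norm \<rho> C (\<lambda>x. v j x - w x) + H1w_norm \<rho> C (\<lambda>x. u j x - w x)"
      using dle[of j] by simp
  qed
  define k where "k = (\<lambda>x. 1 * g x + (- 1) * g' x)"
  have kL: "k \<in> L2 \<Omega>" unfolding k_def by (rule l.lincomb_mem[OF g])
  define b where "b j x = d j (x, 0)" for j x
  have bot: "(\<lambda>x. f (x, 0)) \<in> L2 \<Omega>" if "continuous_on (closure C) f" for f :: "_ \<Rightarrow> real"
    by (rule continuous_on_closure_L2, rule continuous_on_compose2[OF that])
      (use Y_pos in \<open>auto simp: closure_C intro!: continuous_intros\<close>)
  have bL: "b j \<in> L2 \<Omega>" and vL: "(\<lambda>x. v j (x, 0)) \<in> L2 \<Omega>" and uL: "(\<lambda>x. u j (x, 0)) \<in> L2 \<Omega>" for j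
    unfolding b_def by (rule bot[OF dc], rule bot[OF v(2)], rule bot[OF u(2)])
  have lN: "L2_norm \<Omega> f = l.N f" for f by (simp add: L2_norm_def l.N_def)
  have "l.N (\<lambda>x. b j x - k x) \<le> L2_norm \<Omega> (\<lambda>x. v j (x, 0) - g x) + L2_norm \<Omega> (\<lambda>x. u j (x, 0) - g' x)" for j
  proof -
    have "(\<lambda>x. b j x - k x) = (\<lambda>x. 1 * (v j (x, 0) - g x) + (- 1) * (u j (x, 0) - g' x))"
      by (auto simp: b_def d_def k_def)
    then show ?thesis
      using l.N_triangle[OF l.diff_mem[OF vL[of j] g(1)] l.diff_mem[OF uL[of j] g(2)], of 1 "-1"] lN by simp
  qed
  note kle = this
  have "(\<lambda>j. L2_norm \<Omega> (\<lambda>x. v j (x, 0) - g x) + L2_norm \<Omega> (\<lambda>x. u j (x, 0) - g' x)) \<longlonglongrightarrow> 0"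
    using tendsto_add[OF vg ug] by simp
  then have b0: "(\<lambda>j. l.N (\<lambda>x. b j x - k x)) \<longlonglongrightarrow> 0"
  proof (rule Lim_null_comparison[rotated], intro always_eventually allI)
    fix j show "norm (l.N (\<lambda>x. b j x - k x))
        \<le> L2_norm \<Omega> (\<lambda>x. v j (x, 0) - g x) + L2_norm \<Omega> (\<lambda>x. u j (x, 0) - g' x)"
      using l.N_nonneg[OF l.diff_mem[OF bL kL, of j]] kle[of j] by simp
  qed
  have "AE x in lebesgue_on \<Omega>. k x = 0"
  proof (rule locally_integrable_eq_0_AE[OF Omega(1)])
    show "locally_integrable \<Omega> k"
      unfolding locally_integrable_def
    proof (intro allI impI)
      fix S assume S: "compact S \<and> S \<subseteq> \<Omega>"
      have one: "(\<lambda>_. 1) \<in> L2 \<Omega>" by (rule continuous_on_closure_L2) (rule continuous_on_const)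
      interpret o: weighted_domain "\<lambda>_. 1" \<Omega> by (rule weighted_domain_one[OF Omega(1)])
      have "integrable (lebesgue_on \<Omega>) k"
        using o.L2w_inner_integrable[of k "\<lambda>_. 1"] kL one by (simp add: L2_def)
      then show "integrable (lebesgue_on S) k"
        using S Omega(5) by (intro integrable_lebesgue_on_subset[of \<Omega> k S]) (auto simp: lmeasurable_compact fmeasurableD)
    qed
    fix \<xi> \<xi>' assume tf: "test_function \<Omega> \<xi> \<xi>'"
    have \<xi>L: "\<xi> \<in> L2 \<Omega>"
      using C1_gradient_continuous tf by (intro continuous_on_closure_L2) (auto simp: test_function_iff intro: continuous_on_subset)
    obtain K where K: "\<forall>d \<in> H1w \<rho> C. continuous_on (closure C) d \<longrightarrow>
      \<bar>LINT x|lebesgue_on \<Omega>. d (x, 0) * \<xi> x\<bar> \<le> K * H1w_norm \<rho> C d"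
      using trace_moment_bound[OF tf] ..
    have "\<bar>L2_inner \<Omega> k \<xi>\<bar> \<le> K * H1w_norm \<rho> C (d j) + l.N (\<lambda>x. b j x - k x) * l.N \<xi>" for j
    proof -
      have "\<bar>L2_inner \<Omega> (b j) \<xi>\<bar> \<le> K * H1w_norm \<rho> C (d j)"
        using K[rule_format, OF dH dc, of j] by (simp add: L2_inner_def b_def)
      moreover have "\<bar>L2_inner \<Omega> (\<lambda>x. b j x - k x) \<xi>\<bar> \<le> l.N (\<lambda>x. b j x - k x) * l.N \<xi>"
        by (rule l.cauchy_schwarz[OF l.diff_mem[OF bL kL] \<xi>L])
      moreover have "L2_inner \<Omega> (\<lambda>x. b j x - k x) \<xi> = L2_inner \<Omega> (b j) \<xi> - L2_inner \<Omega> k \<xi>"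
        by (rule l.diff_left[OF bL kL \<xi>L])
      ultimately show ?thesis by linarith
    qed
    moreover have "(\<lambda>j. K * H1w_norm \<rho> C (d j) + l.N (\<lambda>x. b j x - k x) * l.N \<xi>) \<longlonglongrightarrow> K * 0 + 0 * l.N \<xi>"
      by (intro tendsto_intros d0 b0)
    ultimately have "\<bar>L2_inner \<Omega> k \<xi>\<bar> \<le> K * 0 + 0 * l.N \<xi>"
      by (intro LIMSEQ_le_const) auto
    then show "(LINT x|lebesgue_on \<Omega>. \<xi> x *\<^sub>R k x) = 0"
      by (simp add: L2_inner_def mult.commute)
  qed
  then show ?thesis by eventually_elim (simp add: k_def)
qed

end

section \<open>The Poincare inequality and the dual space\<close>

context extension_problem
begin

lemma domain_radius:
  obtains R where "0 < R" "\<And>x. x \<in> closure \<Omega> \<Longrightarrow> norm x \<le> R"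
proof -
  obtain R where R: "\<forall>x\<in>closure \<Omega>. norm x \<le> R"
    using compact_imp_bounded[OF compact_closure_Omega] unfolding bounded_iff by blast
  show ?thesis
  proof (rule that[of "max R 1"])
    show "norm x \<le> max R 1" if "x \<in> closure \<Omega>" for x using that R by fastforce
  qed auto
qed

lemma elliptic_form_A: "\<exists>K b. elliptic_form (\<lambda>_. 1) \<Omega> (\<lambda>x p. A x *v p) c K b"
proof -
  obtain K0 where K0: "\<And>x. x \<in> \<Omega> \<Longrightarrow> norm (A x) \<le> K0" using A_bounded by blast
  obtain b where b: "AE x in lebesgue_on \<Omega>. 0 \<le> c x \<and> c x \<le> b"
    using admissible by (auto simp: admissible_coefficients_def)
  obtain a where a: "a > 0" "\<And>x \<xi>. x \<in> \<Omega> \<Longrightarrow> (A x *v \<xi>) \<bullet> \<xi> \<ge> a * (norm \<xi>)\<^sup>2"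
    using admissible by (auto simp: admissible_coefficients_def)
  obtain L where L: "L-lipschitz_on \<Omega> A" using admissible by (auto simp: admissible_coefficients_def)
  have "elliptic_form (\<lambda>_. 1) \<Omega> (\<lambda>x p. A x *v p) c (real CARD('n) * K0) b"
  proof (intro elliptic_form.intro elliptic_form_axioms.intro weighted_domain_one[OF Omega(1)])
    fix z p q :: "real^'n"
    assume z: "z \<in> \<Omega>"
    show "linear ((*v) (A z))" by (rule matrix_vector_mul_linear)
    have "transpose (A z) = A z"
      using admissible z by (auto simp: admissible_coefficients_def)
    then show "(A z *v p) \<bullet> q = (A z *v q) \<bullet> p"
      by (metis dot_lmul_matrix inner_commute transpose_matrix_vector)
    have "0 \<le> a * (norm p)\<^sup>2" using a(1) by simp
    also have "\<dots> \<le> (A z *v p) \<bullet> p" using a(2) z by simp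
    finally show "0 \<le> (A z *v p) \<bullet> p" .
    have "norm (A z *v p) \<le> (real CARD('n) * norm (A z)) * norm p" by (rule norm_matrix_vector_le)
    also have "\<dots> \<le> (real CARD('n) * K0) * norm p"
      using K0[OF z] by (intro mult_right_mono mult_left_mono) auto
    finally show "norm (A z *v p) \<le> real CARD('n) * K0 * norm p" .
  next
    fix g :: "real^'n \<Rightarrow> real^'n"
    assume g: "g \<in> borel_measurable (lebesgue_on \<Omega>)"
    have "A \<in> borel_measurable (lebesgue_on \<Omega>)"
      by (rule continuous_imp_measurable_on_sets_lebesgue[OF lipschitz_on_continuous_on[OF L] Omega(5)])
    then show "(\<lambda>z. A z *v g z) \<in> borel_measurable (lebesgue_on \<Omega>)"
      using g by (intro borel_measurable_continuous_Pair[OF _ _ continuous_on_matrix_vector])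
  qed (use b admissible in \<open>auto simp: admissible_coefficients_def\<close>)
  then show ?thesis by blast
qed

abbreviation grad_norm :: "(real^'n \<Rightarrow> real) \<Rightarrow> real" where
  "grad_norm u \<equiv> sqrt (grad_form (\<lambda>_. 1) \<Omega> (\<lambda>_ p. p) (\<lambda>_. 0) u u)"

lemma elliptic_form_Dirichlet: "elliptic_form (\<lambda>_. 1) \<Omega> (\<lambda>_ p. p) (\<lambda>_. 0) 1 1"
proof -
  interpret weighted_domain "\<lambda>_. 1" \<Omega> by (rule weighted_domain_one[OF Omega(1)])
  show ?thesis by unfold_locales (auto simp: inner_commute linear_id[unfolded id_def])
qed

text \<open>The weak formulation for the test function \<open>x\<^sub>b v\<close> gives \<open>\<parallel>v\<parallel>\<^sup>2 = - 2 (v, x\<^sub>b \<partial>\<^sub>b v)\<close>.\<close>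

lemma poincare_test_function:
  assumes tf: "test_function \<Omega> v v'" and R: "0 < R" "\<And>x. x \<in> closure \<Omega> \<Longrightarrow> norm x \<le> R"
  shows "L2_norm \<Omega> v \<le> 2 * R * grad_norm v"
proof -
  interpret l: semi_inner "L2 \<Omega>" "L2_inner \<Omega>" by (rule semi_inner_L2[OF Omega(1)])
  obtain b :: "real^'n" where b: "b \<in> Basis" using nonempty_Basis by blast
  have C1: "C1_gradient v v'" using tf by (simp add: test_function_iff)
  have wg: "has_weak_gradient \<Omega> v v'" by (rule has_weak_gradient_test_function[OF Omega(1) tf])
  have cv: "continuous_on UNIV v" "continuous_on UNIV v'"
    using C1 C1_gradient_continuous by (auto simp: C1_gradient_def)
  define \<psi> where "\<psi> x = (b \<bullet> x + 0) * v x" for x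
  define \<psi>' where "\<psi>' x = (b \<bullet> x + 0) *\<^sub>R v' x + v x *\<^sub>R b" for x
  have "C1_gradient \<psi> \<psi>'"
    unfolding \<psi>_def[abs_def] \<psi>'_def[abs_def] by (rule C1_gradient_mult[OF C1_gradient_affine C1])
  then have tf': "test_function \<Omega> \<psi> \<psi>'"
    using tf unfolding test_function_iff by (auto simp: \<psi>_def)
  define w where "w x = (b \<bullet> x) * (v' x \<bullet> b)" for x
  have vL: "v \<in> L2 \<Omega>" and wL: "w \<in> L2 \<Omega>"
    unfolding w_def using cv
    by (auto intro!: continuous_on_closure_L2 continuous_intros intro: continuous_on_subset)
  note int = has_weak_gradient_integrable[OF Omega(1) wg tf']
  have eq: "(LINT x|lebesgue_on \<Omega>. v x *\<^sub>R \<psi>' x) = - (LINT x|lebesgue_on \<Omega>. \<psi> x *\<^sub>R v' x)"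
    using wg tf' unfolding has_weak_gradient_def by blast
  have "(LINT x|lebesgue_on \<Omega>. (v x *\<^sub>R \<psi>' x) \<bullet> b) = - (LINT x|lebesgue_on \<Omega>. (\<psi> x *\<^sub>R v' x) \<bullet> b)"
    using arg_cong[OF eq, of "\<lambda>u. u \<bullet> b"] integral_inner_left[OF int(1), of b]
      integral_inner_left[OF int(2), of b] by (simp only: inner_minus_left)
  moreover have "(v x *\<^sub>R \<psi>' x) \<bullet> b = v x * (1 * w x + 1 * v x)" for x
    using b by (simp add: \<psi>'_def w_def inner_add_left algebra_simps)
  moreover have "(\<psi> x *\<^sub>R v' x) \<bullet> b = v x * w x" for x by (simp add: \<psi>_def w_def)
  ultimately have "L2_inner \<Omega> v (\<lambda>x. 1 * w x + 1 * v x) = - L2_inner \<Omega> v w"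
    unfolding L2_inner_def by (simp only:)
  then have "L2_inner \<Omega> v v = - 2 * L2_inner \<Omega> v w"
    unfolding l.lincomb_right[OF wL vL vL] by simp
  then have "l.N v * l.N v \<le> 2 * (l.N v * l.N w)"
    using l.cauchy_schwarz[OF vL wL] l.N_power2[OF vL] by (simp add: power2_eq_square)
  then have vw: "l.N v \<le> 2 * l.N w"
    using l.N_nonneg[OF vL] l.N_nonneg[OF wL] by (cases "l.N v = 0") (auto simp: mult.left_commute)
  have ae: "AE x in lebesgue_on \<Omega>. weak_gradient \<Omega> v x = v' x"
    by (rule weak_gradient_AE[OF Omega(1) wg])
  have v'i: "integrable (lebesgue_on \<Omega>) (\<lambda>x. (norm (v' x))\<^sup>2)"
  proof -
    have "(\<lambda>x. norm (v' x)) \<in> L2 \<Omega>"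
      using cv by (intro continuous_on_closure_L2 continuous_intros) (auto intro: continuous_on_subset)
    then show ?thesis by (simp add: L2_def L2w_def)
  qed
  have gf: "grad_form (\<lambda>_. 1) \<Omega> (\<lambda>_ p. p) (\<lambda>_. 0) v v = (LINT x|lebesgue_on \<Omega>. (norm (v' x))\<^sup>2)"
    unfolding grad_form_def
  proof (rule integral_cong_AE)
    have "weak_gradient \<Omega> v \<in> borel_measurable (lebesgue_on \<Omega>)"
      using cv by (intro borel_measurable_lebesgue_on_AE[OF Omega(5) _ ae] borel_measurable_lebesgue_on_borel
          borel_measurable_continuous_onI)
    then show "(\<lambda>z. 1 * (weak_gradient \<Omega> v z \<bullet> weak_gradient \<Omega> v z + 0 * v z * v z)) \<in> borel_measurable (lebesgue_on \<Omega>)"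
      by simp
    show "(\<lambda>x. (norm (v' x))\<^sup>2) \<in> borel_measurable (lebesgue_on \<Omega>)" using v'i by auto
    show "AE x in lebesgue_on \<Omega>. 1 * (weak_gradient \<Omega> v x \<bullet> weak_gradient \<Omega> v x + 0 * v x * v x) = (norm (v' x))\<^sup>2"
      using ae by eventually_elim (simp add: power2_norm_eq_inner)
  qed
  have "L2_inner \<Omega> w w \<le> (LINT x|lebesgue_on \<Omega>. R\<^sup>2 * (norm (v' x))\<^sup>2)"
    unfolding L2_inner_def
  proof (rule integral_mono)
    show "integrable (lebesgue_on \<Omega>) (\<lambda>x. w x * w x)" using wL by (simp add: L2_def L2w_def power2_eq_square)
    show "integrable (lebesgue_on \<Omega>) (\<lambda>x. R\<^sup>2 * (norm (v' x))\<^sup>2)" using v'i by simp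
    fix x assume "x \<in> space (lebesgue_on \<Omega>)"
    then have "norm x \<le> R" using R(2) closure_subset[of \<Omega>] by auto
    then have "\<bar>b \<bullet> x\<bar> \<le> R" using Cauchy_Schwarz_ineq2[of b x] b by simp
    moreover have "\<bar>v' x \<bullet> b\<bar> \<le> norm (v' x)" using Cauchy_Schwarz_ineq2[of "v' x" b] b by simp
    ultimately have "\<bar>w x\<bar> \<le> R * norm (v' x)" unfolding w_def abs_mult by (intro mult_mono) auto
    then have "\<bar>w x\<bar>\<^sup>2 \<le> (R * norm (v' x))\<^sup>2" by (intro power_mono) auto
    then show "w x * w x \<le> R\<^sup>2 * (norm (v' x))\<^sup>2" by (simp add: power2_eq_square mult_ac)
  qed
  also have "\<dots> = R\<^sup>2 * grad_form (\<lambda>_. 1) \<Omega> (\<lambda>_ p. p) (\<lambda>_. 0) v v" unfolding gf by simp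
  finally have "sqrt (L2_inner \<Omega> w w) \<le> sqrt (R\<^sup>2 * grad_form (\<lambda>_. 1) \<Omega> (\<lambda>_ p. p) (\<lambda>_. 0) v v)"
    by (rule real_sqrt_le_mono)
  then have "l.N w \<le> R * grad_norm v" using R(1) by (simp add: l.N_def real_sqrt_mult)
  then show ?thesis using vw by (simp add: L2_norm_def l.N_def)
qed

text \<open>Density of test functions: replacing u by \<open>v j\<close> changes the left side by at
  most \<open>q j\<close> and the gradient norm by at most \<open>q j\<close>, a total error of (1 +
  2R) \<open>q j\<close>.\<close>

lemma poincare:
  assumes u: "u \<in> H10 \<Omega>" and R: "0 < R" "\<And>x. x \<in> closure \<Omega> \<Longrightarrow> norm x \<le> R"
  shows "L2_norm \<Omega> u \<le> 2 * R * grad_norm u"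
proof -
  interpret l: semi_inner "L2 \<Omega>" "L2_inner \<Omega>" by (rule semi_inner_L2[OF Omega(1)])
  interpret o: weighted_domain "\<lambda>_. 1" \<Omega> by (rule weighted_domain_one[OF Omega(1)])
  interpret e: elliptic_form "\<lambda>_. 1" \<Omega> "\<lambda>_ p. p" "\<lambda>_. 0" 1 1 by (rule elliptic_form_Dirichlet)
  obtain v where v: "\<forall>j. \<exists>v'. test_function \<Omega> (v j) v'"
    and lim: "(\<lambda>j. H1w_norm (\<lambda>_. 1) \<Omega> (\<lambda>x. v j x - u x)) \<longlonglongrightarrow> 0"
    using u by (auto simp: H10_def H1w_tendsto_def)
  have uH: "u \<in> H1w (\<lambda>_. 1) \<Omega>" using u by (simp add: H10_def)
  have sub: "f \<in> L2 \<Omega>" if "f \<in> H1w (\<lambda>_. 1) \<Omega>" for f using that by (simp add: H1w_def L2_def)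
  have vH: "v j \<in> H1w (\<lambda>_. 1) \<Omega>" for j
  proof -
    obtain v' where tf: "test_function \<Omega> (v j) v'" using v by blast
    have C1: "C1_gradient (v j) v'" using tf by (simp add: test_function_iff)
    have cv: "continuous_on UNIV (v j)" "continuous_on UNIV v'"
      using C1 C1_gradient_continuous by (auto simp: C1_gradient_def)
    have "v j \<in> L2 \<Omega>" "(\<lambda>x. norm (v' x)) \<in> L2 \<Omega>"
      using cv by (auto intro!: continuous_on_closure_L2 continuous_intros intro: continuous_on_subset)
    then have "v j \<in> L2w (\<lambda>_. 1) \<Omega>" "v' \<in> L2w (\<lambda>_. 1) \<Omega>"
      using cv(2) by (auto simp: L2_def L2w_def intro!: borel_measurable_lebesgue_on_borel borel_measurable_continuous_onI)
    then show ?thesis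
      by (intro o.H1wI[OF _ has_weak_gradient_test_function[OF Omega(1) tf]])
  qed
  define q where "q j = H1w_norm (\<lambda>_. 1) \<Omega> (\<lambda>x. v j x - u x)" for j
  have qb: "L2_norm \<Omega> (\<lambda>x. v j x - u x) \<le> q j" "grad_norm (\<lambda>x. v j x - u x) \<le> q j" for j
    unfolding q_def H1w_norm_def L2_norm_def L2_inner_def grad_form_def
    by (simp_all add: power2_eq_square dot_square_norm)
  have "L2_norm \<Omega> u \<le> 2 * R * grad_norm u + (1 + 2 * R) * q j" for j
  proof -
    obtain v' where tf: "test_function \<Omega> (v j) v'" using v by blast
    have mem: "(\<lambda>x. v j x - u x) \<in> H1w (\<lambda>_. 1) \<Omega>" by (rule e.diff_mem[OF vH uH])
    have "l.N u \<le> l.N (v j) + l.N (\<lambda>x. v j x - u x)"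
      using l.N_triangle[OF sub[OF vH[of j]] sub[OF mem], of 1 "-1"] by simp
    moreover have "e.N (v j) \<le> e.N u + e.N (\<lambda>x. v j x - u x)"
      using e.N_triangle[OF uH mem, of 1 1] by simp
    then have "2 * R * e.N (v j) \<le> 2 * R * (e.N u + q j)"
      using qb(2)[of j] R(1) unfolding e.N_def by (intro mult_left_mono) linarith+
    ultimately show ?thesis
      using poincare_test_function[OF tf R] qb(1)[of j]
      by (simp add: L2_norm_def l.N_def e.N_def algebra_simps)
  qed
  moreover have "(\<lambda>j. 2 * R * grad_norm u + (1 + 2 * R) * q j) \<longlonglongrightarrow> 2 * R * grad_norm u + (1 + 2 * R) * 0"
    unfolding q_def by (intro tendsto_intros lim)
  ultimately have "L2_norm \<Omega> u \<le> 2 * R * grad_norm u + (1 + 2 * R) * 0"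
    by (intro LIMSEQ_le_const[where X="\<lambda>j. 2 * R * grad_norm u + (1 + 2 * R) * q j"]) auto
  then show ?thesis by simp
qed

text \<open>Positivity is not part of \<open>dirichlet_eigensystem\<close>. It follows from the
  Rayleigh quotient of a normalized eigenfunction: ellipticity and c \<ge> 0 bound it below by a
  multiple of the Dirichlet integral, and the Poincare constant 2R bounds that integral
  below.\<close>

lemma eigenvalues_bounded_below:
  assumes "dirichlet_eigensystem \<Omega> A c \<mu> \<phi>"
  shows "\<exists>m>0. \<forall>k. m \<le> \<mu> k"
proof -
  obtain K b where "elliptic_form (\<lambda>_. 1) \<Omega> (\<lambda>x p. A x *v p) c K b" using elliptic_form_A by blast
  then interpret e: elliptic_form "\<lambda>_. 1" \<Omega> "\<lambda>x p. A x *v p" c K b .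
  interpret d: elliptic_form "\<lambda>_. 1" \<Omega> "\<lambda>_ p. p" "\<lambda>_. 0" 1 1 by (rule elliptic_form_Dirichlet)
  obtain R where R: "0 < R" "\<And>x. x \<in> closure \<Omega> \<Longrightarrow> norm x \<le> R" using domain_radius by blast
  obtain a where a: "a > 0" "\<And>x \<xi>. x \<in> \<Omega> \<Longrightarrow> (A x *v \<xi>) \<bullet> \<xi> \<ge> a * (norm \<xi>)\<^sup>2"
    using admissible by (auto simp: admissible_coefficients_def)
  have "a / (2 * R)\<^sup>2 \<le> \<mu> k" for k
  proof -
    have \<phi>: "\<phi> k \<in> H10 \<Omega>" using assms by (auto simp: dirichlet_eigensystem_def)
    then have \<phi>H: "\<phi> k \<in> H1w (\<lambda>_. 1) \<Omega>" by (simp add: H10_def)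
    have one: "L2_inner \<Omega> (\<phi> k) (\<phi> k) = 1" using assms by (auto simp: dirichlet_eigensystem_def)
    let ?g = "weak_gradient \<Omega> (\<phi> k)"
    have "\<mu> k = grad_form (\<lambda>_. 1) \<Omega> (\<lambda>x p. A x *v p) c (\<phi> k) (\<phi> k)"
      using assms \<phi> one by (auto simp: dirichlet_eigensystem_def grad_form_def)
    moreover have "a * grad_form (\<lambda>_. 1) \<Omega> (\<lambda>_ p. p) (\<lambda>_. 0) (\<phi> k) (\<phi> k)
        \<le> grad_form (\<lambda>_. 1) \<Omega> (\<lambda>x p. A x *v p) c (\<phi> k) (\<phi> k)"
      unfolding grad_form_def integral_mult_right_zero[symmetric]
    proof (rule integral_mono_AE)
      show "integrable (lebesgue_on \<Omega>) (\<lambda>z. a * (1 * (?g z \<bullet> ?g z + 0 * \<phi> k z * \<phi> k z)))"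
        using d.integrand_integrable[OF \<phi>H \<phi>H] by simp
      show "integrable (lebesgue_on \<Omega>) (\<lambda>z. 1 * ((A z *v ?g z) \<bullet> ?g z + c z * \<phi> k z * \<phi> k z))"
        by (rule e.integrand_integrable[OF \<phi>H \<phi>H])
      have "AE z in lebesgue_on \<Omega>. z \<in> \<Omega>" by (rule AE_I2) simp
      with e.k_bounds show "AE z in lebesgue_on \<Omega>. a * (1 * (?g z \<bullet> ?g z + 0 * \<phi> k z * \<phi> k z))
          \<le> 1 * ((A z *v ?g z) \<bullet> ?g z + c z * \<phi> k z * \<phi> k z)"
      proof eventually_elim
        case (elim z)
        then have "0 \<le> c z * \<phi> k z * \<phi> k z" by (simp add: mult.assoc)
        moreover have "a * (?g z \<bullet> ?g z) \<le> (A z *v ?g z) \<bullet> ?g z"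
          using a(2)[of z "?g z"] elim by (simp add: power2_norm_eq_inner)
        ultimately show ?case by simp
      qed
    qed
    moreover have "1 \<le> 2 * R * grad_norm (\<phi> k)"
      using poincare[OF \<phi> R] one by (simp add: L2_norm_def)
    then have "1\<^sup>2 \<le> (2 * R * grad_norm (\<phi> k))\<^sup>2" by (intro power_mono) auto
    then have "1 \<le> (2 * R)\<^sup>2 * grad_form (\<lambda>_. 1) \<Omega> (\<lambda>_ p. p) (\<lambda>_. 0) (\<phi> k) (\<phi> k)"
      using d.nonneg[OF \<phi>H] by (simp add: power_mult_distrib)
    then have "a * 1 \<le> a * ((2 * R)\<^sup>2 * grad_form (\<lambda>_. 1) \<Omega> (\<lambda>_ p. p) (\<lambda>_. 0) (\<phi> k) (\<phi> k))"
      using a(1) by (intro mult_left_mono) auto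
    ultimately have "a \<le> (2 * R)\<^sup>2 * (a * grad_form (\<lambda>_. 1) \<Omega> (\<lambda>_ p. p) (\<lambda>_. 0) (\<phi> k) (\<phi> k))"
      "a * grad_form (\<lambda>_. 1) \<Omega> (\<lambda>_ p. p) (\<lambda>_. 0) (\<phi> k) (\<phi> k) \<le> \<mu> k"
      by (simp_all add: mult.left_commute)
    then have "a \<le> (2 * R)\<^sup>2 * \<mu> k"
      by (meson mult_left_mono order_trans zero_le_power2)
    then show ?thesis using R(1) by (subst pos_divide_le_eq) (auto simp: mult.commute)
  qed
  moreover have "0 < a / (2 * R)\<^sup>2" using a(1) R(1) by simp
  ultimately show ?thesis by blast
qed

text \<open>Reduces to control of the L2 norm by the \<open>Hs\<close> norm. For partial
  eigenfunction sums this is orthonormality and the lower eigenvalue bound; completeness of the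
  system carries it over to u.\<close>

lemma L2_inner_Hs_dual:
  assumes eig: "dirichlet_eigensystem \<Omega> A c \<mu> \<phi>" and f: "f \<in> L2 \<Omega>"
  shows "L2_inner \<Omega> f \<in> Hs_dual \<Omega> \<mu> \<phi> s"
proof -
  interpret l: semi_inner "L2 \<Omega>" "L2_inner \<Omega>" by (rule semi_inner_L2[OF Omega(1)])
  obtain m where m: "m > 0" "\<And>k. m \<le> \<mu> k" using eigenvalues_bounded_below[OF eig] by blast
  have \<phi>L: "\<phi> k \<in> L2 \<Omega>" for k
    using eig by (auto simp: dirichlet_eigensystem_def H10_def H1w_def L2_def)
  have orth: "L2_inner \<Omega> (\<phi> j) (\<phi> k) = (if j = k then 1 else 0)" for j k
    using eig by (simp add: dirichlet_eigensystem_def)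
  have main: "l.N u \<le> m powr (- s / 2) * Hs_norm \<Omega> \<mu> \<phi> s u" if u: "u \<in> Hs \<Omega> \<mu> \<phi> s" for u
  proof -
    have uL: "u \<in> L2 \<Omega>" and summ: "summable (\<lambda>k. \<mu> k powr s * (L2_inner \<Omega> u (\<phi> k))\<^sup>2)"
      using u by (auto simp: Hs_def)
    define q where "q k = L2_inner \<Omega> u (\<phi> k)" for k
    define P where "P n = (\<lambda>x. \<Sum>k<n. q k * \<phi> k x)" for n
    \<comment> \<open>Orthogonality of the partial sum to all later eigenfunctions is included
      because it removes the cross term in the induction step for the squared norm.\<close>
    have P: "P n \<in> L2 \<Omega> \<and> (\<forall>j\<ge>n. L2_inner \<Omega> (P n) (\<phi> j) = 0) \<and> L2_inner \<Omega> (P n) (P n) = (\<Sum>k<n. (q k)\<^sup>2)" for n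
    proof (induction n)
      case 0
      have "L2_inner \<Omega> (\<lambda>_. 0) g = 0" for g by (simp add: L2_inner_def)
      then show ?case by (simp add: P_def l.zero_mem)
    next
      case (Suc n)
      have eq: "P (Suc n) = (\<lambda>x. 1 * P n x + q n * \<phi> n x)" by (simp add: P_def)
      have "P (Suc n) \<in> L2 \<Omega>" unfolding eq using Suc \<phi>L by (intro l.lincomb_mem) auto
      moreover have "L2_inner \<Omega> (P (Suc n)) (\<phi> j) = 0" if "j \<ge> Suc n" for j
        unfolding eq using Suc \<phi>L that by (subst l.lincomb_left) (auto simp: orth)
      moreover have "L2_inner \<Omega> (P (Suc n)) (P (Suc n)) = (\<Sum>k<Suc n. (q k)\<^sup>2)"
        unfolding eq using Suc \<phi>L by (subst l.square_lincomb) (auto simp: orth)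
      ultimately show ?case by blast
    qed
    have NP: "l.N (P n) \<le> m powr (- s / 2) * Hs_norm \<Omega> \<mu> \<phi> s u" for n
    proof -
      have "(\<Sum>k<n. (q k)\<^sup>2) \<le> (\<Sum>k<n. m powr (- s) * (\<mu> k powr s * (q k)\<^sup>2))"
      proof (rule sum_mono)
        fix k
        have "m powr s \<le> \<mu> k powr s" using m s_range by (intro powr_mono2) auto
        then have "1 \<le> m powr (- s) * \<mu> k powr s"
          using m(1) by (simp add: powr_minus field_simps)
        then show "(q k)\<^sup>2 \<le> m powr (- s) * (\<mu> k powr s * (q k)\<^sup>2)"
          using mult_right_mono[of 1 "m powr (- s) * \<mu> k powr s" "(q k)\<^sup>2"] by (simp add: mult.assoc)
      qed
      also have "\<dots> = m powr (- s) * (\<Sum>k<n. \<mu> k powr s * (q k)\<^sup>2)" by (simp add: sum_distrib_left)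
      also have "\<dots> \<le> m powr (- s) * (\<Sum>k. \<mu> k powr s * (q k)\<^sup>2)"
        using summ by (intro mult_left_mono sum_le_suminf) (auto simp: q_def)
      finally have "sqrt (\<Sum>k<n. (q k)\<^sup>2) \<le> sqrt (m powr (- s) * (\<Sum>k. \<mu> k powr s * (q k)\<^sup>2))"
        by (rule real_sqrt_le_mono)
      also have "\<dots> = sqrt (m powr (- s)) * Hs_norm \<Omega> \<mu> \<phi> s u"
        by (simp add: real_sqrt_mult Hs_norm_def q_def)
      also have "sqrt (m powr (- s)) = m powr (- s / 2)"
        using m(1) by (simp add: powr_half_sqrt[symmetric] powr_powr)
      finally show ?thesis using P[of n] by (simp add: l.N_def)
    qed
    have "l.N u \<le> l.N (\<lambda>x. u x - P n x) + m powr (- s / 2) * Hs_norm \<Omega> \<mu> \<phi> s u" for n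
      using l.N_triangle[OF l.diff_mem[OF uL, of "P n"], of "P n" 1 1] P[of n] NP[of n] by simp
    moreover have "(\<lambda>n. l.N (\<lambda>x. u x - P n x) + m powr (- s / 2) * Hs_norm \<Omega> \<mu> \<phi> s u)
        \<longlonglongrightarrow> 0 + m powr (- s / 2) * Hs_norm \<Omega> \<mu> \<phi> s u"
    proof (intro tendsto_intros)
      have "(\<lambda>N. L2_norm \<Omega> (\<lambda>x. u x - (\<Sum>k<N. L2_inner \<Omega> u (\<phi> k) * \<phi> k x))) \<longlonglongrightarrow> 0"
        using eig uL by (simp add: dirichlet_eigensystem_def)
      then show "(\<lambda>n. l.N (\<lambda>x. u x - P n x)) \<longlonglongrightarrow> 0"
        by (simp add: L2_norm_def l.N_def P_def q_def)
    qed
    ultimately have "l.N u \<le> 0 + m powr (- s / 2) * Hs_norm \<Omega> \<mu> \<phi> s u"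
      by (intro LIMSEQ_le_const[where X="\<lambda>n. l.N (\<lambda>x. u x - P n x) + m powr (- s / 2) * Hs_norm \<Omega> \<mu> \<phi> s u"]) auto
    then show ?thesis by simp
  qed
  have sub: "u \<in> L2 \<Omega>" if "u \<in> Hs \<Omega> \<mu> \<phi> s" for u using that by (simp add: Hs_def)
  show ?thesis
    unfolding Hs_dual_def
  proof (intro CollectI conjI ballI allI exI)
    fix u v assume u: "u \<in> Hs \<Omega> \<mu> \<phi> s" and v: "v \<in> Hs \<Omega> \<mu> \<phi> s"
    show "L2_inner \<Omega> f (\<lambda>x. u x + v x) = L2_inner \<Omega> f u + L2_inner \<Omega> f v"
      by (rule l.add_right[OF sub[OF u] sub[OF v] f])
  next
    fix u and r :: real assume u: "u \<in> Hs \<Omega> \<mu> \<phi> s"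
    show "L2_inner \<Omega> f (\<lambda>x. r * u x) = r * L2_inner \<Omega> f u" by (rule l.scale_right[OF sub[OF u] f])
  next
    fix u assume u: "u \<in> Hs \<Omega> \<mu> \<phi> s"
    have "\<bar>L2_inner \<Omega> f u\<bar> \<le> l.N f * l.N u" by (rule l.cauchy_schwarz[OF f sub[OF u]])
    also have "\<dots> \<le> l.N f * (m powr (- s / 2) * Hs_norm \<Omega> \<mu> \<phi> s u)"
      by (intro mult_left_mono main[OF u] l.N_nonneg[OF f])
    finally show "\<bar>L2_inner \<Omega> f u\<bar> \<le> (l.N f * m powr (- s / 2)) * Hs_norm \<Omega> \<mu> \<phi> s u"
      by (simp add: mult.assoc)
  qed
qed

end

section \<open>The discrete energy argument\<close>

text \<open>The energy is \<open>E\<^sub>k = (\<parallel>D\<^sub>k\<parallel>\<^sub>b\<^sup>2 + a(V\<^sub>k\<^sub>+\<^sub>1, V\<^sub>k)) / 2\<close> with \<open>D\<^sub>k = (V\<^sub>k\<^sub>+\<^sub>1 - V\<^sub>k) / \<Delta>t\<close>. The inverse estimate and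
  the time step restriction make it coercive, and testing the scheme with \<open>D\<^sub>k + D\<^sub>k\<^sub>-\<^sub>1\<close> bounds the
  increments of its square root by \<open>\<Delta>t \<parallel>F\<^sub>k\<parallel>\<close>.\<close>

lemma leapfrog_energy_estimate:
  fixes V :: "nat \<Rightarrow> 'a \<Rightarrow> real"
  assumes sa: "semi_inner S a" and sb: "semi_inner S b"
    and V: "\<And>k. k \<le> K \<Longrightarrow> V k \<in> S" and dt: "0 < \<Delta>t"
    and step: "\<And>k W. 1 \<le> k \<Longrightarrow> k < K \<Longrightarrow> W \<in> S \<Longrightarrow>
      1 / \<Delta>t\<^sup>2 * b (\<lambda>z. V (k + 1) z - 2 * V k z + V (k - 1) z) W + a (V k) W = F k W"
    and F: "\<And>k W. 1 \<le> k \<Longrightarrow> k < K \<Longrightarrow> W \<in> S \<Longrightarrow> \<bar>F k W\<bar> \<le> p k * sqrt (b W W)"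
    and p: "\<And>k. 1 \<le> k \<Longrightarrow> k \<le> K \<Longrightarrow> 0 \<le> p k"
    and inv: "\<And>k. k < K \<Longrightarrow> \<Delta>t\<^sup>2 * a (\<lambda>z. V (k + 1) z - V k z) (\<lambda>z. V (k + 1) z - V k z)
      \<le> 2 * b (\<lambda>z. V (k + 1) z - V k z) (\<lambda>z. V (k + 1) z - V k z)"
    and l: "l \<in> {1..K}"
  shows "sqrt (b (dq \<Delta>t V l) (dq \<Delta>t V l)) + sqrt (a (V l) (V l))
    \<le> 5 * (sqrt (b (dq \<Delta>t V 1) (dq \<Delta>t V 1)) + sqrt (a (V 0) (V 0)) + sqrt (a (V 1) (V 1))
          + (\<Sum>k=1..l. \<Delta>t * p k))"
proof -
  interpret a: semi_inner S a by fact
  interpret b: semi_inner S b by fact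
  define D where "D k = dq \<Delta>t V (k + 1)" for k
  define E where "E k = (b (D k) (D k) + a (V (k + 1)) (V k)) / 2" for k
  have Dx: "D k = (\<lambda>z. (1 / \<Delta>t) * V (k + 1) z + (- 1 / \<Delta>t) * V k z)" for k
    by (auto simp: D_def dq_def diff_divide_distrib)
  have DS: "D k \<in> S" if "k < K" for k unfolding Dx using V that by (intro a.lincomb_mem) auto
  have diff: "(\<lambda>z. V (k + 1) z - V k z) = (\<lambda>z. \<Delta>t * D k z)" for k
    using dt by (auto simp: Dx field_simps)
  have inv': "a (\<lambda>z. V (k + 1) z - V k z) (\<lambda>z. V (k + 1) z - V k z) \<le> 2 * b (D k) (D k)" if k: "k < K" for k
  proof -
    have "b (\<lambda>z. V (k + 1) z - V k z) (\<lambda>z. V (k + 1) z - V k z) = \<Delta>t\<^sup>2 * b (D k) (D k)"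
      unfolding diff using DS[OF k] by (simp add: b.scale_left b.scale_right b.scale_mem power2_eq_square)
    then have "\<Delta>t\<^sup>2 * a (\<lambda>z. V (k + 1) z - V k z) (\<lambda>z. V (k + 1) z - V k z) \<le> \<Delta>t\<^sup>2 * (2 * b (D k) (D k))"
      using inv[OF k] by simp
    then show ?thesis using dt by simp
  qed
  have sq: "4 * a (V (k + 1)) (V k) = a (\<lambda>z. V (k + 1) z + V k z) (\<lambda>z. V (k + 1) z + V k z)
      - a (\<lambda>z. V (k + 1) z - V k z) (\<lambda>z. V (k + 1) z - V k z)" if "k < K" for k
    using a.square_lincomb[of "V (k + 1)" "V k" 1 1] a.square_lincomb[of "V (k + 1)" "V k" 1 "-1"]
      V[of k] V[of "k + 1"] that by simp
  have Vs: "(\<lambda>z. V (k + 1) z + V k z) \<in> S" "(\<lambda>z. V (k + 1) z - V k z) \<in> S" if "k < K" for k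
    using V that by (auto intro: a.add_mem a.diff_mem)
  \<comment> \<open>The subtracted term in the polarized mixed product contributes at most b(D,D)/4
    to the energy by \<open>inv'\<close>. This is half of the kinetic part b(D,D)/2, so a quarter
    survives.\<close>
  have coer: "b (D k) (D k) / 4 + a (\<lambda>z. V (k + 1) z + V k z) (\<lambda>z. V (k + 1) z + V k z) / 8 \<le> E k"
    if k: "k < K" for k
    using sq[OF k] inv'[OF k] by (simp add: E_def)
  have E0: "0 \<le> E k" if k: "k < K" for k
    using coer[OF k] a.nonneg[OF Vs(1)[OF k]] b.nonneg[OF DS[OF k]] by linarith
  have ND: "b.N (D k) \<le> 2 * sqrt (E k)" if k: "k < K" for k
  proof -
    have "b (D k) (D k) \<le> 2\<^sup>2 * E k" using coer[OF k] a.nonneg[OF Vs(1)[OF k]] by simp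
    then have "sqrt (b (D k) (D k)) \<le> sqrt (2\<^sup>2 * E k)" by (rule real_sqrt_le_mono)
    then show ?thesis by (simp only: b.N_def real_sqrt_mult real_sqrt_abs abs_numeral)
  qed
  have incr: "sqrt (E k) \<le> sqrt (E (k - 1)) + \<Delta>t * p k" if k: "1 \<le> k" "k < K" for k
  proof -
    have k1: "k - 1 < K" "k - 1 + 1 = k" using k by auto
    have D1: "D k \<in> S" "D (k - 1) \<in> S" using DS k by auto
    define W where "W = (\<lambda>z. D k z + D (k - 1) z)"
    have W: "W \<in> S" unfolding W_def by (rule a.add_mem[OF D1])
    have VS: "V (k + 1) \<in> S" "V k \<in> S" "V (k - 1) \<in> S" using V k by auto
    have "(\<lambda>z. V (k + 1) z - 2 * V k z + V (k - 1) z) = (\<lambda>z. \<Delta>t * (D k z - D (k - 1) z))"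
      using dt k1(2) by (auto simp: Dx field_simps)
    then have "1 / \<Delta>t\<^sup>2 * b (\<lambda>z. V (k + 1) z - 2 * V k z + V (k - 1) z) W
        = 1 / \<Delta>t\<^sup>2 * (\<Delta>t * b (\<lambda>z. D k z - D (k - 1) z) W)"
      using b.scale_left[OF b.diff_mem[OF D1] W, of \<Delta>t] by simp
    also have "\<dots> = b (\<lambda>z. D k z - D (k - 1) z) W / \<Delta>t"
      using dt by (simp add: power2_eq_square)
    also have "b (\<lambda>z. D k z - D (k - 1) z) W = b (D k) (D k) - b (D (k - 1)) (D (k - 1))"
      unfolding W_def using D1 b.sym[OF D1]
      by (simp add: b.diff_left b.add_right b.add_mem)
    finally have 1: "1 / \<Delta>t\<^sup>2 * b (\<lambda>z. V (k + 1) z - 2 * V k z + V (k - 1) z) W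
        = (b (D k) (D k) - b (D (k - 1)) (D (k - 1))) / \<Delta>t" .
    \<comment> \<open>The two occurrences of \<open>V k\<close> in W cancel, so a(V k, W) is a
      difference of consecutive mixed products.\<close>
    have "W = (\<lambda>z. (1 / \<Delta>t) * V (k + 1) z + (- 1 / \<Delta>t) * V (k - 1) z)"
      using k1(2) by (auto simp: W_def Dx)
    then have 2: "a (V k) W = (a (V (k + 1)) (V k) - a (V k) (V (k - 1))) / \<Delta>t"
      using a.lincomb_right[OF VS(1,3,2), of "1 / \<Delta>t" "- 1 / \<Delta>t"] a.sym[OF VS(1,2)]
      by (simp add: diff_divide_distrib)
    have "(b (D k) (D k) - b (D (k - 1)) (D (k - 1))) / \<Delta>t
        + (a (V (k + 1)) (V k) - a (V k) (V (k - 1))) / \<Delta>t = F k W"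
      using step[OF k W] unfolding 1 2 .
    then have "(b (D k) (D k) - b (D (k - 1)) (D (k - 1))) + (a (V (k + 1)) (V k) - a (V k) (V (k - 1))) = \<Delta>t * F k W"
      unfolding add_divide_distrib[symmetric] using dt by (simp only: nonzero_divide_eq_eq mult.commute)
    moreover have "2 * (E k - E (k - 1)) = (b (D k) (D k) - b (D (k - 1)) (D (k - 1)))
        + (a (V (k + 1)) (V k) - a (V k) (V (k - 1)))"
      unfolding E_def k1(2) by (simp add: diff_divide_distrib add_divide_distrib)
    ultimately have eq: "2 * (E k - E (k - 1)) = \<Delta>t * F k W" by simp
    have "F k W \<le> p k * b.N W" using F[OF k W] by (simp add: b.N_def)
    also have "\<dots> \<le> p k * (2 * sqrt (E k) + 2 * sqrt (E (k - 1)))"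
      using b.N_triangle[OF D1, of 1 1] ND[OF k(2)] ND[OF k1(1)] p[of k] k
      by (intro mult_left_mono) (auto simp: W_def)
    finally have "\<Delta>t * F k W \<le> \<Delta>t * (p k * (2 * sqrt (E k) + 2 * sqrt (E (k - 1))))"
      using dt by simp
    then have ineq: "E k - E (k - 1) \<le> \<Delta>t * p k * (sqrt (E k) + sqrt (E (k - 1)))"
      using eq by (simp add: algebra_simps)
    have e: "0 \<le> E k" "0 \<le> E (k - 1)" using E0 k k1 by auto
    have "(sqrt (E k) - sqrt (E (k - 1))) * (sqrt (E k) + sqrt (E (k - 1))) = E k - E (k - 1)"
      using e by (simp add: algebra_simps)
    with ineq have m: "(sqrt (E k) - sqrt (E (k - 1))) * (sqrt (E k) + sqrt (E (k - 1)))
        \<le> (\<Delta>t * p k) * (sqrt (E k) + sqrt (E (k - 1)))" by simp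
    show ?thesis
    \<comment> \<open>The common factor of m is cancelled when it is positive. If it is 0, both
      roots vanish and only nonnegativity of \<Delta>t p k remains.\<close>
    proof (cases "sqrt (E k) + sqrt (E (k - 1)) = 0")
      case True
      have "0 \<le> sqrt (E k)" "0 \<le> sqrt (E (k - 1))" "0 \<le> \<Delta>t * p k" using e dt p[of k] k by auto
      then show ?thesis using True by linarith
    next
      case False
      have "0 \<le> sqrt (E k)" "0 \<le> sqrt (E (k - 1))" using e by auto
      then have "0 < sqrt (E k) + sqrt (E (k - 1))" using False by linarith
      then show ?thesis using m by (simp add: mult_le_cancel_right)
    qed
  qed
  have sumE: "sqrt (E n) \<le> sqrt (E 0) + (\<Sum>k=1..n. \<Delta>t * p k)" if "n < K" for n
    using that
  proof (induction n)
    case (Suc n)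
    then show ?case using incr[of "Suc n"] by simp
  qed simp
  have K: "0 < K" using l by auto
  define x where "x = sqrt (b (dq \<Delta>t V 1) (dq \<Delta>t V 1))"
  define q where "q = sqrt (a (V 0) (V 0))"
  define r where "r = sqrt (a (V 1) (V 1))"
  have xqr: "0 \<le> x" "0 \<le> q" "0 \<le> r"
    using DS[OF K] V[of 0] V[of 1] K by (auto simp: x_def q_def r_def D_def a.nonneg b.nonneg)
  \<comment> \<open>The energy at index 0 involves V 0, V 1 and the first difference quotient only;
    its mixed product is estimated by Cauchy-Schwarz.\<close>
  have "E 0 \<le> (x + q + r)\<^sup>2"
  proof -
    have "b (D 0) (D 0) = x\<^sup>2" using b.nonneg[OF DS[OF K]] by (simp add: x_def D_def)
    moreover have "a (V 1) (V 0) \<le> r * q"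
      using a.cauchy_schwarz[of "V 1" "V 0"] V[of 0] V[of 1] K by (simp add: q_def r_def a.N_def)
    ultimately have "E 0 \<le> x\<^sup>2 / 2 + r * q / 2" by (simp add: E_def)
    moreover have "(x + q + r)\<^sup>2 = x\<^sup>2 + q * q + r * r + 2 * (x * q) + 2 * (x * r) + 2 * (r * q)"
      by (simp add: power2_eq_square algebra_simps)
    ultimately show "E 0 \<le> (x + q + r)\<^sup>2"
      using mult_nonneg_nonneg[OF xqr(2,2)] mult_nonneg_nonneg[OF xqr(3,3)] zero_le_power2[of x]
        mult_nonneg_nonneg[OF xqr(1,2)] mult_nonneg_nonneg[OF xqr(1,3)] mult_nonneg_nonneg[OF xqr(3,2)]
      by linarith
  qed
  then have "sqrt (E 0) \<le> x + q + r" using xqr by (intro real_le_lsqrt) auto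
  \<comment> \<open>The energy with index n is built from V (n + 1) and V n, so V l and the
    difference quotient at l are read off at n = l - 1.\<close>
  moreover define n where "n = l - 1"
  have n: "n < K" "n + 1 = l" using l by (auto simp: n_def)
  ultimately have En: "sqrt (E n) \<le> x + q + r + (\<Sum>k=1..n. \<Delta>t * p k)" using sumE[OF n(1)] by linarith
  \<comment> \<open>The steps up to l - 1 produce the shorter sum. The added last term is
    nonnegative, which for l = K uses the assumption on p at K itself.\<close>
  have "(\<Sum>k=1..n. \<Delta>t * p k) \<le> (\<Sum>k=1..l. \<Delta>t * p k)"
    using n p l dt by (intro sum_mono2) auto
  with En have El: "sqrt (E n) \<le> x + q + r + (\<Sum>k=1..l. \<Delta>t * p k)" by linarith
  have sE: "0 \<le> sqrt (E n)" using E0[OF n(1)] by simp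
  \<comment> \<open>V l is half the sum plus half the difference of the last two iterates.
    Coercivity bounds the squared energy norm of either by 8 E, and 8 \<le> 3^2. Together with the
    factor 2 for the difference quotient this yields the constant 5.\<close>
  have "a.N (V l) \<le> 3 * sqrt (E n)"
  proof -
    have s9: "sqrt y \<le> 3 * sqrt (E n)" if "y \<le> 8 * E n" for y
    proof -
      have "sqrt y \<le> sqrt (3\<^sup>2 * E n)" using that E0[OF n(1)] by (intro real_sqrt_le_mono) simp
      then show ?thesis by (simp only: real_sqrt_mult real_sqrt_abs abs_numeral)
    qed
    have "a.N (\<lambda>z. V (n + 1) z + V n z) \<le> 3 * sqrt (E n)"
      unfolding a.N_def using coer[OF n(1)] b.nonneg[OF DS[OF n(1)]] by (intro s9) simp
    moreover have "a.N (\<lambda>z. V (n + 1) z - V n z) \<le> 3 * sqrt (E n)"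
      unfolding a.N_def using coer[OF n(1)] a.nonneg[OF Vs(1)[OF n(1)]] inv'[OF n(1)] by (intro s9) simp
    moreover have "V l = (\<lambda>z. (1 / 2) * (V (n + 1) z + V n z) + (1 / 2) * (V (n + 1) z - V n z))"
      unfolding n(2)[symmetric] by (auto simp: algebra_simps)
    then have "a.N (V l) \<le> 1 / 2 * a.N (\<lambda>z. V (n + 1) z + V n z) + 1 / 2 * a.N (\<lambda>z. V (n + 1) z - V n z)"
      using a.N_triangle[OF Vs[OF n(1)], of "1 / 2" "1 / 2"] by simp
    ultimately show ?thesis by linarith
  qed
  moreover have "sqrt (b (dq \<Delta>t V l) (dq \<Delta>t V l)) \<le> 2 * sqrt (E n)"
    using ND[OF n(1)] unfolding D_def n(2) b.N_def .
  ultimately have "sqrt (b (dq \<Delta>t V l) (dq \<Delta>t V l)) + a.N (V l) \<le> 5 * sqrt (E n)" by linarith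
  also have "\<dots> \<le> 5 * (x + q + r + (\<Sum>k=1..l. \<Delta>t * p k))" using El by (intro mult_left_mono) auto
  finally show ?thesis unfolding x_def q_def r_def a.N_def .
qed

section \<open>The leapfrog scheme as an instance of the energy argument\<close>

context discrete_problem
begin

text \<open>Replaces \<open>tr\<close> by actual bottom values, which are pointwise linear in W; the
  chosen trace agrees with them almost everywhere, hence in every L2 product.\<close>

abbreviation bottom :: "((real^'n) \<times> real \<Rightarrow> real) \<Rightarrow> real^'n \<Rightarrow> real" where
  "bottom W \<equiv> (\<lambda>x. W (x, 0))"

lemma bottom_L2: "W \<in> \<V> \<Longrightarrow> bottom W \<in> L2 \<Omega>"
  by (intro continuous_on_closure_L2 V_bottom_continuous)

lemma tr_eq_bottom_AE:
  assumes "W \<in> \<V>"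
  shows "AE x in lebesgue_on \<Omega>. tr \<Omega> s Y W x = W (x, 0)"
proof (rule trace_unique)
  show "has_trace \<Omega> s Y W (tr \<Omega> s Y W)"
    unfolding tr_def by (rule someI[where P="has_trace \<Omega> s Y W"]) (rule V_has_trace[OF assms])
  show "has_trace \<Omega> s Y W (bottom W)" by (rule V_has_trace[OF assms])
qed

lemma L2_measurable: "f \<in> L2 \<Omega> \<Longrightarrow> f \<in> borel_measurable (lebesgue_on \<Omega>)"
  by (auto simp: L2_def L2w_def)

lemma L2_inner_tr: "W \<in> \<V> \<Longrightarrow> W' \<in> \<V> \<Longrightarrow> L2_inner \<Omega> (tr \<Omega> s Y W) (tr \<Omega> s Y W') = L2_inner \<Omega> (bottom W) (bottom W')"
  by (intro L2_inner_cong_AE[OF Omega(5)] L2_measurable bottom_L2 tr_eq_bottom_AE)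

lemma L2_inner_tr_right: "f \<in> L2 \<Omega> \<Longrightarrow> W \<in> \<V> \<Longrightarrow> L2_inner \<Omega> f (tr \<Omega> s Y W) = L2_inner \<Omega> f (bottom W)"
  by (intro L2_inner_cong_AE[OF Omega(5)] L2_measurable bottom_L2 tr_eq_bottom_AE AE_I2 refl)

lemma L2_norm_tr: "W \<in> \<V> \<Longrightarrow> L2_norm \<Omega> (tr \<Omega> s Y W) = sqrt (L2_inner \<Omega> (bottom W) (bottom W))"
  by (simp add: L2_norm_def L2_inner_tr)

lemma semi_inner_bottom: "semi_inner \<V> (\<lambda>u v. L2_inner \<Omega> (bottom u) (bottom v))"
proof -
  interpret l: semi_inner "L2 \<Omega>" "L2_inner \<Omega>" by (rule semi_inner_L2[OF Omega(1)])
  show ?thesis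
    by unfold_locales
      (auto intro: V_space_zero V_space_lincomb l.lincomb_left l.sym l.nonneg bottom_L2)
qed

lemma semi_inner_a_V: "semi_inner \<V> a"
proof -
  interpret a: semi_inner "H1w \<rho> C" a by (rule semi_inner_a)
  show ?thesis using V_H1w by (intro a.semi_inner_subset V_space_zero V_space_lincomb) auto
qed

text \<open>The property common to all iterates and preserved by differences: V 0 and V 1 inherit it
  from the harmonic extensions they project, the later ones from the extension condition of the
  scheme.\<close>

definition discrete_harmonic :: "((real^'n) \<times> real \<Rightarrow> real) \<Rightarrow> bool" where
  "discrete_harmonic X \<longleftrightarrow> X \<in> \<V> \<and> (\<forall>W\<in>\<V>. has_trace \<Omega> s Y W (\<lambda>_. 0) \<longrightarrow> a X W = 0)"

lemma discrete_harmonic_diff: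
  assumes "discrete_harmonic X" "discrete_harmonic X'"
  shows "discrete_harmonic (\<lambda>z. X z - X' z)"
proof -
  interpret a: semi_inner \<V> a by (rule semi_inner_a_V)
  show ?thesis using assms by (auto simp: discrete_harmonic_def a.diff_left a.diff_mem)
qed

text \<open>On the finite-dimensional space of traces, the functional \<open>a(X, \<cdot>)\<close> is represented by an \<open>L\<^sup>2\<close>
  function, so that the inverse inequality applies to \<open>X\<close>.\<close>

lemma discrete_harmonic_inverse_inequality:
  assumes eig: "dirichlet_eigensystem \<Omega> A c \<mu> \<phi>" and X: "discrete_harmonic X"
    and inv: "inverse_inequality \<Omega> A c \<mu> \<phi> s Y \<V> h Cinv"
  shows "a X X \<le> (Cinv * h powr (- s))\<^sup>2 * L2_inner \<Omega> (bottom X) (bottom X)"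
proof -
  interpret a: semi_inner \<V> a by (rule semi_inner_a_V)
  interpret b: semi_inner \<V> "\<lambda>u v. L2_inner \<Omega> (bottom u) (bottom v)" by (rule semi_inner_bottom)
  have XV: "X \<in> \<V>" and harm: "\<And>W. W \<in> \<V> \<Longrightarrow> has_trace \<Omega> s Y W (\<lambda>_. 0) \<Longrightarrow> a X W = 0"
    using X by (auto simp: discrete_harmonic_def)
  obtain P where P: "finite P" "\<And>W. W \<in> \<V> \<Longrightarrow> (\<forall>z\<in>P. W z = 0) \<Longrightarrow> (\<forall>x\<in>closure \<Omega>. W (x, 0) = 0)"
    using V_determining_points by metis
  have "\<exists>Z\<in>\<V>. \<forall>W\<in>\<V>. a X W = L2_inner \<Omega> (bottom Z) (bottom W)"
  proof (rule b.riesz_representation[OF P(1) subset_refl])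
    show "(\<lambda>_. 0) \<in> \<V>" by (rule V_space_zero)
    show "(\<lambda>z. r * u z + t * v z) \<in> \<V>" if "u \<in> \<V>" "v \<in> \<V>" for u v r t
      using that by (rule V_space_lincomb)
    show "L2_inner \<Omega> (bottom W) (bottom W) = 0" if "W \<in> \<V>" "\<forall>z\<in>P. W z = 0" for W
    proof -
      have "(LINT x|lebesgue_on \<Omega>. W (x, 0) * W (x, 0)) = (LINT x|lebesgue_on \<Omega>. 0)"
        using P(2)[OF that] closure_subset[of \<Omega>] by (intro Bochner_Integration.integral_cong) auto
      then show ?thesis by (simp add: L2_inner_def)
    qed
    show "a X (\<lambda>z. r * u z + t * v z) = r * a X u + t * a X v" if "u \<in> \<V>" "v \<in> \<V>" for u v r t
      using that XV by (rule a.lincomb_right)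
    \<comment> \<open>Here discrete harmonicity enters: a null vector of the bottom product has zero
      trace, so the energy functional of X descends to traces.\<close>
    show "a X W = 0" if W: "W \<in> \<V>" "L2_inner \<Omega> (bottom W) (bottom W) = 0" for W
    proof (rule harm[OF W(1)])
      have "L2_norm \<Omega> (\<lambda>x. W (x, 0) - 0) = 0" using W(2) by (simp add: L2_norm_def)
      then show "has_trace \<Omega> s Y W (\<lambda>_. 0)"
        unfolding has_trace_def
        using V_H1w[OF W(1)] V_continuous[OF W(1)] H1w_tendsto_const[of W] continuous_on_closure_L2[of "\<lambda>_. 0"]
        by (intro conjI exI[of _ "\<lambda>_. W"]) auto
    qed
  qed
  then obtain Z where Z: "Z \<in> \<V>" "\<forall>W\<in>\<V>. a X W = L2_inner \<Omega> (bottom Z) (bottom W)" by blast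
  have "\<forall>W\<in>\<V>. a X W = L2_inner \<Omega> (bottom Z) (tr \<Omega> s Y W)"
    using Z L2_inner_tr_right[OF bottom_L2[OF Z(1)]] by simp
  moreover have "L2_inner \<Omega> (bottom Z) \<in> Hs_dual \<Omega> \<mu> \<phi> s"
    by (rule L2_inner_Hs_dual[OF eig bottom_L2[OF Z(1)]])
  ultimately have "C_norm \<Omega> A c s Y X \<le> Cinv * h powr (- s) * L2_norm \<Omega> (tr \<Omega> s Y X)"
    using inv XV unfolding inverse_inequality_def by blast
  then have "sqrt (a X X) \<le> Cinv * h powr (- s) * sqrt (L2_inner \<Omega> (bottom X) (bottom X))"
    by (simp add: C_norm_def L2_norm_tr[OF XV])
  then have "(sqrt (a X X))\<^sup>2 \<le> (Cinv * h powr (- s) * sqrt (L2_inner \<Omega> (bottom X) (bottom X)))\<^sup>2"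
    using a.nonneg[OF XV] by (intro power_mono) auto
  then show ?thesis
    using a.nonneg[OF XV] b.nonneg[OF XV] by (simp add: power_mult_distrib)
qed

lemma galerkin_projection_harmonic:
  assumes "is_galerkin_projection \<Omega> A c s Y \<V> w X"
    "\<And>W. W \<in> \<V> \<Longrightarrow> has_trace \<Omega> s Y W (\<lambda>_. 0) \<Longrightarrow> a w W = 0"
  shows "discrete_harmonic X"
  using assms by (auto simp: is_galerkin_projection_def discrete_harmonic_def)

lemma harmonic_extensionD:
  assumes "is_harmonic_extension \<Omega> A c s Y w u"
  shows "u \<in> H1w \<rho> C" "\<And>W. W \<in> \<V> \<Longrightarrow> has_trace \<Omega> s Y W (\<lambda>_. 0) \<Longrightarrow> a u W = 0"
  using assms V_HL by (auto simp: is_harmonic_extension_def HL_def H1w_vanishing_def)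

lemma leapfrog_discrete_harmonic:
  assumes init: "leapfrog_initial \<Omega> A c \<mu> \<phi> s Y \<V> \<Delta>t f g h V"
    and steps: "leapfrog_steps \<Omega> A c s Y \<V> K \<Delta>t f V" and "k \<le> K"
  shows "discrete_harmonic (V k)"
proof -
  interpret a: semi_inner "H1w \<rho> C" a by (rule semi_inner_a)
  obtain w Hg Hh Hw where H: "is_harmonic_extension \<Omega> A c s Y g Hg" "is_harmonic_extension \<Omega> A c s Y h Hh"
      "is_harmonic_extension \<Omega> A c s Y w Hw" "is_galerkin_projection \<Omega> A c s Y \<V> Hg (V 0)"
      "is_galerkin_projection \<Omega> A c s Y \<V> (\<lambda>z. Hg z + \<Delta>t * Hh z + \<Delta>t\<^sup>2 / 2 * Hw z) (V 1)"
    using init unfolding leapfrog_initial_def by blast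
  consider "k = 0" | "k = 1" | j where "k = j + 1" "1 \<le> j" "j < K"
    using \<open>k \<le> K\<close> by (metis One_nat_def Suc_eq_plus1 Suc_le_eq less_one linorder_cases not0_implies_Suc not_less_eq zero_less_Suc)
  then show ?thesis
  proof cases
    case 1
    then show ?thesis using galerkin_projection_harmonic[OF H(4) harmonic_extensionD(2)[OF H(1)]] by simp
  next
    case 2
    \<comment> \<open>Linearity of the energy form on the weighted Sobolev space: each of the three
      extensions is orthogonal to W separately.\<close>
    have "a (\<lambda>z. Hg z + \<Delta>t * Hh z + \<Delta>t\<^sup>2 / 2 * Hw z) W = 0" if W: "W \<in> \<V>" "has_trace \<Omega> s Y W (\<lambda>_. 0)" for W
    proof -
      note m = harmonic_extensionD(1)[OF H(1)] harmonic_extensionD(1)[OF H(2)] harmonic_extensionD(1)[OF H(3)] V_H1w[OF W(1)]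
      note z = harmonic_extensionD(2)[OF H(1) W] harmonic_extensionD(2)[OF H(2) W] harmonic_extensionD(2)[OF H(3) W]
      have "(\<lambda>z. Hg z + \<Delta>t * Hh z + \<Delta>t\<^sup>2 / 2 * Hw z) = (\<lambda>z. 1 * (1 * Hg z + \<Delta>t * Hh z) + \<Delta>t\<^sup>2 / 2 * Hw z)"
        by simp
      then show ?thesis
        using a.lincomb_left[OF a.lincomb_mem[OF m(1,2), of 1 \<Delta>t] m(3,4), of 1 "\<Delta>t\<^sup>2 / 2"]
          a.lincomb_left[OF m(1,2,4), of 1 \<Delta>t] z by simp
    qed
    then show ?thesis using galerkin_projection_harmonic[OF H(5)] 2 by simp
  next
    case 3
    then show ?thesis using steps unfolding leapfrog_steps_def discrete_harmonic_def by blast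
  qed
qed

theorem leapfrog_stability:
  assumes eig: "dirichlet_eigensystem \<Omega> A c \<mu> \<phi>"
    and inv: "inverse_inequality \<Omega> A c \<mu> \<phi> s Y \<V> h0 Cinv"
    and T: "0 < T" and \<Delta>t: "\<Delta>t = T / real K"
    and f: "continuous_L2_valued T \<Omega> f"
    and init: "leapfrog_initial \<Omega> A c \<mu> \<phi> s Y \<V> \<Delta>t f g h V"
    and steps: "leapfrog_steps \<Omega> A c s Y \<V> K \<Delta>t f V"
    and cfl: "Cinv\<^sup>2 * (\<Delta>t\<^sup>2 / (2 * h0 powr (2 * s))) \<le> 1"
    and l: "l \<in> {1..K}"
  shows "L2_norm \<Omega> (tr \<Omega> s Y (dq \<Delta>t V l)) + C_norm \<Omega> A c s Y (V l)
      \<le> 5 * (L2_norm \<Omega> (tr \<Omega> s Y (dq \<Delta>t V 1)) + C_norm \<Omega> A c s Y (V 0) + C_norm \<Omega> A c s Y (V 1)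
             + (\<Sum>k=1..l. \<Delta>t * L2_norm \<Omega> (f (real k * \<Delta>t))))"
proof -
  interpret b: semi_inner \<V> "\<lambda>u v. L2_inner \<Omega> (bottom u) (bottom v)" by (rule semi_inner_bottom)
  interpret L: semi_inner "L2 \<Omega>" "L2_inner \<Omega>" by (rule semi_inner_L2[OF Omega(1)])
  have K: "1 \<le> K" using l by auto
  have dt: "0 < \<Delta>t" using T K by (simp add: \<Delta>t)
  have harm: "discrete_harmonic (V k)" if "k \<le> K" for k
    using leapfrog_discrete_harmonic[OF init steps that] .
  have V: "V k \<in> \<V>" if "k \<le> K" for k using harm[OF that] by (simp add: discrete_harmonic_def)
  have fL: "f (real k * \<Delta>t) \<in> L2 \<Omega>" if "k \<le> K" for k
  proof -
    \<comment> \<open>The data f are known to be square integrable only at times in [0,T], so each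
      grid time has to be located there.\<close>
    have "real k * \<Delta>t \<le> real K * \<Delta>t" using that dt by (intro mult_right_mono) auto
    also have "\<dots> = T" using K by (simp add: \<Delta>t)
    finally show ?thesis using f dt by (auto simp: continuous_L2_valued_def)
  qed
  have dqV: "dq \<Delta>t V k \<in> \<V>" if "k \<le> K" for k
  proof -
    have "dq \<Delta>t V k = (\<lambda>z. (1 / \<Delta>t) * V k z + (- 1 / \<Delta>t) * V (k - 1) z)"
      by (auto simp: dq_def diff_divide_distrib)
    moreover have "(\<lambda>z. (1 / \<Delta>t) * V k z + (- 1 / \<Delta>t) * V (k - 1) z) \<in> \<V>"
      using V that by (intro V_space_lincomb) auto
    ultimately show ?thesis by (simp only:)
  qed
  have second: "(\<lambda>z. V (k + 1) z - 2 * V k z + V (k - 1) z) \<in> \<V>" if "k < K" for k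
  proof -
    have "(\<lambda>z. 1 * (1 * V (k + 1) z + (- 2) * V k z) + 1 * V (k - 1) z) \<in> \<V>"
      using V that by (intro V_space_lincomb) auto
    then show ?thesis by simp
  qed
  \<comment> \<open>Twice the quotient in the CFL condition: the 2 in its denominator becomes the
    factor 2 in the difference bound of the energy estimate.\<close>
  have kappa: "\<Delta>t\<^sup>2 * (Cinv * h0 powr (- s))\<^sup>2 \<le> 2"
  proof -
    have "(h0 powr (- s))\<^sup>2 = 1 / h0 powr (2 * s)"
      using powr_add[of h0 s s] by (simp add: power2_eq_square powr_minus divide_inverse)
    then have "\<Delta>t\<^sup>2 * (Cinv * h0 powr (- s))\<^sup>2 = 2 * (Cinv\<^sup>2 * (\<Delta>t\<^sup>2 / (2 * h0 powr (2 * s))))"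
      by (simp add: power_mult_distrib)
    then show ?thesis using cfl by linarith
  qed
  have "sqrt (L2_inner \<Omega> (bottom (dq \<Delta>t V l)) (bottom (dq \<Delta>t V l))) + sqrt (a (V l) (V l))
    \<le> 5 * (sqrt (L2_inner \<Omega> (bottom (dq \<Delta>t V 1)) (bottom (dq \<Delta>t V 1))) + sqrt (a (V 0) (V 0)) + sqrt (a (V 1) (V 1))
          + (\<Sum>k=1..l. \<Delta>t * L2_norm \<Omega> (f (real k * \<Delta>t))))"
  proof (rule leapfrog_energy_estimate[where S=\<V> and K=K and V=V and \<Delta>t=\<Delta>t and l=l
        and a=a and p="\<lambda>k. L2_norm \<Omega> (f (real k * \<Delta>t))" and b="\<lambda>u v. L2_inner \<Omega> (bottom u) (bottom v)"
        and F="\<lambda>k W. L2_inner \<Omega> (f (real k * \<Delta>t)) (bottom W)"])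
    show "semi_inner \<V> a" by (rule semi_inner_a_V)
    show "semi_inner \<V> (\<lambda>u v. L2_inner \<Omega> (bottom u) (bottom v))" by (rule semi_inner_bottom)
    fix k
    show "V k \<in> \<V>" if "k \<le> K" using V[OF that] .
    show "1 / \<Delta>t\<^sup>2 * L2_inner \<Omega> (bottom (\<lambda>z. V (k + 1) z - 2 * V k z + V (k - 1) z)) (bottom W) + a (V k) W
        = L2_inner \<Omega> (f (real k * \<Delta>t)) (bottom W)" if k: "1 \<le> k" "k < K" and W: "W \<in> \<V>" for W
    proof -
      have "1 / \<Delta>t\<^sup>2 * L2_inner \<Omega> (tr \<Omega> s Y (\<lambda>z. V (k + 1) z - 2 * V k z + V (k - 1) z)) (tr \<Omega> s Y W)
           + a (V k) W = L2_inner \<Omega> (f (real k * \<Delta>t)) (tr \<Omega> s Y W)"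
        using steps k W unfolding leapfrog_steps_def by blast
      then show ?thesis
        using L2_inner_tr[OF second[OF k(2)] W] L2_inner_tr_right[OF fL W, of k] k by simp
    qed
    show "\<bar>L2_inner \<Omega> (f (real k * \<Delta>t)) (bottom W)\<bar>
        \<le> L2_norm \<Omega> (f (real k * \<Delta>t)) * sqrt (L2_inner \<Omega> (bottom W) (bottom W))"
      if "1 \<le> k" "k < K" "W \<in> \<V>" for W
      using L.cauchy_schwarz[OF fL bottom_L2[OF that(3)], of k] that by (simp add: L.N_def L2_norm_def)
    show "0 \<le> L2_norm \<Omega> (f (real k * \<Delta>t))" if "k \<le> K"
      using L.N_nonneg[OF fL[OF that]] by (simp add: L.N_def L2_norm_def)
    let ?d = "\<lambda>z. V (k + 1) z - V k z"
    show "\<Delta>t\<^sup>2 * a ?d ?d \<le> 2 * L2_inner \<Omega> (bottom ?d) (bottom ?d)" if "k < K"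
    proof -
      have X: "discrete_harmonic ?d" using harm that by (intro discrete_harmonic_diff) auto
      then have "?d \<in> \<V>" by (simp add: discrete_harmonic_def)
      note nn = b.nonneg[OF this]
      have "\<Delta>t\<^sup>2 * a ?d ?d \<le> \<Delta>t\<^sup>2 * ((Cinv * h0 powr (- s))\<^sup>2 * L2_inner \<Omega> (bottom ?d) (bottom ?d))"
        by (intro mult_left_mono discrete_harmonic_inverse_inequality[OF eig X inv]) auto
      also have "\<dots> \<le> 2 * L2_inner \<Omega> (bottom ?d) (bottom ?d)"
        using mult_right_mono[OF kappa nn] by (simp add: mult.assoc)
      finally show ?thesis .
    qed
  qed (use dt l in auto)
  then show ?thesis
    using L2_norm_tr[OF dqV, of l] L2_norm_tr[OF dqV, of 1] l by (simp add: C_norm_def)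
qed

end

theorem lemma6p12:
  fixes \<Omega> :: "(real^'n) set"
    and A :: "real^'n \<Rightarrow> real^'n^'n"
    and c :: "real^'n \<Rightarrow> real"
    and \<mu> :: "nat \<Rightarrow> real"
    and \<phi> :: "nat \<Rightarrow> real^'n \<Rightarrow> real"
    and s T \<theta> :: real
  assumes "open_convex_polytope \<Omega>"
    and "admissible_coefficients \<Omega> A c"
    and "dirichlet_eigensystem \<Omega> A c \<mu> \<phi>"
    and "0 < s" "s < 1"
    and "0 < T"
    and "0 < \<theta>" "\<theta> < 1"
  shows "\<exists>C>0. \<forall>Y \<sigma> \<ss> M \<T> Cinv K f g h V \<V> \<Delta>t.
    0 < Y \<and> 0 < \<sigma> \<and> \<sigma> < 1 \<and> 1 \<le> M \<and> 1 \<le> K \<and>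
    simplicial_mesh \<Omega> \<T> \<and>
    \<V> = V_space \<Omega> \<T> Y \<sigma> M \<ss> \<and>
    0 < Cinv \<and> inverse_inequality \<Omega> A c \<mu> \<phi> s Y \<V> (mesh_size \<T>) Cinv \<and>
    \<Delta>t = T / real K \<and>
    continuous_L2_valued T \<Omega> f \<and>
    leapfrog_initial \<Omega> A c \<mu> \<phi> s Y \<V> \<Delta>t f g h V \<and>
    leapfrog_steps \<Omega> A c s Y \<V> K \<Delta>t f V \<and>
    1 - Cinv\<^sup>2 * (\<Delta>t\<^sup>2 / (2 * mesh_size \<T> powr (2 * s))) \<ge> \<theta>
    \<longrightarrow> (\<forall>l\<in>{1..K}.
      L2_norm \<Omega> (tr \<Omega> s Y (dq \<Delta>t V l)) + C_norm \<Omega> A c s Y (V l)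
      \<le> C * (L2_norm \<Omega> (tr \<Omega> s Y (dq \<Delta>t V 1)) + C_norm \<Omega> A c s Y (V 0) + C_norm \<Omega> A c s Y (V 1)
             + (\<Sum>k=1..l. \<Delta>t * L2_norm \<Omega> (f (real k * \<Delta>t)))))"
\<comment> \<open>The constant is that of the energy estimate, 2 for the difference quotient plus 3
  for the energy norm, and is fixed before any discretization parameter.\<close>
proof (intro exI[of _ 5] conjI allI impI ballI)
  show "(0::real) < 5" by simp
next
  fix Y \<sigma> \<ss> M \<T> Cinv K f g h V \<V> \<Delta>t l
  assume H: "0 < Y \<and> 0 < \<sigma> \<and> \<sigma> < 1 \<and> 1 \<le> M \<and> 1 \<le> K \<and>
    simplicial_mesh \<Omega> \<T> \<and>
    \<V> = V_space \<Omega> \<T> Y \<sigma> M \<ss> \<and>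
    0 < Cinv \<and> inverse_inequality \<Omega> A c \<mu> \<phi> s Y \<V> (mesh_size \<T>) Cinv \<and>
    \<Delta>t = T / real K \<and>
    continuous_L2_valued T \<Omega> f \<and>
    leapfrog_initial \<Omega> A c \<mu> \<phi> s Y \<V> \<Delta>t f g h V \<and>
    leapfrog_steps \<Omega> A c s Y \<V> K \<Delta>t f V \<and>
    1 - Cinv\<^sup>2 * (\<Delta>t\<^sup>2 / (2 * mesh_size \<T> powr (2 * s))) \<ge> \<theta>"
    and l: "l \<in> {1..K}"
  then have eq: "\<V> = V_space \<Omega> \<T> Y \<sigma> M \<ss>" by blast
  interpret discrete_problem \<Omega> A c s Y \<T> \<sigma> M \<ss>
    using H assms(1,2,4,5) by unfold_locales auto
  show "L2_norm \<Omega> (tr \<Omega> s Y (dq \<Delta>t V l)) + C_norm \<Omega> A c s Y (V l)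
      \<le> 5 * (L2_norm \<Omega> (tr \<Omega> s Y (dq \<Delta>t V 1)) + C_norm \<Omega> A c s Y (V 0) + C_norm \<Omega> A c s Y (V 1)
             + (\<Sum>k=1..l. \<Delta>t * L2_norm \<Omega> (f (real k * \<Delta>t))))"
  proof (rule leapfrog_stability[OF assms(3) _ assms(6) _ _ _ _ _ l])
    show "Cinv\<^sup>2 * (\<Delta>t\<^sup>2 / (2 * mesh_size \<T> powr (2 * s))) \<le> 1"
      using H assms(7) by linarith
  qed (use H[unfolded eq] in blast)+
qed

end
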